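(* For no non-trivial compact regular formal space $S$ can the Gleason cover of $S$ be constructed in $\mathrm{CZF}^*$, $\mathrm{CTT}^*$.
   Context: Systems. CZF is Aczel's constructive set theory; CTT is Martin-Löf's constructive type theory. $\mathrm{CZF}^*$ denotes an arbitrary fixed extension of CZF consistent with the scheme GUP-CZF: for every set $I$, $(\forall x)(\exists y\in I)A(x,y)\to(\exists y\in I)(\forall x)A(x,y)$ ($x$ ranging over all sets). $\mathrm{CTT}^*$ denotes an arbitrary fixed extension of CTT consistent with GUP-CTT: for every set $I$, every $R$ mapping a proposition and an element of $I$ to a proposition, and every $F$ from propositions to $I$ with $R(P,F(P))$ for all $P$, there is $\bar i\in I$ with $R(P,\bar i)$ for all $P$. "Cannot be constructed in $T$" is a metamathematical statement: for no $S$ (given by a definition in $T$) that is a non-trivial compact regular formal space in $T$ are there a formal space $\gamma S$ and a map $\gamma S\to S$, given by definitions in $T$, that $T$ proves to be a Gleason cover of $S$. Formal spaces. A formal space is a pair $(S,\vartriangleleft)$ with $S$ a set and $\vartriangleleft$ a relation (a class in CZF) between elements and subsets of $S$ such that: $a\in U$ implies $a\vartriangleleft U$; $a\vartriangleleft U$ and $U\vartriangleleft V$ imply $a\vartriangleleft V$; $a\vartriangleleft U$ and $a\vartriangleleft V$ imply $a\vartriangleleft U\downarrow V$; and (in CZF) $\{a\in S:a\vartriangleleft U\}$ is a set for every $U\subseteq S$. Here $U\vartriangleleft V$ means $(\forall u\in U)\,u\vartriangleleft V$, $U\downarrow V\equiv\{d\in S:(\exists u\in U)\,d\vartriangleleft\{u\}\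 \&\ (\exists v\in V)\,d\vartriangleleft\{v\}\}$, and $a\downarrow U$ means $\{a\}\downarrow U$. $U=_SV$ means $U\vartriangleleft V$ and $V\vartriangleleft U$. The pseudocomplement of $U\subseteq S$ is $U^*\equiv\{a\in S:a\downarrow U\vartriangleleft\emptyset\}$. $S$ is non-trivial if $\neg(S\vartriangleleft\emptyset)$; De Morgan if $S\vartriangleleft U^{**}\cup U^*$ for all $U\subseteq S$; compact if $S\vartriangleleft U$ implies $S\vartriangleleft u_0$ for some finite $u_0\subseteq U$; regular if, in the usual sense, every $a\in S$ is covered by the elements $b$ well inside it ($S\vartriangleleft\{b\}^*\cup\{a\}$). A continuous function $S_2\to S_1$ of formal spaces is a morphism of formal topologies in the opposite direction, i.e. a map $f:S_1\to\mathsf{Pow}(S_2)$ with $f(S_1)=_{S_2}S_2$, $f(a)\downarrow f(b)\vartriangleleft f(a\downarrow b)$, and $a\vartriangleleft U$ implies $f(a)\vartriangleleft f(U)$, where $f(U)\equiv\bigcup_{a\in U}f(a)$; it is a surjection if $f(a)\vartriangleleft f(U)$ implies $a\vartriangleleft U$. The Gleason cover of a compact regular formal space $S$ is a minimal surjection $\gamma S\to S$ with $\gamma S$ a compact, regular, De Morgan formal space (minimal: its restriction to no proper closed subspace of $\gamma S$ is still a surjection). *)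

theory Defs
  imports Main
begin

section \<open>First-order set theory\<close>

text \<open>De Bruijn formulas of the language of set theory; the only terms are variables.\<close>

datatype fm =
    Mem nat nat
  | Eql nat nat
  | Bot
  | Conj fm fm
  | Disj fm fm
  | Impl fm fm
  | Forall fm
  | Exists fm

fun up :: "(nat \<Rightarrow> nat) \<Rightarrow> nat \<Rightarrow> nat" where
  "up r 0 = 0"
| "up r (Suc n) = Suc (r n)"

primrec rename :: "(nat \<Rightarrow> nat) \<Rightarrow> fm \<Rightarrow> fm" where
  "rename r (Mem i j) = Mem (r i) (r j)"
| "rename r (Eql i j) = Eql (r i) (r j)"
| "rename r Bot = Bot"
| "rename r (Conj p q) = Conj (rename r p) (rename r q)"
| "rename r (Disj p q) = Disj (rename r p) (rename r q)"
| "rename r (Impl p q) = Impl (rename r p) (rename r q)"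
| "rename r (Forall p) = Forall (rename (up r) p)"
| "rename r (Exists p) = Exists (rename (up r) p)"

primrec fv :: "fm \<Rightarrow> nat set" where
  "fv (Mem i j) = {i, j}"
| "fv (Eql i j) = {i, j}"
| "fv Bot = {}"
| "fv (Conj p q) = fv p \<union> fv q"
| "fv (Disj p q) = fv p \<union> fv q"
| "fv (Impl p q) = fv p \<union> fv q"
| "fv (Forall p) = {n. Suc n \<in> fv p}"
| "fv (Exists p) = {n. Suc n \<in> fv p}"

definition lift_fm :: "fm \<Rightarrow> fm" where
  "lift_fm = rename Suc"

definition inst0 :: "fm \<Rightarrow> nat \<Rightarrow> fm" where
  "inst0 p t = rename (\<lambda>n. case n of 0 \<Rightarrow> t | Suc m \<Rightarrow> m) p"

text \<open>Intuitionistic natural deduction with equality over a theory \<open>T\<close>. Free variables in a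
  member of \<open>T\<close> are implicitly universally quantified: the quantifier rules shift the local
  hypotheses, but not \<open>T\<close>.\<close>

inductive prv :: "fm set \<Rightarrow> fm list \<Rightarrow> fm \<Rightarrow> bool" for T :: "fm set" where
  axiom: "p \<in> T \<Longrightarrow> prv T H p"
| hyp: "p \<in> set H \<Longrightarrow> prv T H p"
| BotE: "prv T H Bot \<Longrightarrow> prv T H p"
| ConjI: "prv T H p \<Longrightarrow> prv T H q \<Longrightarrow> prv T H (Conj p q)"
| ConjE1: "prv T H (Conj p q) \<Longrightarrow> prv T H p"
| ConjE2: "prv T H (Conj p q) \<Longrightarrow> prv T H q"
| DisjI1: "prv T H p \<Longrightarrow> prv T H (Disj p q)"
| DisjI2: "prv T H q \<Longrightarrow> prv T H (Disj p q)"
| DisjE: "prv T H (Disj p q) \<Longrightarrow> prv T (p # H) r \<Longrightarrow> prv T (q # H) r \<Longrightarrow> prv T H r"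
| ImplI: "prv T (p # H) q \<Longrightarrow> prv T H (Impl p q)"
| ImplE: "prv T H (Impl p q) \<Longrightarrow> prv T H p \<Longrightarrow> prv T H q"
| ForallI: "prv T (map lift_fm H) p \<Longrightarrow> prv T H (Forall p)"
| ForallE: "prv T H (Forall p) \<Longrightarrow> prv T H (inst0 p t)"
| ExistsI: "prv T H (inst0 p t) \<Longrightarrow> prv T H (Exists p)"
| ExistsE: "prv T H (Exists p) \<Longrightarrow> prv T (p # map lift_fm H) (lift_fm q) \<Longrightarrow> prv T H q"
| EqlI: "prv T H (Eql t t)"
| EqlE: "prv T H (Eql s t) \<Longrightarrow> prv T H (inst0 p s) \<Longrightarrow> prv T H (inst0 p t)"

text \<open>Concrete syntax with host-level binders. A \<open>form\<close> is a formula waiting for the number of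
  enclosing binders; a \<open>var\<close> gives the de Bruijn index of a variable at a given depth, so that the
  variable bound at depth \<open>d\<close> has index \<open>e - Suc d\<close> at any depth \<open>e > d\<close>. A closed formula is
  obtained by evaluation at depth \<open>0\<close>.\<close>

type_synonym var = "nat \<Rightarrow> nat"
type_synonym form = "nat \<Rightarrow> fm"
type_synonym cls = "var \<Rightarrow> form"

definition fMem :: "var \<Rightarrow> var \<Rightarrow> form" (infix "\<^bold>\<in>" 50) where
  "(x \<^bold>\<in> y) = (\<lambda>d. Mem (x d) (y d))"
definition fEql :: "var \<Rightarrow> var \<Rightarrow> form" (infix "\<^bold>=" 50) where
  "(x \<^bold>= y) = (\<lambda>d. Eql (x d) (y d))"
definition fBot :: form ("\<^bold>\<bottom>") where
  "\<^bold>\<bottom> = (\<lambda>d. Bot)"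
definition fConj :: "form \<Rightarrow> form \<Rightarrow> form" (infixr "\<^bold>\<and>" 35) where
  "(P \<^bold>\<and> Q) = (\<lambda>d. Conj (P d) (Q d))"
definition fDisj :: "form \<Rightarrow> form \<Rightarrow> form" (infixr "\<^bold>\<or>" 30) where
  "(P \<^bold>\<or> Q) = (\<lambda>d. Disj (P d) (Q d))"
definition fImpl :: "form \<Rightarrow> form \<Rightarrow> form" (infixr "\<^bold>\<longrightarrow>" 25) where
  "(P \<^bold>\<longrightarrow> Q) = (\<lambda>d. Impl (P d) (Q d))"
definition fIff :: "form \<Rightarrow> form \<Rightarrow> form" (infixr "\<^bold>\<longleftrightarrow>" 25) where
  "(P \<^bold>\<longleftrightarrow> Q) = ((P \<^bold>\<longrightarrow> Q) \<^bold>\<and> (Q \<^bold>\<longrightarrow> P))"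
definition fNot :: "form \<Rightarrow> form" ("\<^bold>\<not> _" [40] 40) where
  "(\<^bold>\<not> P) = (P \<^bold>\<longrightarrow> \<^bold>\<bottom>)"
definition fAll :: "(var \<Rightarrow> form) \<Rightarrow> form" (binder "\<^bold>\<forall>" 10) where
  "fAll F = (\<lambda>d. Forall (F (\<lambda>e. e - Suc d) (Suc d)))"
definition fEx :: "(var \<Rightarrow> form) \<Rightarrow> form" (binder "\<^bold>\<exists>" 10) where
  "fEx F = (\<lambda>d. Exists (F (\<lambda>e. e - Suc d) (Suc d)))"
definition fBall :: "var \<Rightarrow> (var \<Rightarrow> form) \<Rightarrow> form" where
  "fBall a F = (\<^bold>\<forall>x. x \<^bold>\<in> a \<^bold>\<longrightarrow> F x)"
definition fBex :: "var \<Rightarrow> (var \<Rightarrow> form) \<Rightarrow> form" where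
  "fBex a F = (\<^bold>\<exists>x. x \<^bold>\<in> a \<^bold>\<and> F x)"
definition fEx1 :: "(var \<Rightarrow> form) \<Rightarrow> form" where
  "fEx1 F = (\<^bold>\<exists>x. F x \<^bold>\<and> (\<^bold>\<forall>y. F y \<^bold>\<longrightarrow> y \<^bold>= x))"

text \<open>\<open>inst p [x\<^sub>0, \<dots>]\<close> puts \<open>x\<^sub>i\<close> for the free variable \<open>i\<close> of \<open>p\<close>; the remaining free
  variables of \<open>p\<close> are parameters and stay free.\<close>

definition inst :: "fm \<Rightarrow> var list \<Rightarrow> form" where
  "inst p xs = (\<lambda>d. rename (\<lambda>n. if n < length xs then (xs ! n) d else n - length xs + d) p)"

definition proves :: "fm set \<Rightarrow> form \<Rightarrow> bool" where
  "proves T P \<longleftrightarrow> prv T [] (P 0)"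


section \<open>CZF and the uniformity scheme\<close>

inductive bounded_fm :: "fm \<Rightarrow> bool" where
  "bounded_fm (Mem i j)"
| "bounded_fm (Eql i j)"
| "bounded_fm Bot"
| "bounded_fm p \<Longrightarrow> bounded_fm q \<Longrightarrow> bounded_fm (Conj p q)"
| "bounded_fm p \<Longrightarrow> bounded_fm q \<Longrightarrow> bounded_fm (Disj p q)"
| "bounded_fm p \<Longrightarrow> bounded_fm q \<Longrightarrow> bounded_fm (Impl p q)"
| "bounded_fm p \<Longrightarrow> bounded_fm (Forall (Impl (Mem 0 (Suc j)) p))"
| "bounded_fm p \<Longrightarrow> bounded_fm (Exists (Conj (Mem 0 (Suc j)) p))"

definition subset_f :: "var \<Rightarrow> var \<Rightarrow> form" (infix "\<^bold>\<subseteq>" 50) where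
  "(a \<^bold>\<subseteq> b) = fBall a (\<lambda>x. x \<^bold>\<in> b)"
definition is_empty :: "var \<Rightarrow> form" where
  "is_empty z = (\<^bold>\<forall>x. \<^bold>\<not> x \<^bold>\<in> z)"
definition is_upair :: "var \<Rightarrow> var \<Rightarrow> var \<Rightarrow> form" where
  "is_upair z a b = (\<^bold>\<forall>x. x \<^bold>\<in> z \<^bold>\<longleftrightarrow> x \<^bold>= a \<^bold>\<or> x \<^bold>= b)"
definition is_pair :: "var \<Rightarrow> var \<Rightarrow> var \<Rightarrow> form" where
  "is_pair p a b = (\<^bold>\<forall>z. z \<^bold>\<in> p \<^bold>\<longleftrightarrow> is_upair z a a \<^bold>\<or> is_upair z a b)"
definition is_succ :: "var \<Rightarrow> var \<Rightarrow> form" where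
  "is_succ z y = (\<^bold>\<forall>x. x \<^bold>\<in> z \<^bold>\<longleftrightarrow> x \<^bold>\<in> y \<^bold>\<or> x \<^bold>= y)"
definition is_inductive :: "var \<Rightarrow> form" where
  "is_inductive w =
     (fBex w is_empty \<^bold>\<and> fBall w (\<lambda>y. fBex w (\<lambda>z. is_succ z y)))"
definition is_omega :: "var \<Rightarrow> form" where
  "is_omega w = (is_inductive w \<^bold>\<and> (\<^bold>\<forall>b. is_inductive b \<^bold>\<longrightarrow> w \<^bold>\<subseteq> b))"

definition extensionality :: form where
  "extensionality = (\<^bold>\<forall>a b. (\<^bold>\<forall>x. x \<^bold>\<in> a \<^bold>\<longleftrightarrow> x \<^bold>\<in> b) \<^bold>\<longrightarrow> a \<^bold>= b)"
definition pairing :: form where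
  "pairing = (\<^bold>\<forall>a b. \<^bold>\<exists>z. is_upair z a b)"
definition union_ax :: form where
  "union_ax = (\<^bold>\<forall>a. \<^bold>\<exists>z. \<^bold>\<forall>x. x \<^bold>\<in> z \<^bold>\<longleftrightarrow> fBex a (\<lambda>y. x \<^bold>\<in> y))"
definition strong_infinity :: form where
  "strong_infinity = (\<^bold>\<exists>w. is_omega w)"
definition set_induction :: "fm \<Rightarrow> form" where
  "set_induction p =
     ((\<^bold>\<forall>a. fBall a (\<lambda>x. inst p [x]) \<^bold>\<longrightarrow> inst p [a]) \<^bold>\<longrightarrow> (\<^bold>\<forall>a. inst p [a]))"
definition separation :: "fm \<Rightarrow> form" where
  "separation p = (\<^bold>\<forall>a. \<^bold>\<exists>z. \<^bold>\<forall>x. x \<^bold>\<in> z \<^bold>\<longleftrightarrow> x \<^bold>\<in> a \<^bold>\<and> inst p [x])"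
definition strong_collection :: "fm \<Rightarrow> form" where
  "strong_collection p =
     (\<^bold>\<forall>a. fBall a (\<lambda>x. \<^bold>\<exists>y. inst p [x, y]) \<^bold>\<longrightarrow>
        (\<^bold>\<exists>b. fBall a (\<lambda>x. fBex b (\<lambda>y. inst p [x, y])) \<^bold>\<and>
             fBall b (\<lambda>y. fBex a (\<lambda>x. inst p [x, y]))))"
definition subset_collection :: "fm \<Rightarrow> form" where
  "subset_collection p =
     (\<^bold>\<forall>a b. \<^bold>\<exists>c. \<^bold>\<forall>u. fBall a (\<lambda>x. fBex b (\<lambda>y. inst p [x, y, u])) \<^bold>\<longrightarrow>
        fBex c (\<lambda>d. fBall a (\<lambda>x. fBex d (\<lambda>y. inst p [x, y, u])) \<^bold>\<and>
                    fBall d (\<lambda>y. fBex a (\<lambda>x. inst p [x, y, u]))))"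

definition CZF :: "fm set" where
  "CZF = {extensionality 0, pairing 0, union_ax 0, strong_infinity 0}
       \<union> {set_induction p 0 | p. True}
       \<union> {separation p 0 | p. bounded_fm p}
       \<union> {strong_collection p 0 | p. True}
       \<union> {subset_collection p 0 | p. True}"

definition GUP_CZF :: "fm set" where
  "GUP_CZF = {(\<^bold>\<forall>I. (\<^bold>\<forall>x. fBex I (\<lambda>y. inst p [x, y])) \<^bold>\<longrightarrow>
                   fBex I (\<lambda>y. \<^bold>\<forall>x. inst p [x, y])) 0 | p. True}"

definition consistent_fm :: "fm set \<Rightarrow> bool" where
  "consistent_fm T \<longleftrightarrow> \<not> proves T \<^bold>\<bottom>"


section \<open>Formal spaces in set theory\<close>

text \<open>Below, \<open>S\<close> is the base set and \<open>C a U\<close> is the cover class, with \<open>U\<close> a set. Subsets of \<open>S\<close>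
  are given by classes; \<open>cz_cov\<close> asserts that the class cuts out a set that covers.\<close>

definition elem_of :: "var \<Rightarrow> cls" where
  "elem_of U = (\<lambda>x. x \<^bold>\<in> U)"
definition cz_empty :: cls where
  "cz_empty = (\<lambda>x. \<^bold>\<bottom>)"
definition cz_sing :: "var \<Rightarrow> cls" where
  "cz_sing a = (\<lambda>x. x \<^bold>= a)"
definition cz_cup :: "cls \<Rightarrow> cls \<Rightarrow> cls" where
  "cz_cup P Q = (\<lambda>x. P x \<^bold>\<or> Q x)"

definition cz_cov :: "var \<Rightarrow> (var \<Rightarrow> cls) \<Rightarrow> var \<Rightarrow> cls \<Rightarrow> form" where
  "cz_cov S C a P = (\<^bold>\<exists>U. (\<^bold>\<forall>b. b \<^bold>\<in> U \<^bold>\<longleftrightarrow> b \<^bold>\<in> S \<^bold>\<and> P b) \<^bold>\<and> C a U)"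
definition cz_covers :: "var \<Rightarrow> (var \<Rightarrow> cls) \<Rightarrow> cls \<Rightarrow> cls \<Rightarrow> form" where
  "cz_covers S C P Q = fBall S (\<lambda>u. P u \<^bold>\<longrightarrow> cz_cov S C u Q)"
definition cz_down :: "var \<Rightarrow> (var \<Rightarrow> cls) \<Rightarrow> cls \<Rightarrow> cls \<Rightarrow> cls" where
  "cz_down S C P Q = (\<lambda>d. d \<^bold>\<in> S \<^bold>\<and>
     fBex S (\<lambda>u. P u \<^bold>\<and> cz_cov S C d (cz_sing u)) \<^bold>\<and>
     fBex S (\<lambda>v. Q v \<^bold>\<and> cz_cov S C d (cz_sing v)))"
definition cz_star :: "var \<Rightarrow> (var \<Rightarrow> cls) \<Rightarrow> cls \<Rightarrow> cls" where
  "cz_star S C P = (\<lambda>a. a \<^bold>\<in> S \<^bold>\<and> cz_covers S C (cz_down S C (cz_sing a) P) cz_empty)"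

definition all_sub :: "var \<Rightarrow> (var \<Rightarrow> form) \<Rightarrow> form" where
  "all_sub S F = (\<^bold>\<forall>U. U \<^bold>\<subseteq> S \<^bold>\<longrightarrow> F U)"

definition cz_space :: "var \<Rightarrow> (var \<Rightarrow> cls) \<Rightarrow> form" where
  "cz_space S C =
     (all_sub S (\<lambda>U. fBall S (\<lambda>a. a \<^bold>\<in> U \<^bold>\<longrightarrow> cz_cov S C a (elem_of U))) \<^bold>\<and>
      all_sub S (\<lambda>U. all_sub S (\<lambda>V. fBall S (\<lambda>a.
        cz_cov S C a (elem_of U) \<^bold>\<and> cz_covers S C (elem_of U) (elem_of V) \<^bold>\<longrightarrow> cz_cov S C a (elem_of V)))) \<^bold>\<and>
      all_sub S (\<lambda>U. all_sub S (\<lambda>V. fBall S (\<lambda>a.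
        cz_cov S C a (elem_of U) \<^bold>\<and> cz_cov S C a (elem_of V) \<^bold>\<longrightarrow>
        cz_cov S C a (cz_down S C (elem_of U) (elem_of V))))) \<^bold>\<and>
      all_sub S (\<lambda>U. \<^bold>\<exists>W. \<^bold>\<forall>a. a \<^bold>\<in> W \<^bold>\<longleftrightarrow> a \<^bold>\<in> S \<^bold>\<and> cz_cov S C a (elem_of U)))"

definition cz_nontrivial :: "var \<Rightarrow> (var \<Rightarrow> cls) \<Rightarrow> form" where
  "cz_nontrivial S C = (\<^bold>\<not> cz_covers S C (elem_of S) cz_empty)"
definition cz_de_morgan :: "var \<Rightarrow> (var \<Rightarrow> cls) \<Rightarrow> form" where
  "cz_de_morgan S C = all_sub S (\<lambda>U. cz_covers S C (elem_of S)
     (cz_cup (cz_star S C (cz_star S C (elem_of U))) (cz_star S C (elem_of U))))"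

text \<open>\<open>f\<close> is a function (a set of ordered pairs) with domain \<open>A\<close> and all values in the class \<open>B\<close>.\<close>

definition maps_to :: "var \<Rightarrow> var \<Rightarrow> var \<Rightarrow> form" where
  "maps_to f a v = fBex f (\<lambda>p. is_pair p a v)"
definition is_fun :: "var \<Rightarrow> var \<Rightarrow> cls \<Rightarrow> form" where
  "is_fun f A B = (fBall f (\<lambda>p. fBex A (\<lambda>a. \<^bold>\<exists>v. B v \<^bold>\<and> is_pair p a v)) \<^bold>\<and>
                   fBall A (\<lambda>a. fEx1 (\<lambda>v. maps_to f a v)))"

text \<open>Finite in the usual sense of formal topology: an image of a natural number.\<close>

definition is_finite :: "var \<Rightarrow> form" where
  "is_finite u = (\<^bold>\<exists>w. is_omega w \<^bold>\<and> fBex w (\<lambda>n. \<^bold>\<exists>g. is_fun g n (elem_of u) \<^bold>\<and>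
                    fBall u (\<lambda>y. fBex n (\<lambda>i. maps_to g i y))))"

definition cz_compact :: "var \<Rightarrow> (var \<Rightarrow> cls) \<Rightarrow> form" where
  "cz_compact S C = all_sub S (\<lambda>U. cz_covers S C (elem_of S) (elem_of U) \<^bold>\<longrightarrow>
     (\<^bold>\<exists>u\<^sub>0. is_finite u\<^sub>0 \<^bold>\<and> u\<^sub>0 \<^bold>\<subseteq> U \<^bold>\<and> cz_covers S C (elem_of S) (elem_of u\<^sub>0)))"
definition cz_well_inside :: "var \<Rightarrow> (var \<Rightarrow> cls) \<Rightarrow> var \<Rightarrow> var \<Rightarrow> form" where
  "cz_well_inside S C b a =
     cz_covers S C (elem_of S) (cz_cup (cz_star S C (cz_sing b)) (cz_sing a))"
definition cz_regular :: "var \<Rightarrow> (var \<Rightarrow> cls) \<Rightarrow> form" where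
  "cz_regular S C = fBall S (\<lambda>a. cz_cov S C a (\<lambda>b. cz_well_inside S C b a))"

text \<open>A continuous function from \<open>(G, D)\<close> to \<open>(S, C)\<close> is a map \<open>f\<close> from \<open>S\<close> to subsets of \<open>G\<close>.\<close>

definition cz_image :: "var \<Rightarrow> var \<Rightarrow> cls \<Rightarrow> cls" where
  "cz_image S f P = (\<lambda>b. fBex S (\<lambda>a. P a \<^bold>\<and> (\<^bold>\<exists>v. maps_to f a v \<^bold>\<and> b \<^bold>\<in> v)))"
definition cz_continuous ::
    "var \<Rightarrow> (var \<Rightarrow> cls) \<Rightarrow> var \<Rightarrow> (var \<Rightarrow> cls) \<Rightarrow> var \<Rightarrow> form" where
  "cz_continuous G D S C f =
     (is_fun f S (\<lambda>v. v \<^bold>\<subseteq> G) \<^bold>\<and>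
      cz_covers G D (cz_image S f (elem_of S)) (elem_of G) \<^bold>\<and>
      cz_covers G D (elem_of G) (cz_image S f (elem_of S)) \<^bold>\<and>
      fBall S (\<lambda>a. fBall S (\<lambda>b. cz_covers G D
        (cz_down G D (cz_image S f (cz_sing a)) (cz_image S f (cz_sing b)))
        (cz_image S f (cz_down S C (cz_sing a) (cz_sing b))))) \<^bold>\<and>
      fBall S (\<lambda>a. all_sub S (\<lambda>U. cz_cov S C a (elem_of U) \<^bold>\<longrightarrow>
        cz_covers G D (cz_image S f (cz_sing a)) (cz_image S f (elem_of U)))))"
definition cz_surjective ::
    "var \<Rightarrow> (var \<Rightarrow> cls) \<Rightarrow> var \<Rightarrow> (var \<Rightarrow> cls) \<Rightarrow> var \<Rightarrow> form" where
  "cz_surjective G D S C f = fBall S (\<lambda>a. all_sub S (\<lambda>U.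
     cz_covers G D (cz_image S f (cz_sing a)) (cz_image S f (elem_of U)) \<^bold>\<longrightarrow>
     cz_cov S C a (elem_of U)))"

text \<open>The cover of the closed subspace complementary to \<open>V\<close>: \<open>a\<close> is covered by \<open>U\<close> there iff it is
  covered by \<open>U \<union> V\<close> in the whole space. The subspace is proper if the two covers do not agree;
  one inclusion always holds.\<close>

definition cz_closed :: "var \<Rightarrow> (var \<Rightarrow> cls) \<Rightarrow> var \<Rightarrow> (var \<Rightarrow> cls)" where
  "cz_closed G D V = (\<lambda>a U. cz_cov G D a (cz_cup (elem_of U) (elem_of V)))"
definition cz_proper :: "var \<Rightarrow> (var \<Rightarrow> cls) \<Rightarrow> var \<Rightarrow> form" where
  "cz_proper G D V = (\<^bold>\<not> fBall G (\<lambda>a. all_sub G (\<lambda>U.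
     cz_cov G (cz_closed G D V) a (elem_of U) \<^bold>\<longrightarrow> cz_cov G D a (elem_of U))))"

definition cz_gleason_cover ::
    "var \<Rightarrow> (var \<Rightarrow> cls) \<Rightarrow> var \<Rightarrow> (var \<Rightarrow> cls) \<Rightarrow> var \<Rightarrow> form" where
  "cz_gleason_cover G D S C f =
     (cz_space G D \<^bold>\<and> cz_compact G D \<^bold>\<and> cz_regular G D \<^bold>\<and> cz_de_morgan G D \<^bold>\<and>
      cz_continuous G D S C f \<^bold>\<and> cz_surjective G D S C f \<^bold>\<and>
      all_sub G (\<lambda>V. cz_proper G D V \<^bold>\<longrightarrow> \<^bold>\<not> cz_surjective G (cz_closed G D V) S C f))"

text \<open>Spaces and maps given by definitions: \<open>s\<close> defines the base set and \<open>c\<close> the cover class.\<close>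

definition def_class :: "fm \<Rightarrow> var \<Rightarrow> cls" where
  "def_class c = (\<lambda>a U. inst c [a, U])"
definition def_set :: "fm \<Rightarrow> var \<Rightarrow> form" where
  "def_set s X = (\<^bold>\<forall>Y. inst s [Y] \<^bold>\<longleftrightarrow> Y \<^bold>= X)"

definition cz_ntcr_space_in :: "fm set \<Rightarrow> fm \<Rightarrow> fm \<Rightarrow> bool" where
  "cz_ntcr_space_in T s c \<longleftrightarrow> fv s \<subseteq> {0} \<and> fv c \<subseteq> {0, 1} \<and>
     proves T (\<^bold>\<exists>S. def_set s S \<^bold>\<and> cz_space S (def_class c) \<^bold>\<and> cz_nontrivial S (def_class c) \<^bold>\<and>
                    cz_compact S (def_class c) \<^bold>\<and> cz_regular S (def_class c))"
definition cz_gleason_cover_in :: "fm set \<Rightarrow> fm \<Rightarrow> fm \<Rightarrow> fm \<Rightarrow> fm \<Rightarrow> fm \<Rightarrow> bool" where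
  "cz_gleason_cover_in T g d s c p \<longleftrightarrow> fv g \<subseteq> {0} \<and> fv d \<subseteq> {0, 1} \<and> fv p \<subseteq> {0} \<and>
     proves T (\<^bold>\<exists>S. def_set s S \<^bold>\<and> (\<^bold>\<exists>G. def_set g G \<^bold>\<and> (\<^bold>\<exists>f. def_set p f \<^bold>\<and>
                    cz_gleason_cover G (def_class d) S (def_class c) f)))"


section \<open>The logical framework of type theory\<close>

text \<open>Martin-Loef's logical framework: types are \<open>Set\<close>, \<open>El A\<close> and dependent function types
  \<open>(x : A) B\<close>; set formers, constructors and eliminators are constants with declared types.
  \<open>Ext\<close> supplies arbitrary additional constants for extensions; \<open>CGupI\<close> and \<open>CGupR\<close> are the
  constants of the uniformity rule.\<close>

datatype 'c con =
    CPi | CLambda | CAp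
  | CSig | CPair | CSplit
  | CPlus | CInl | CInr | CWhen
  | CN0 | CCase0
  | CN1 | CTt | CCase1
  | CN | CZero | CSucc | CNatrec
  | CList | CNil | CCons | CListrec
  | CId | CRefl | CIdpeel
  | CW | CSup | CWrec
  | CU | CT | CodePi | CodeSig | CodePlus | CodeN0 | CodeN1 | CodeN | CodeList | CodeId | CodeW
  | CGupI | CGupR
  | Ext 'c

datatype 'c tm = Var nat | Con "'c con" | App "'c tm" "'c tm" | Lam "'c tm"

datatype 'c ty = SetT | El "'c tm" | Fun "'c ty" "'c ty"

primrec ren_tm :: "(nat \<Rightarrow> nat) \<Rightarrow> 'c tm \<Rightarrow> 'c tm" where
  "ren_tm r (Var n) = Var (r n)"
| "ren_tm r (Con c) = Con c"
| "ren_tm r (App t u) = App (ren_tm r t) (ren_tm r u)"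
| "ren_tm r (Lam t) = Lam (ren_tm (up r) t)"

fun up_sub :: "(nat \<Rightarrow> 'c tm) \<Rightarrow> nat \<Rightarrow> 'c tm" where
  "up_sub s 0 = Var 0"
| "up_sub s (Suc n) = ren_tm Suc (s n)"

primrec sub_tm :: "(nat \<Rightarrow> 'c tm) \<Rightarrow> 'c tm \<Rightarrow> 'c tm" where
  "sub_tm s (Var n) = s n"
| "sub_tm s (Con c) = Con c"
| "sub_tm s (App t u) = App (sub_tm s t) (sub_tm s u)"
| "sub_tm s (Lam t) = Lam (sub_tm (up_sub s) t)"

primrec sub_ty :: "(nat \<Rightarrow> 'c tm) \<Rightarrow> 'c ty \<Rightarrow> 'c ty" where
  "sub_ty s SetT = SetT"
| "sub_ty s (El t) = El (sub_tm s t)"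
| "sub_ty s (Fun X Y) = Fun (sub_ty s X) (sub_ty (up_sub s) Y)"

definition one :: "'c tm \<Rightarrow> nat \<Rightarrow> 'c tm" where
  "one a n = (case n of 0 \<Rightarrow> a | Suc m \<Rightarrow> Var m)"

definition shift_ty :: "nat \<Rightarrow> 'c ty \<Rightarrow> 'c ty" where
  "shift_ty k = sub_ty (\<lambda>n. Var (n + k))"

primrec scoped :: "nat \<Rightarrow> 'c tm \<Rightarrow> bool" where
  "scoped k (Var n) \<longleftrightarrow> n < k"
| "scoped k (Con c) \<longleftrightarrow> True"
| "scoped k (App t u) \<longleftrightarrow> scoped k t \<and> scoped k u"
| "scoped k (Lam t) \<longleftrightarrow> scoped (Suc k) t"

datatype 'c jdg =
    Ctx
  | IsTy "'c ty"
  | EqTy "'c ty" "'c ty"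
  | HasTy "'c tm" "'c ty"
  | EqTm "'c tm" "'c tm" "'c ty"

primrec sub_jdg :: "(nat \<Rightarrow> 'c tm) \<Rightarrow> 'c jdg \<Rightarrow> 'c jdg" where
  "sub_jdg s Ctx = Ctx"
| "sub_jdg s (IsTy X) = IsTy (sub_ty s X)"
| "sub_jdg s (EqTy X Y) = EqTy (sub_ty s X) (sub_ty s Y)"
| "sub_jdg s (HasTy t X) = HasTy (sub_tm s t) (sub_ty s X)"
| "sub_jdg s (EqTm t u X) = EqTm (sub_tm s t) (sub_tm s u) (sub_ty s X)"

type_synonym 'c judgement = "'c ty list \<times> 'c jdg"

text \<open>Derivability from a set \<open>A\<close> of hypothetical judgements taken as axioms. An extension given
  by additional rules is covered as well: take for \<open>A\<close> the set of all its judgements. The head of a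
  context is the most recent assumption, and each entry lives in the context formed by the later
  entries of the list. The rule \<open>subst\<close> is simultaneous substitution and includes weakening.\<close>

inductive derivable :: "'c judgement set \<Rightarrow> 'c ty list \<Rightarrow> 'c jdg \<Rightarrow> bool"
  for A :: "'c judgement set" where
  axiom: "(\<Gamma>, J) \<in> A \<Longrightarrow> derivable A \<Gamma> J"
| ctx_nil: "derivable A [] Ctx"
| ctx_cons: "derivable A \<Gamma> Ctx \<Longrightarrow> derivable A \<Gamma> (IsTy X) \<Longrightarrow> derivable A (X # \<Gamma>) Ctx"
| var: "derivable A \<Gamma> Ctx \<Longrightarrow> i < length \<Gamma> \<Longrightarrow>
    derivable A \<Gamma> (HasTy (Var i) (shift_ty (Suc i) (\<Gamma> ! i)))"
| subst: "derivable A \<Gamma> J \<Longrightarrow> derivable A \<Delta> Ctx \<Longrightarrow>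
    (\<forall>i<length \<Gamma>. derivable A \<Delta> (HasTy (s i) (sub_ty s (shift_ty (Suc i) (\<Gamma> ! i))))) \<Longrightarrow>
    derivable A \<Delta> (sub_jdg s J)"
| ty_subst_eq: "derivable A (X # \<Gamma>) (IsTy Y) \<Longrightarrow> derivable A \<Gamma> (EqTm a b X) \<Longrightarrow>
    derivable A \<Gamma> (EqTy (sub_ty (one a) Y) (sub_ty (one b) Y))"
| set_ty: "derivable A \<Gamma> Ctx \<Longrightarrow> derivable A \<Gamma> (IsTy SetT)"
| el_ty: "derivable A \<Gamma> (HasTy t SetT) \<Longrightarrow> derivable A \<Gamma> (IsTy (El t))"
| el_eq: "derivable A \<Gamma> (EqTm t u SetT) \<Longrightarrow> derivable A \<Gamma> (EqTy (El t) (El u))"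
| fun_ty: "derivable A \<Gamma> (IsTy X) \<Longrightarrow> derivable A (X # \<Gamma>) (IsTy Y) \<Longrightarrow>
    derivable A \<Gamma> (IsTy (Fun X Y))"
| fun_eq: "derivable A \<Gamma> (EqTy X X') \<Longrightarrow> derivable A (X # \<Gamma>) (EqTy Y Y') \<Longrightarrow>
    derivable A \<Gamma> (EqTy (Fun X Y) (Fun X' Y'))"
| lam: "derivable A (X # \<Gamma>) (HasTy b Y) \<Longrightarrow> derivable A \<Gamma> (HasTy (Lam b) (Fun X Y))"
| lam_eq: "derivable A (X # \<Gamma>) (EqTm b c Y) \<Longrightarrow> derivable A \<Gamma> (EqTm (Lam b) (Lam c) (Fun X Y))"
| app: "derivable A \<Gamma> (HasTy f (Fun X Y)) \<Longrightarrow> derivable A \<Gamma> (HasTy a X) \<Longrightarrow>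
    derivable A \<Gamma> (HasTy (App f a) (sub_ty (one a) Y))"
| app_eq: "derivable A \<Gamma> (EqTm f g (Fun X Y)) \<Longrightarrow> derivable A \<Gamma> (EqTm a b X) \<Longrightarrow>
    derivable A \<Gamma> (EqTm (App f a) (App g b) (sub_ty (one a) Y))"
| beta: "derivable A (X # \<Gamma>) (HasTy b Y) \<Longrightarrow> derivable A \<Gamma> (HasTy a X) \<Longrightarrow>
    derivable A \<Gamma> (EqTm (App (Lam b) a) (sub_tm (one a) b) (sub_ty (one a) Y))"
| eta: "derivable A \<Gamma> (HasTy f (Fun X Y)) \<Longrightarrow>
    derivable A \<Gamma> (EqTm (Lam (App (ren_tm Suc f) (Var 0))) f (Fun X Y))"
| ty_refl: "derivable A \<Gamma> (IsTy X) \<Longrightarrow> derivable A \<Gamma> (EqTy X X)"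
| ty_sym: "derivable A \<Gamma> (EqTy X Y) \<Longrightarrow> derivable A \<Gamma> (EqTy Y X)"
| ty_trans: "derivable A \<Gamma> (EqTy X Y) \<Longrightarrow> derivable A \<Gamma> (EqTy Y Z) \<Longrightarrow> derivable A \<Gamma> (EqTy X Z)"
| tm_refl: "derivable A \<Gamma> (HasTy t X) \<Longrightarrow> derivable A \<Gamma> (EqTm t t X)"
| tm_sym: "derivable A \<Gamma> (EqTm t u X) \<Longrightarrow> derivable A \<Gamma> (EqTm u t X)"
| tm_trans: "derivable A \<Gamma> (EqTm t u X) \<Longrightarrow> derivable A \<Gamma> (EqTm u v X) \<Longrightarrow>
    derivable A \<Gamma> (EqTm t v X)"
| conv: "derivable A \<Gamma> (HasTy t X) \<Longrightarrow> derivable A \<Gamma> (EqTy X Y) \<Longrightarrow> derivable A \<Gamma> (HasTy t Y)"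
| conv_eq: "derivable A \<Gamma> (EqTm t u X) \<Longrightarrow> derivable A \<Gamma> (EqTy X Y) \<Longrightarrow>
    derivable A \<Gamma> (EqTm t u Y)"

text \<open>Concrete syntax with host-level binders, depending on the number of enclosing binders as for
  formulas above.\<close>

type_synonym 'c ptm = "nat \<Rightarrow> 'c tm"
type_synonym 'c pty = "nat \<Rightarrow> 'c ty"

definition cst :: "'c con \<Rightarrow> 'c ptm" where
  "cst c = (\<lambda>d. Con c)"
definition app_p :: "'c ptm \<Rightarrow> 'c ptm \<Rightarrow> 'c ptm" (infixl "\<cdot>" 90) where
  "t \<cdot> u = (\<lambda>d. App (t d) (u d))"
definition lam_p :: "('c ptm \<Rightarrow> 'c ptm) \<Rightarrow> 'c ptm" (binder "\<^bold>\<lambda>" 10) where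
  "lam_p F = (\<lambda>d. Lam (F (\<lambda>e. Var (e - Suc d)) (Suc d)))"
definition set_p :: "'c pty" where
  "set_p = (\<lambda>d. SetT)"
definition el :: "'c ptm \<Rightarrow> 'c pty" where
  "el t = (\<lambda>d. El (t d))"
definition fn :: "'c pty \<Rightarrow> ('c ptm \<Rightarrow> 'c pty) \<Rightarrow> 'c pty" where
  "fn X F = (\<lambda>d. Fun (X d) (F (\<lambda>e. Var (e - Suc d)) (Suc d)))"
definition arr :: "'c pty \<Rightarrow> 'c pty \<Rightarrow> 'c pty" (infixr "\<^bold>\<rightarrow>" 60) where
  "(X \<^bold>\<rightarrow> Y) = fn X (\<lambda>_. Y)"


section \<open>Constructive type theory and the uniformity rule\<close>

definition Pi_s :: "'c ptm \<Rightarrow> ('c ptm \<Rightarrow> 'c ptm) \<Rightarrow> 'c ptm" where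
  "Pi_s A B = cst CPi \<cdot> A \<cdot> lam_p B"
definition Sig_s :: "'c ptm \<Rightarrow> ('c ptm \<Rightarrow> 'c ptm) \<Rightarrow> 'c ptm" where
  "Sig_s A B = cst CSig \<cdot> A \<cdot> lam_p B"
definition W_s :: "'c ptm \<Rightarrow> ('c ptm \<Rightarrow> 'c ptm) \<Rightarrow> 'c ptm" where
  "W_s A B = cst CW \<cdot> A \<cdot> lam_p B"
definition fam :: "'c ptm \<Rightarrow> 'c pty" where
  "fam A = el A \<^bold>\<rightarrow> set_p"

definition ctt_constants :: "('c con \<times> 'c pty) list" where
  "ctt_constants = [
    (CPi, fn set_p (\<lambda>A. fam A \<^bold>\<rightarrow> set_p)),
    (CLambda, fn set_p (\<lambda>A. fn (fam A) (\<lambda>B.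
      fn (el A) (\<lambda>x. el (B \<cdot> x)) \<^bold>\<rightarrow> el (cst CPi \<cdot> A \<cdot> B)))),
    (CAp, fn set_p (\<lambda>A. fn (fam A) (\<lambda>B.
      el (cst CPi \<cdot> A \<cdot> B) \<^bold>\<rightarrow> fn (el A) (\<lambda>a. el (B \<cdot> a))))),

    (CSig, fn set_p (\<lambda>A. fam A \<^bold>\<rightarrow> set_p)),
    (CPair, fn set_p (\<lambda>A. fn (fam A) (\<lambda>B. fn (el A) (\<lambda>a.
      el (B \<cdot> a) \<^bold>\<rightarrow> el (cst CSig \<cdot> A \<cdot> B))))),
    (CSplit, fn set_p (\<lambda>A. fn (fam A) (\<lambda>B. fn (fam (cst CSig \<cdot> A \<cdot> B)) (\<lambda>C.
      fn (el A) (\<lambda>x. fn (el (B \<cdot> x)) (\<lambda>y. el (C \<cdot> (cst CPair \<cdot> A \<cdot> B \<cdot> x \<cdot> y)))) \<^bold>\<rightarrow>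
      fn (el (cst CSig \<cdot> A \<cdot> B)) (\<lambda>p. el (C \<cdot> p)))))),

    (CPlus, set_p \<^bold>\<rightarrow> set_p \<^bold>\<rightarrow> set_p),
    (CInl, fn set_p (\<lambda>A. fn set_p (\<lambda>B. el A \<^bold>\<rightarrow> el (cst CPlus \<cdot> A \<cdot> B)))),
    (CInr, fn set_p (\<lambda>A. fn set_p (\<lambda>B. el B \<^bold>\<rightarrow> el (cst CPlus \<cdot> A \<cdot> B)))),
    (CWhen, fn set_p (\<lambda>A. fn set_p (\<lambda>B. fn (fam (cst CPlus \<cdot> A \<cdot> B)) (\<lambda>C.
      fn (el A) (\<lambda>x. el (C \<cdot> (cst CInl \<cdot> A \<cdot> B \<cdot> x))) \<^bold>\<rightarrow>
      fn (el B) (\<lambda>y. el (C \<cdot> (cst CInr \<cdot> A \<cdot> B \<cdot> y))) \<^bold>\<rightarrow>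
      fn (el (cst CPlus \<cdot> A \<cdot> B)) (\<lambda>p. el (C \<cdot> p)))))),

    (CN0, set_p),
    (CCase0, fn (fam (cst CN0)) (\<lambda>C. fn (el (cst CN0)) (\<lambda>x. el (C \<cdot> x)))),

    (CN1, set_p),
    (CTt, el (cst CN1)),
    (CCase1, fn (fam (cst CN1)) (\<lambda>C. el (C \<cdot> cst CTt) \<^bold>\<rightarrow> fn (el (cst CN1)) (\<lambda>x. el (C \<cdot> x)))),

    (CN, set_p),
    (CZero, el (cst CN)),
    (CSucc, el (cst CN) \<^bold>\<rightarrow> el (cst CN)),
    (CNatrec, fn (fam (cst CN)) (\<lambda>C. el (C \<cdot> cst CZero) \<^bold>\<rightarrow>
      fn (el (cst CN)) (\<lambda>x. el (C \<cdot> x) \<^bold>\<rightarrow> el (C \<cdot> (cst CSucc \<cdot> x))) \<^bold>\<rightarrow>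
      fn (el (cst CN)) (\<lambda>n. el (C \<cdot> n)))),

    (CList, set_p \<^bold>\<rightarrow> set_p),
    (CNil, fn set_p (\<lambda>A. el (cst CList \<cdot> A))),
    (CCons, fn set_p (\<lambda>A. el A \<^bold>\<rightarrow> el (cst CList \<cdot> A) \<^bold>\<rightarrow> el (cst CList \<cdot> A))),
    (CListrec, fn set_p (\<lambda>A. fn (fam (cst CList \<cdot> A)) (\<lambda>C. el (C \<cdot> (cst CNil \<cdot> A)) \<^bold>\<rightarrow>
      fn (el A) (\<lambda>x. fn (el (cst CList \<cdot> A)) (\<lambda>y.
        el (C \<cdot> y) \<^bold>\<rightarrow> el (C \<cdot> (cst CCons \<cdot> A \<cdot> x \<cdot> y)))) \<^bold>\<rightarrow>
      fn (el (cst CList \<cdot> A)) (\<lambda>l. el (C \<cdot> l))))),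

    (CId, fn set_p (\<lambda>A. el A \<^bold>\<rightarrow> el A \<^bold>\<rightarrow> set_p)),
    (CRefl, fn set_p (\<lambda>A. fn (el A) (\<lambda>a. el (cst CId \<cdot> A \<cdot> a \<cdot> a)))),
    (CIdpeel, fn set_p (\<lambda>A.
      fn (fn (el A) (\<lambda>x. fn (el A) (\<lambda>y. fam (cst CId \<cdot> A \<cdot> x \<cdot> y)))) (\<lambda>C.
      fn (el A) (\<lambda>x. el (C \<cdot> x \<cdot> x \<cdot> (cst CRefl \<cdot> A \<cdot> x))) \<^bold>\<rightarrow>
      fn (el A) (\<lambda>a. fn (el A) (\<lambda>b. fn (el (cst CId \<cdot> A \<cdot> a \<cdot> b)) (\<lambda>e.
        el (C \<cdot> a \<cdot> b \<cdot> e))))))),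

    (CW, fn set_p (\<lambda>A. fam A \<^bold>\<rightarrow> set_p)),
    (CSup, fn set_p (\<lambda>A. fn (fam A) (\<lambda>B. fn (el A) (\<lambda>a.
      (el (B \<cdot> a) \<^bold>\<rightarrow> el (cst CW \<cdot> A \<cdot> B)) \<^bold>\<rightarrow> el (cst CW \<cdot> A \<cdot> B))))),
    (CWrec, fn set_p (\<lambda>A. fn (fam A) (\<lambda>B. fn (fam (cst CW \<cdot> A \<cdot> B)) (\<lambda>C.
      fn (el A) (\<lambda>x. fn (el (B \<cdot> x) \<^bold>\<rightarrow> el (cst CW \<cdot> A \<cdot> B)) (\<lambda>f.
        fn (el (B \<cdot> x)) (\<lambda>y. el (C \<cdot> (f \<cdot> y))) \<^bold>\<rightarrow> el (C \<cdot> (cst CSup \<cdot> A \<cdot> B \<cdot> x \<cdot> f)))) \<^bold>\<rightarrow>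
      fn (el (cst CW \<cdot> A \<cdot> B)) (\<lambda>w. el (C \<cdot> w)))))),

    (CU, set_p),
    (CT, el (cst CU) \<^bold>\<rightarrow> set_p),
    (CodePi, fn (el (cst CU)) (\<lambda>a. (el (cst CT \<cdot> a) \<^bold>\<rightarrow> el (cst CU)) \<^bold>\<rightarrow> el (cst CU))),
    (CodeSig, fn (el (cst CU)) (\<lambda>a. (el (cst CT \<cdot> a) \<^bold>\<rightarrow> el (cst CU)) \<^bold>\<rightarrow> el (cst CU))),
    (CodePlus, el (cst CU) \<^bold>\<rightarrow> el (cst CU) \<^bold>\<rightarrow> el (cst CU)),
    (CodeN0, el (cst CU)),
    (CodeN1, el (cst CU)),
    (CodeN, el (cst CU)),
    (CodeList, el (cst CU) \<^bold>\<rightarrow> el (cst CU)),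
    (CodeId, fn (el (cst CU)) (\<lambda>a. el (cst CT \<cdot> a) \<^bold>\<rightarrow> el (cst CT \<cdot> a) \<^bold>\<rightarrow> el (cst CU))),
    (CodeW, fn (el (cst CU)) (\<lambda>a. (el (cst CT \<cdot> a) \<^bold>\<rightarrow> el (cst CU)) \<^bold>\<rightarrow> el (cst CU)))]"

text \<open>An equation is a triple (left side, right side, type); \<open>given\<close> abstracts all three over a
  variable, so a hypothetical equation becomes one between closed function terms.\<close>

type_synonym 'c peq = "'c ptm \<times> 'c ptm \<times> 'c pty"

definition given :: "'c pty \<Rightarrow> ('c ptm \<Rightarrow> 'c peq) \<Rightarrow> 'c peq" where
  "given X E = (lam_p (\<lambda>x. fst (E x)), lam_p (\<lambda>x. fst (snd (E x))), fn X (\<lambda>x. snd (snd (E x))))"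

definition ctt_equations :: "'c peq list" where
  "ctt_equations = [
    given set_p (\<lambda>A. given (fam A) (\<lambda>B. given (fn (el A) (\<lambda>x. el (B \<cdot> x))) (\<lambda>b. given (el A) (\<lambda>a.
      (cst CAp \<cdot> A \<cdot> B \<cdot> (cst CLambda \<cdot> A \<cdot> B \<cdot> b) \<cdot> a, b \<cdot> a, el (B \<cdot> a)))))),

    given set_p (\<lambda>A. given (fam A) (\<lambda>B. given (fam (cst CSig \<cdot> A \<cdot> B)) (\<lambda>C.
      given (fn (el A) (\<lambda>x. fn (el (B \<cdot> x)) (\<lambda>y. el (C \<cdot> (cst CPair \<cdot> A \<cdot> B \<cdot> x \<cdot> y))))) (\<lambda>c.
      given (el A) (\<lambda>a. given (el (B \<cdot> a)) (\<lambda>b.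
      (cst CSplit \<cdot> A \<cdot> B \<cdot> C \<cdot> c \<cdot> (cst CPair \<cdot> A \<cdot> B \<cdot> a \<cdot> b), c \<cdot> a \<cdot> b,
       el (C \<cdot> (cst CPair \<cdot> A \<cdot> B \<cdot> a \<cdot> b))))))))),

    given set_p (\<lambda>A. given set_p (\<lambda>B. given (fam (cst CPlus \<cdot> A \<cdot> B)) (\<lambda>C.
      given (fn (el A) (\<lambda>x. el (C \<cdot> (cst CInl \<cdot> A \<cdot> B \<cdot> x)))) (\<lambda>c.
      given (fn (el B) (\<lambda>y. el (C \<cdot> (cst CInr \<cdot> A \<cdot> B \<cdot> y)))) (\<lambda>d. given (el A) (\<lambda>a.
      (cst CWhen \<cdot> A \<cdot> B \<cdot> C \<cdot> c \<cdot> d \<cdot> (cst CInl \<cdot> A \<cdot> B \<cdot> a), c \<cdot> a,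
       el (C \<cdot> (cst CInl \<cdot> A \<cdot> B \<cdot> a))))))))),
    given set_p (\<lambda>A. given set_p (\<lambda>B. given (fam (cst CPlus \<cdot> A \<cdot> B)) (\<lambda>C.
      given (fn (el A) (\<lambda>x. el (C \<cdot> (cst CInl \<cdot> A \<cdot> B \<cdot> x)))) (\<lambda>c.
      given (fn (el B) (\<lambda>y. el (C \<cdot> (cst CInr \<cdot> A \<cdot> B \<cdot> y)))) (\<lambda>d. given (el B) (\<lambda>b.
      (cst CWhen \<cdot> A \<cdot> B \<cdot> C \<cdot> c \<cdot> d \<cdot> (cst CInr \<cdot> A \<cdot> B \<cdot> b), d \<cdot> b,
       el (C \<cdot> (cst CInr \<cdot> A \<cdot> B \<cdot> b))))))))),

    given (fam (cst CN1)) (\<lambda>C. given (el (C \<cdot> cst CTt)) (\<lambda>c.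
      (cst CCase1 \<cdot> C \<cdot> c \<cdot> cst CTt, c, el (C \<cdot> cst CTt)))),

    given (fam (cst CN)) (\<lambda>C. given (el (C \<cdot> cst CZero)) (\<lambda>c.
      given (fn (el (cst CN)) (\<lambda>x. el (C \<cdot> x) \<^bold>\<rightarrow> el (C \<cdot> (cst CSucc \<cdot> x)))) (\<lambda>d.
      (cst CNatrec \<cdot> C \<cdot> c \<cdot> d \<cdot> cst CZero, c, el (C \<cdot> cst CZero))))),
    given (fam (cst CN)) (\<lambda>C. given (el (C \<cdot> cst CZero)) (\<lambda>c.
      given (fn (el (cst CN)) (\<lambda>x. el (C \<cdot> x) \<^bold>\<rightarrow> el (C \<cdot> (cst CSucc \<cdot> x)))) (\<lambda>d.
      given (el (cst CN)) (\<lambda>n.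
      (cst CNatrec \<cdot> C \<cdot> c \<cdot> d \<cdot> (cst CSucc \<cdot> n), d \<cdot> n \<cdot> (cst CNatrec \<cdot> C \<cdot> c \<cdot> d \<cdot> n),
       el (C \<cdot> (cst CSucc \<cdot> n))))))),

    given set_p (\<lambda>A. given (fam (cst CList \<cdot> A)) (\<lambda>C. given (el (C \<cdot> (cst CNil \<cdot> A))) (\<lambda>c.
      given (fn (el A) (\<lambda>x. fn (el (cst CList \<cdot> A)) (\<lambda>y.
        el (C \<cdot> y) \<^bold>\<rightarrow> el (C \<cdot> (cst CCons \<cdot> A \<cdot> x \<cdot> y))))) (\<lambda>d.
      (cst CListrec \<cdot> A \<cdot> C \<cdot> c \<cdot> d \<cdot> (cst CNil \<cdot> A), c, el (C \<cdot> (cst CNil \<cdot> A))))))),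
    given set_p (\<lambda>A. given (fam (cst CList \<cdot> A)) (\<lambda>C. given (el (C \<cdot> (cst CNil \<cdot> A))) (\<lambda>c.
      given (fn (el A) (\<lambda>x. fn (el (cst CList \<cdot> A)) (\<lambda>y.
        el (C \<cdot> y) \<^bold>\<rightarrow> el (C \<cdot> (cst CCons \<cdot> A \<cdot> x \<cdot> y))))) (\<lambda>d.
      given (el A) (\<lambda>a. given (el (cst CList \<cdot> A)) (\<lambda>l.
      (cst CListrec \<cdot> A \<cdot> C \<cdot> c \<cdot> d \<cdot> (cst CCons \<cdot> A \<cdot> a \<cdot> l),
       d \<cdot> a \<cdot> l \<cdot> (cst CListrec \<cdot> A \<cdot> C \<cdot> c \<cdot> d \<cdot> l),
       el (C \<cdot> (cst CCons \<cdot> A \<cdot> a \<cdot> l))))))))),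

    given set_p (\<lambda>A.
      given (fn (el A) (\<lambda>x. fn (el A) (\<lambda>y. fam (cst CId \<cdot> A \<cdot> x \<cdot> y)))) (\<lambda>C.
      given (fn (el A) (\<lambda>x. el (C \<cdot> x \<cdot> x \<cdot> (cst CRefl \<cdot> A \<cdot> x)))) (\<lambda>c. given (el A) (\<lambda>a.
      (cst CIdpeel \<cdot> A \<cdot> C \<cdot> c \<cdot> a \<cdot> a \<cdot> (cst CRefl \<cdot> A \<cdot> a), c \<cdot> a,
       el (C \<cdot> a \<cdot> a \<cdot> (cst CRefl \<cdot> A \<cdot> a))))))),

    given set_p (\<lambda>A. given (fam A) (\<lambda>B. given (fam (cst CW \<cdot> A \<cdot> B)) (\<lambda>C.
      given (fn (el A) (\<lambda>x. fn (el (B \<cdot> x) \<^bold>\<rightarrow> el (cst CW \<cdot> A \<cdot> B)) (\<lambda>f.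
        fn (el (B \<cdot> x)) (\<lambda>y. el (C \<cdot> (f \<cdot> y))) \<^bold>\<rightarrow> el (C \<cdot> (cst CSup \<cdot> A \<cdot> B \<cdot> x \<cdot> f))))) (\<lambda>c.
      given (el A) (\<lambda>a. given (el (B \<cdot> a) \<^bold>\<rightarrow> el (cst CW \<cdot> A \<cdot> B)) (\<lambda>f.
      (cst CWrec \<cdot> A \<cdot> B \<cdot> C \<cdot> c \<cdot> (cst CSup \<cdot> A \<cdot> B \<cdot> a \<cdot> f),
       c \<cdot> a \<cdot> f \<cdot> (\<^bold>\<lambda>y. cst CWrec \<cdot> A \<cdot> B \<cdot> C \<cdot> c \<cdot> (f \<cdot> y)),
       el (C \<cdot> (cst CSup \<cdot> A \<cdot> B \<cdot> a \<cdot> f))))))))),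

    given (el (cst CU)) (\<lambda>a. given (el (cst CT \<cdot> a) \<^bold>\<rightarrow> el (cst CU)) (\<lambda>b.
      (cst CT \<cdot> (cst CodePi \<cdot> a \<cdot> b), Pi_s (cst CT \<cdot> a) (\<lambda>x. cst CT \<cdot> (b \<cdot> x)), set_p))),
    given (el (cst CU)) (\<lambda>a. given (el (cst CT \<cdot> a) \<^bold>\<rightarrow> el (cst CU)) (\<lambda>b.
      (cst CT \<cdot> (cst CodeSig \<cdot> a \<cdot> b), Sig_s (cst CT \<cdot> a) (\<lambda>x. cst CT \<cdot> (b \<cdot> x)), set_p))),
    given (el (cst CU)) (\<lambda>a. given (el (cst CU)) (\<lambda>b.
      (cst CT \<cdot> (cst CodePlus \<cdot> a \<cdot> b), cst CPlus \<cdot> (cst CT \<cdot> a) \<cdot> (cst CT \<cdot> b), set_p))),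
    (cst CT \<cdot> cst CodeN0, cst CN0, set_p),
    (cst CT \<cdot> cst CodeN1, cst CN1, set_p),
    (cst CT \<cdot> cst CodeN, cst CN, set_p),
    given (el (cst CU)) (\<lambda>a. (cst CT \<cdot> (cst CodeList \<cdot> a), cst CList \<cdot> (cst CT \<cdot> a), set_p)),
    given (el (cst CU)) (\<lambda>a. given (el (cst CT \<cdot> a)) (\<lambda>x. given (el (cst CT \<cdot> a)) (\<lambda>y.
      (cst CT \<cdot> (cst CodeId \<cdot> a \<cdot> x \<cdot> y), cst CId \<cdot> (cst CT \<cdot> a) \<cdot> x \<cdot> y, set_p)))),
    given (el (cst CU)) (\<lambda>a. given (el (cst CT \<cdot> a) \<^bold>\<rightarrow> el (cst CU)) (\<lambda>b.
      (cst CT \<cdot> (cst CodeW \<cdot> a \<cdot> b), W_s (cst CT \<cdot> a) (\<lambda>x. cst CT \<cdot> (b \<cdot> x)), set_p)))]"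

definition declare_const :: "'c con \<times> 'c pty \<Rightarrow> 'c judgement" where
  "declare_const = (\<lambda>(c, X). ([], HasTy (Con c) (X 0)))"
definition declare_eqn :: "'c peq \<Rightarrow> 'c judgement" where
  "declare_eqn = (\<lambda>(l, r, X). ([], EqTm (l 0) (r 0) (X 0)))"

definition CTT :: "'c judgement set" where
  "CTT = declare_const ` set ctt_constants \<union> declare_eqn ` set ctt_equations"

text \<open>Propositions are sets. From \<open>I\<close>, \<open>R\<close>, \<open>F\<close> and a proof of \<open>R(P, F(P))\<close> for all propositions \<open>P\<close>,
  the first constant gives the uniform index and the second the proof that it works.\<close>

definition gup_rule :: "('c ptm \<Rightarrow> 'c ptm \<Rightarrow> 'c ptm \<Rightarrow> 'c ptm \<Rightarrow> 'c pty) \<Rightarrow> 'c pty" where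
  "gup_rule X = fn set_p (\<lambda>I. fn (set_p \<^bold>\<rightarrow> fam I) (\<lambda>R. fn (set_p \<^bold>\<rightarrow> el I) (\<lambda>F.
     fn (fn set_p (\<lambda>P. el (R \<cdot> P \<cdot> (F \<cdot> P)))) (\<lambda>r. X I R F r))))"

definition GUP_CTT :: "'c judgement set" where
  "GUP_CTT = declare_const ` {
     (CGupI, gup_rule (\<lambda>I R F r. el I)),
     (CGupR, gup_rule (\<lambda>I R F r. fn set_p (\<lambda>P. el (R \<cdot> P \<cdot> (cst CGupI \<cdot> I \<cdot> R \<cdot> F \<cdot> r)))))}"

definition inhabited :: "'c judgement set \<Rightarrow> 'c pty \<Rightarrow> bool" where
  "inhabited A X \<longleftrightarrow> (\<exists>t. derivable A [] (HasTy t (X 0)))"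

definition consistent_ctt :: "'c judgement set \<Rightarrow> bool" where
  "consistent_ctt A \<longleftrightarrow> \<not> inhabited A (el (cst CN0))"


section \<open>Formal spaces in type theory\<close>

text \<open>Subsets of \<open>S\<close> are propositional functions on \<open>S\<close>. A property is given by a list of types, all of
  which have to be inhabited: those that quantify over all subsets are not sets.\<close>

definition imp_s :: "'c ptm \<Rightarrow> 'c ptm \<Rightarrow> 'c ptm" where
  "imp_s A B = Pi_s A (\<lambda>_. B)"
definition and_s :: "'c ptm \<Rightarrow> 'c ptm \<Rightarrow> 'c ptm" where
  "and_s A B = Sig_s A (\<lambda>_. B)"

definition ct_whole :: "'c ptm" where
  "ct_whole = (\<^bold>\<lambda>x. cst CN1)"
definition ct_empty :: "'c ptm" where
  "ct_empty = (\<^bold>\<lambda>x. cst CN0)"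
definition ct_sing :: "'c ptm \<Rightarrow> 'c ptm \<Rightarrow> 'c ptm" where
  "ct_sing S a = (\<^bold>\<lambda>x. cst CId \<cdot> S \<cdot> x \<cdot> a)"
definition ct_cup :: "'c ptm \<Rightarrow> 'c ptm \<Rightarrow> 'c ptm" where
  "ct_cup U V = (\<^bold>\<lambda>x. cst CPlus \<cdot> (U \<cdot> x) \<cdot> (V \<cdot> x))"

definition ct_covers :: "'c ptm \<Rightarrow> 'c ptm \<Rightarrow> 'c ptm \<Rightarrow> 'c ptm \<Rightarrow> 'c ptm" where
  "ct_covers S C U V = Pi_s S (\<lambda>u. imp_s (U \<cdot> u) (C \<cdot> u \<cdot> V))"
definition ct_down :: "'c ptm \<Rightarrow> 'c ptm \<Rightarrow> 'c ptm \<Rightarrow> 'c ptm \<Rightarrow> 'c ptm" where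
  "ct_down S C U V = (\<^bold>\<lambda>d. and_s
     (Sig_s S (\<lambda>u. and_s (U \<cdot> u) (C \<cdot> d \<cdot> ct_sing S u)))
     (Sig_s S (\<lambda>v. and_s (V \<cdot> v) (C \<cdot> d \<cdot> ct_sing S v))))"
definition ct_star :: "'c ptm \<Rightarrow> 'c ptm \<Rightarrow> 'c ptm \<Rightarrow> 'c ptm" where
  "ct_star S C U = (\<^bold>\<lambda>a. ct_covers S C (ct_down S C (ct_sing S a) U) ct_empty)"

definition ct_space :: "'c ptm \<Rightarrow> 'c ptm \<Rightarrow> 'c pty list" where
  "ct_space S C = [
     fn (fam S) (\<lambda>U. fn (el S) (\<lambda>a. el (U \<cdot> a) \<^bold>\<rightarrow> el (C \<cdot> a \<cdot> U))),
     fn (fam S) (\<lambda>U. fn (fam S) (\<lambda>V. fn (el S) (\<lambda>a.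
       el (C \<cdot> a \<cdot> U) \<^bold>\<rightarrow> el (ct_covers S C U V) \<^bold>\<rightarrow> el (C \<cdot> a \<cdot> V)))),
     fn (fam S) (\<lambda>U. fn (fam S) (\<lambda>V. fn (el S) (\<lambda>a.
       el (C \<cdot> a \<cdot> U) \<^bold>\<rightarrow> el (C \<cdot> a \<cdot> V) \<^bold>\<rightarrow> el (C \<cdot> a \<cdot> ct_down S C U V))))]"

definition ct_nontrivial :: "'c ptm \<Rightarrow> 'c ptm \<Rightarrow> 'c pty list" where
  "ct_nontrivial S C = [el (imp_s (ct_covers S C ct_whole ct_empty) (cst CN0))]"
definition ct_de_morgan :: "'c ptm \<Rightarrow> 'c ptm \<Rightarrow> 'c pty list" where
  "ct_de_morgan S C = [fn (fam S) (\<lambda>U. el (ct_covers S C ct_whole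
     (ct_cup (ct_star S C (ct_star S C U)) (ct_star S C U))))]"

text \<open>The standard finite sets, by recursion into the universe: no elements for \<open>zero\<close>, and one more
  for each successor. A finite subset is the image of a function \<open>g\<close> on some \<open>ct_fin n\<close>.\<close>

definition ct_fin :: "'c ptm \<Rightarrow> 'c ptm" where
  "ct_fin n = cst CT \<cdot> (cst CNatrec \<cdot> (\<^bold>\<lambda>x. cst CU) \<cdot> cst CodeN0 \<cdot> (\<^bold>\<lambda>x. \<^bold>\<lambda>y. cst CodePlus \<cdot> y \<cdot> cst CodeN1) \<cdot> n)"
definition ct_value :: "'c ptm \<Rightarrow> 'c ptm \<Rightarrow> 'c ptm \<Rightarrow> 'c ptm \<Rightarrow> 'c ptm" where
  "ct_value S n g i = cst CAp \<cdot> ct_fin n \<cdot> (\<^bold>\<lambda>x. S) \<cdot> g \<cdot> i"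
definition ct_range :: "'c ptm \<Rightarrow> 'c ptm \<Rightarrow> 'c ptm \<Rightarrow> 'c ptm" where
  "ct_range S n g = (\<^bold>\<lambda>x. Sig_s (ct_fin n) (\<lambda>i. cst CId \<cdot> S \<cdot> x \<cdot> ct_value S n g i))"

definition ct_compact :: "'c ptm \<Rightarrow> 'c ptm \<Rightarrow> 'c pty list" where
  "ct_compact S C = [fn (fam S) (\<lambda>U. el (ct_covers S C ct_whole U) \<^bold>\<rightarrow>
     el (Sig_s (cst CN) (\<lambda>n. Sig_s (imp_s (ct_fin n) S) (\<lambda>g. and_s
       (Pi_s S (\<lambda>x. imp_s (ct_range S n g \<cdot> x) (U \<cdot> x)))
       (ct_covers S C ct_whole (ct_range S n g))))))]"
definition ct_well_inside :: "'c ptm \<Rightarrow> 'c ptm \<Rightarrow> 'c ptm \<Rightarrow> 'c ptm \<Rightarrow> 'c ptm" where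
  "ct_well_inside S C b a =
     ct_covers S C ct_whole (ct_cup (ct_star S C (ct_sing S b)) (ct_sing S a))"
definition ct_regular :: "'c ptm \<Rightarrow> 'c ptm \<Rightarrow> 'c pty list" where
  "ct_regular S C = [fn (el S) (\<lambda>a. el (C \<cdot> a \<cdot> (\<^bold>\<lambda>b. ct_well_inside S C b a)))]"

definition ct_image :: "'c ptm \<Rightarrow> 'c ptm \<Rightarrow> 'c ptm \<Rightarrow> 'c ptm" where
  "ct_image S f U = (\<^bold>\<lambda>b. Sig_s S (\<lambda>a. and_s (U \<cdot> a) (f \<cdot> a \<cdot> b)))"
definition ct_continuous ::
    "'c ptm \<Rightarrow> 'c ptm \<Rightarrow> 'c ptm \<Rightarrow> 'c ptm \<Rightarrow> 'c ptm \<Rightarrow> 'c pty list" where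
  "ct_continuous G D S C f = [
     el (ct_covers G D (ct_image S f ct_whole) ct_whole),
     el (ct_covers G D ct_whole (ct_image S f ct_whole)),
     fn (el S) (\<lambda>a. fn (el S) (\<lambda>b. el (ct_covers G D (ct_down G D (f \<cdot> a) (f \<cdot> b))
       (ct_image S f (ct_down S C (ct_sing S a) (ct_sing S b)))))),
     fn (el S) (\<lambda>a. fn (fam S) (\<lambda>U.
       el (C \<cdot> a \<cdot> U) \<^bold>\<rightarrow> el (ct_covers G D (f \<cdot> a) (ct_image S f U))))]"
definition ct_surjective ::
    "'c ptm \<Rightarrow> 'c ptm \<Rightarrow> 'c ptm \<Rightarrow> 'c ptm \<Rightarrow> 'c ptm \<Rightarrow> 'c pty" where
  "ct_surjective G D S C f = fn (el S) (\<lambda>a. fn (fam S) (\<lambda>U.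
     el (ct_covers G D (f \<cdot> a) (ct_image S f U)) \<^bold>\<rightarrow> el (C \<cdot> a \<cdot> U)))"

definition ct_closed :: "'c ptm \<Rightarrow> 'c ptm \<Rightarrow> 'c ptm \<Rightarrow> 'c ptm" where
  "ct_closed G D V = (\<^bold>\<lambda>a. \<^bold>\<lambda>U. D \<cdot> a \<cdot> ct_cup U V)"
definition ct_proper :: "'c ptm \<Rightarrow> 'c ptm \<Rightarrow> 'c ptm \<Rightarrow> 'c pty" where
  "ct_proper G D V = fn (el G) (\<lambda>a. fn (fam G) (\<lambda>U.
     el (ct_closed G D V \<cdot> a \<cdot> U) \<^bold>\<rightarrow> el (D \<cdot> a \<cdot> U))) \<^bold>\<rightarrow> el (cst CN0)"

definition ct_gleason_cover ::
    "'c ptm \<Rightarrow> 'c ptm \<Rightarrow> 'c ptm \<Rightarrow> 'c ptm \<Rightarrow> 'c ptm \<Rightarrow> 'c pty list" where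
  "ct_gleason_cover G D S C f =
     ct_space G D @ ct_compact G D @ ct_regular G D @ ct_de_morgan G D @
     ct_continuous G D S C f @ [ct_surjective G D S C f] @
     [fn (fam G) (\<lambda>V. ct_proper G D V \<^bold>\<rightarrow>
        (ct_surjective G (ct_closed G D V) S C f \<^bold>\<rightarrow> el (cst CN0)))]"

text \<open>Spaces and maps given by definitions: closed terms, which are embedded at every depth.\<close>

definition emb :: "'c tm \<Rightarrow> 'c ptm" where
  "emb t = (\<lambda>d. t)"
definition given_term :: "'c judgement set \<Rightarrow> 'c tm \<Rightarrow> 'c pty \<Rightarrow> bool" where
  "given_term A t X \<longleftrightarrow> scoped 0 t \<and> derivable A [] (HasTy t (X 0))"
definition given_space :: "'c judgement set \<Rightarrow> 'c tm \<Rightarrow> 'c tm \<Rightarrow> bool" where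
  "given_space A S C \<longleftrightarrow> given_term A S set_p \<and>
     given_term A C (el (emb S) \<^bold>\<rightarrow> fam (emb S) \<^bold>\<rightarrow> set_p)"

definition ct_ntcr_space_in :: "'c judgement set \<Rightarrow> 'c tm \<Rightarrow> 'c tm \<Rightarrow> bool" where
  "ct_ntcr_space_in A S C \<longleftrightarrow> given_space A S C \<and>
     (\<forall>X \<in> set (ct_space (emb S) (emb C) @ ct_nontrivial (emb S) (emb C) @
                ct_compact (emb S) (emb C) @ ct_regular (emb S) (emb C)). inhabited A X)"
definition ct_gleason_cover_in ::
    "'c judgement set \<Rightarrow> 'c tm \<Rightarrow> 'c tm \<Rightarrow> 'c tm \<Rightarrow> 'c tm \<Rightarrow> 'c tm \<Rightarrow> bool" where
  "ct_gleason_cover_in A G D S C f \<longleftrightarrow> given_space A G D \<and>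
     given_term A f (el (emb S) \<^bold>\<rightarrow> fam (emb G)) \<and>
     (\<forall>X \<in> set (ct_gleason_cover (emb G) (emb D) (emb S) (emb C) (emb f)). inhabited A X)"

end

theory Submission
  imports Defs
begin

text \<open>A surjection onto a non-trivial space has a non-trivial domain, so it is enough to show that
  under the uniformity principle every compact De Morgan space is trivial. For a proposition \<open>P\<close> let \<open>U\<^sub>P\<close> be the subset of all elements for which \<open>P\<close> holds. By
  the De Morgan law and compactness the space is covered by a finite \<open>u \<subseteq> U\<^sub>P\<^sup>*\<^sup>* \<union> U\<^sub>P\<^sup>*\<close>. For
  \<open>y \<in> u\<close> this says that either \<open>\<not> P\<close> or \<open>P\<close> implies \<open>y \<lhd> \<emptyset>\<close>. The finite subsets form a set, hence
  uniformity yields one \<open>u\<close> for all \<open>P\<close>; the two disjuncts are indexed by a set, hence for every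
  \<open>y \<in> u\<close> uniformity yields one disjunct for all \<open>P\<close>. Taking \<open>P\<close> false, respectively true, gives
  \<open>y \<lhd> \<emptyset>\<close>, and so the whole space is covered by \<open>\<emptyset>\<close>.

  In set theory the argument is carried out in a forcing semantics whose worlds are finite lists of
  hypotheses and in which formulas are forced exactly when they are provable. In type theory it is
  carried out with inhabited sets, the proof terms being dropped as soon as they are constructed.\<close>

section \<open>Structural properties of the first-order calculus\<close>

text \<open>In set theory the obstacle is predicativity. The pseudocomplement
  \<open>U\<^sup>*\<close> is only a class, and the candidates for a finite subset must be gathered
  without power sets. Compactness is therefore applied to a set that the cover relation itself
  provides, and uniformity is used once for the number \<open>n\<close> of elements and once more
  inside a set of images of functions on \<open>n\<close>, supplied by subset collection. The
  disjunction becomes a relation on a fixed set of tags, \<omega> in set theory and the universe in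
  type theory; a shared tag keeps the false and the true proposition from selecting different
  disjuncts.

  Forcing by provability replaces explicit derivations: existential and disjunctive statements are
  opened as in the host logic, and at the root world, whose theory is \<open>T\<close> with the
  uniformity scheme, forcing falsity is inconsistency. In type theory the variable proposition is a
  context entry \<open>SetT\<close>, and uniformity acts on inhabited sums over it. The second
  projection used there has a type that mentions the first one, which is why the computation rule of
  \<open>CSplit\<close> has to be unfolded.\<close>

lemma up_comp: "up r \<circ> up s = up (r \<circ> s)"
proof
  fix n show "(up r \<circ> up s) n = up (r \<circ> s) n" by (cases n) auto
qed

lemma rename_rename: "rename r (rename s p) = rename (r \<circ> s) p"
  by (induction p arbitrary: r s) (auto simp: up_comp)

lemma rename_cong: "(\<And>n. n \<in> fv p \<Longrightarrow> r n = s n) \<Longrightarrow> rename r p = rename s p"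
proof (induction p arbitrary: r s)
  case (Forall p)
  have "up r n = up s n" if "n \<in> fv p" for n using that Forall.prems by (cases n) auto
  then show ?case by (simp add: Forall.IH[of "up r" "up s"])
next
  case (Exists p)
  have "up r n = up s n" if "n \<in> fv p" for n using that Exists.prems by (cases n) auto
  then show ?case by (simp add: Exists.IH[of "up r" "up s"])
next
  case (Conj p q)
  have "rename r p = rename s p" "rename r q = rename s q"
    by (rule Conj.IH(1), simp add: Conj.prems) (rule Conj.IH(2), simp add: Conj.prems)
  then show ?case by simp
next
  case (Disj p q)
  have "rename r p = rename s p" "rename r q = rename s q"
    by (rule Disj.IH(1), simp add: Disj.prems) (rule Disj.IH(2), simp add: Disj.prems)
  then show ?case by simp
next
  case (Impl p q)
  have "rename r p = rename s p" "rename r q = rename s q"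
    by (rule Impl.IH(1), simp add: Impl.prems) (rule Impl.IH(2), simp add: Impl.prems)
  then show ?case by simp
qed simp_all

lemma up_id: "up (\<lambda>n. n) = (\<lambda>n. n)"
proof
  fix n show "up (\<lambda>n. n) n = n" by (cases n) auto
qed

lemma Suc_eq_up_iff: "Suc m = up r k \<longleftrightarrow> (\<exists>n. k = Suc n \<and> m = r n)"
  by (cases k) auto

lemma Suc_mem_up_image: "Suc m \<in> up r ` A \<longleftrightarrow> m \<in> r ` {n. Suc n \<in> A}"
  by (auto simp: image_iff Suc_eq_up_iff)

lemma fv_rename: "fv (rename r p) = r ` fv p"
proof (induction p arbitrary: r)
  case (Forall p)
  show ?case by (auto simp: Forall Suc_mem_up_image)
next
  case (Exists p)
  show ?case by (auto simp: Exists Suc_mem_up_image)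
qed (simp_all add: image_Un)

lemma rename_id: "rename (\<lambda>n. n) p = p"
  by (induction p) (auto simp: up_id)

lemma finite_fv: "finite (fv p)"
proof (induction p)
  case (Forall p)
  have "finite (Suc -` fv p)" using Forall by (simp add: finite_vimageI)
  then show ?case by (simp add: vimage_def)
next
  case (Exists p)
  have "finite (Suc -` fv p)" using Exists by (simp add: finite_vimageI)
  then show ?case by (simp add: vimage_def)
qed auto

text \<open>Links the substitution of the calculus to environments: instantiating the bound variable
  amounts to extending \<open>v\<close> by \<open>t\<close>. The quantifier clauses of the semantics
  are all stated with \<open>case_nat t v\<close>.\<close>

lemma inst0_rename_up: "inst0 (rename (up v) p) t = rename (case_nat t v) p"
  unfolding inst0_def rename_rename
  by (rule arg_cong[of _ _ "\<lambda>r. rename r p"]) (auto simp: fun_eq_iff split: nat.split)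

lemma rename_inst0: "rename r (inst0 p t) = inst0 (rename (up r) p) (r t)"
  unfolding inst0_rename_up unfolding inst0_def rename_rename
  by (rule arg_cong[of _ _ "\<lambda>r. rename r p"]) (auto simp: fun_eq_iff split: nat.split)

lemma rename_lift: "rename (up r) (lift_fm p) = lift_fm (rename r p)"
  unfolding lift_fm_def rename_rename by (rule arg_cong[of _ _ "\<lambda>r. rename r p"]) auto

section \<open>Weakening, renaming and fresh variables\<close>

lemma prv_weaken: "prv T H p \<Longrightarrow> T \<subseteq> T' \<Longrightarrow> set H \<subseteq> set H' \<Longrightarrow> prv T' H' p"
proof (induction arbitrary: H' rule: prv.induct)
  case (axiom p H)
  then show ?case by (simp add: prv.axiom subsetD)
next
  case (hyp p H)
  then show ?case by (simp add: prv.hyp subsetD)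
next
  case (DisjE H p q r)
  have "set (p # H) \<subseteq> set (p # H')" "set (q # H) \<subseteq> set (q # H')" using DisjE.prems(2) by auto
  then show ?case by (rule prv.DisjE[OF DisjE.IH(1)[OF DisjE.prems] DisjE.IH(2)[OF DisjE.prems(1)] DisjE.IH(3)[OF DisjE.prems(1)]])
next
  case (ImplI p H q)
  have "set (p # H) \<subseteq> set (p # H')" using ImplI.prems(2) by auto
  then show ?case by (rule prv.ImplI[OF ImplI.IH[OF ImplI.prems(1)]])
next
  case (ForallI H p)
  have "set (map lift_fm H) \<subseteq> set (map lift_fm H')" using ForallI.prems(2) by auto
  then show ?case by (rule prv.ForallI[OF ForallI.IH[OF ForallI.prems(1)]])
next
  case (ExistsE H p q)
  have "set (p # map lift_fm H) \<subseteq> set (p # map lift_fm H')" using ExistsE.prems(2) by auto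
  then show ?case by (rule prv.ExistsE[OF ExistsE.IH(1)[OF ExistsE.prems] ExistsE.IH(2)[OF ExistsE.prems(1)]])
qed (meson prv.BotE prv.ConjI prv.ConjE1 prv.ConjE2 prv.DisjI1 prv.DisjI2 prv.ImplE prv.ForallE
    prv.ExistsI prv.EqlI prv.EqlE)+

text \<open>Instantiates a block of quantifiers at once. The induction strips the outermost one,
  whose variable has the largest index \<open>n\<close> in \<open>p\<close>; therefore the
  environment \<open>v\<close> has to be general.\<close>

lemma prv_Forall_instance:
  "prv T H (rename v ((Forall ^^ n) p)) \<Longrightarrow>
   prv T H (rename (\<lambda>k. if k < n then ts k else v (k - n)) p)"
proof (induction n arbitrary: v)
  case 0
  then show ?case by simp
next
  case (Suc n)
  have "prv T H (Forall (rename (up v) ((Forall ^^ n) p)))" using Suc.prems by simp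
  from prv.ForallE[OF this, of "ts n"]
  have "prv T H (rename (case_nat (ts n) v) ((Forall ^^ n) p))" by (simp only: inst0_rename_up)
  from Suc.IH[OF this]
  have "prv T H (rename (\<lambda>k. if k < n then ts k else case_nat (ts n) v (k - n)) p)" .
  moreover have "(\<lambda>k. if k < n then ts k else case_nat (ts n) v (k - n))
      = (\<lambda>k. if k < Suc n then ts k else v (k - Suc n))"
    proof
    fix k
    consider "k < n" | "k = n" | m where "k = Suc (n + m)"
      by (metis less_imp_Suc_add linorder_neqE_nat)
    then show "(if k < n then ts k else case_nat (ts n) v (k - n))
      = (if k < Suc n then ts k else v (k - Suc n))" by cases auto
  qed
  ultimately show ?case by simp
qed

lemma fv_funpow_Forall: "fv ((Forall ^^ n) p) = {k. k + n \<in> fv p}"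
  by (induction n) auto

text \<open>The rule \<open>axiom\<close> yields a member of \<open>T\<close> only with its own
  variables. A renamed copy is reached through a universal closure, which no renaming changes,
  followed by instantiation.\<close>

lemma prv_axiom_rename:
  assumes "p \<in> T"
  shows "prv T H (rename r p)"
proof -
  obtain n where n: "\<forall>k\<in>fv p. k < n"
    using finite_fv[of p] finite_nat_set_iff_bounded by blast
  \<comment> \<open>\<open>ForallI\<close> shifts the hypotheses but not \<open>T\<close>, so the
    axiom stays available under every quantifier.\<close>
  have closed: "prv T H ((Forall ^^ m) p)" for H m
    by (induction m arbitrary: H) (auto intro: prv.axiom[OF assms] prv.ForallI)
  have "fv ((Forall ^^ n) p) = {}" using n by (auto simp: fv_funpow_Forall)
  then have "rename r ((Forall ^^ n) p) = rename (\<lambda>k. k) ((Forall ^^ n) p)"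
    by (intro rename_cong) simp
  then have "prv T H (rename r ((Forall ^^ n) p))" using closed by (simp add: rename_id)
  from prv_Forall_instance[OF this]
  have "prv T H (rename (\<lambda>k. if k < n then r k else r (k - n)) p)" .
  moreover have "rename (\<lambda>k. if k < n then r k else r (k - n)) p = rename r p"
    by (rule rename_cong) (use n in auto)
  ultimately show ?thesis by simp
qed

lemma map_lift_rename: "map lift_fm (map (rename r) H) = map (rename (up r)) (map lift_fm H)"
  by (simp add: rename_lift)

text \<open>The renaming may identify variables: no rule has an eigenvariable condition, since
  binders shift the hypotheses instead.\<close>

lemma prv_rename: "prv T H p \<Longrightarrow> prv T (map (rename r) H) (rename r p)"
proof (induction arbitrary: r rule: prv.induct)
  case (axiom p H)
  then show ?case by (rule prv_axiom_rename)
next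
  case (hyp p H)
  then show ?case by (simp add: prv.hyp)
next
  case (BotE H p)
  then show ?case by (simp add: prv.BotE)
next
  case (ConjI H p q)
  then show ?case by (simp add: prv.ConjI)
next
  case (ConjE1 H p q)
  from ConjE1.IH[of r] show ?case by (simp add: prv.ConjE1[where q = "rename r q"])
next
  case (ConjE2 H p q)
  from ConjE2.IH[of r] show ?case by (simp add: prv.ConjE2[where p = "rename r p"])
next
  case (DisjI1 H p q)
  then show ?case by (simp add: prv.DisjI1)
next
  case (DisjI2 H q p)
  then show ?case by (simp add: prv.DisjI2)
next
  case (DisjE H p q s)
  show ?case
    by (rule prv.DisjE[where p = "rename r p" and q = "rename r q"])
      (use DisjE.IH[of r] in simp_all)
next
  case (ImplI p H q)
  from ImplI.IH[of r] show ?case by (simp add: prv.ImplI)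
next
  case (ImplE H p q)
  show ?case
    by (rule prv.ImplE[where p = "rename r p"]) (use ImplE.IH[of r] in simp_all)
next
  case (ForallI H p)
  from ForallI.IH[of "up r"] show ?case
    by (simp only: rename.simps map_lift_rename[symmetric]) (rule prv.ForallI)
next
  case (ForallE H p t)
  from ForallE.IH[of r] show ?case
    by (simp only: rename.simps rename_inst0) (rule prv.ForallE)
next
  case (ExistsI H p t)
  from ExistsI.IH[of r] show ?case
    by (simp only: rename.simps rename_inst0) (rule prv.ExistsI)
next
  case (ExistsE H p q)
  show ?case
  proof (rule prv.ExistsE[where p = "rename (up r) p"])
    show "prv T (map (rename r) H) (Exists (rename (up r) p))" using ExistsE.IH(1)[of r] by simp
    show "prv T (rename (up r) p # map lift_fm (map (rename r) H)) (lift_fm (rename r q))"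
      using ExistsE.IH(2)[of "up r"] by (simp only: list.map map_lift_rename rename_lift)
  qed
next
  case (EqlI H t)
  show ?case by (simp add: prv.EqlI)
next
  case (EqlE H s t p)
  from EqlE.IH[of r] show ?case
    by (simp only: rename.simps rename_inst0) (rule prv.EqlE)
qed

lemma fresh_variable: "\<exists>x. \<forall>p\<in>set H. x \<notin> fv p"
proof -
  have "finite (\<Union>p\<in>set H. fv p)" by (simp add: finite_fv)
  then obtain x where "x \<notin> (\<Union>p\<in>set H. fv p)" using ex_new_if_finite infinite_UNIV_nat by blast
  then show ?thesis by blast
qed

text \<open>Renaming a fresh variable \<open>x\<close> to the bound variable turns \<open>p[x]\<close> into the body of a
  quantifier, and the remaining formulas into their liftings.\<close>

lemma rename_fresh:
  assumes "x \<notin> fv p"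
  shows "rename (\<lambda>n. if n = x then 0 else Suc n) p = lift_fm p"
  unfolding lift_fm_def by (rule rename_cong) (use assms in auto)

lemma rename_fresh_instance:
  assumes "x \<notin> fv (rename v (Forall p))"
  shows "rename (\<lambda>n. if n = x then 0 else Suc n) (rename (case_nat x v) p) = rename (up v) p"
  unfolding rename_rename
proof (rule rename_cong)
  fix n assume n: "n \<in> fv p"
  show "((\<lambda>n. if n = x then 0 else Suc n) \<circ> case_nat x v) n = up v n"
  proof (cases n)
    case (Suc m)
    then have "v m \<in> fv (rename v (Forall p))" using n by (force simp: fv_rename)
    then show ?thesis using Suc assms by auto
  qed simp
qed

text \<open>The premise is taken at every variable instead of under shifted hypotheses: one fresh
  \<open>x\<close> is generic, and renaming it to 0 recovers the premise of \<open>ForallI\<close>.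
  Thus the semantics can quantify over variables without shifting worlds.\<close>

lemma prv_Forall_fresh:
  assumes "\<And>x. prv T H (rename (case_nat x v) p)"
  shows "prv T H (rename v (Forall p))"
proof -
  obtain x where x: "\<forall>q\<in>set (rename v (Forall p) # H). x \<notin> fv q" using fresh_variable by blast
  let ?r = "\<lambda>n. if n = x then 0 else Suc n"
  have "map (rename ?r) H = map lift_fm H" using x by (auto intro: rename_fresh)
  with prv_rename[OF assms[of x], of ?r] x
  have "prv T (map lift_fm H) (rename (up v) p)" by (simp add: rename_fresh_instance)
  then show ?thesis by (simp add: prv.ForallI)
qed

lemma prv_Exists_fresh:
  assumes ex: "prv T H (rename v (Exists p))"
    and step: "\<And>x. prv T (rename (case_nat x v) p # H) q"
  shows "prv T H q"
proof -
  \<comment> \<open>\<open>Forall p\<close> stands in for \<open>Exists p\<close>, which has the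
    same free variables, because \<open>rename_fresh_instance\<close> is stated for it.\<close>
  obtain x where x: "\<forall>q\<in>set (rename v (Forall p) # q # H). x \<notin> fv q" using fresh_variable by blast
  let ?r = "\<lambda>n. if n = x then 0 else Suc n"
  have "map (rename ?r) H = map lift_fm H" "rename ?r q = lift_fm q"
    using x by (auto intro: rename_fresh)
  with prv_rename[OF step[of x], of ?r] x
  have "prv T (rename (up v) p # map lift_fm H) (lift_fm q)" by (simp add: rename_fresh_instance)
  with ex show ?thesis by (auto intro: prv.ExistsE)
qed

section \<open>Forcing by provability\<close>

text \<open>The theory is a component of the world, so that one type of truth values serves all
  theories.\<close>

datatype world = World (world_theory: "fm set") (world_hyps: "fm list")

definition pr :: "world \<Rightarrow> fm \<Rightarrow> bool" where
  "pr w q = prv (world_theory w) (world_hyps w) q"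

definition ext :: "world \<Rightarrow> world \<Rightarrow> bool" (infix "\<preceq>" 50) where
  "w \<preceq> w' \<longleftrightarrow> world_theory w = world_theory w' \<and> set (world_hyps w) \<subseteq> set (world_hyps w')"

lemma ext_refl [simp]: "w \<preceq> w"
  by (simp add: ext_def)

lemma ext_trans [trans]: "w \<preceq> w' \<Longrightarrow> w' \<preceq> w'' \<Longrightarrow> w \<preceq> w''"
  by (auto simp: ext_def)

lemma pr_mono: "w \<preceq> w' \<Longrightarrow> pr w q \<Longrightarrow> pr w' q"
  unfolding pr_def ext_def by (auto intro: prv_weaken)

definition extend :: "world \<Rightarrow> fm \<Rightarrow> world" where
  "extend w p = World (world_theory w) (p # world_hyps w)"

lemma ext_extend [simp]: "w \<preceq> extend w p" and pr_extend [simp]: "pr (extend w p) p"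
  by (auto simp: ext_def pr_def extend_def intro: prv.hyp)

text \<open>Provability is neither prime nor witnessed, so falsity, disjunction and existence are
  interpreted through this closure, which mimics their elimination rules.\<close>

definition jcl :: "world set \<Rightarrow> world set" where
  "jcl A = {w. \<forall>w' q. w \<preceq> w' \<longrightarrow> (\<forall>w''. w' \<preceq> w'' \<longrightarrow> w'' \<in> A \<longrightarrow> pr w'' q) \<longrightarrow> pr w' q}"

lemma jcl_I: "(\<And>w' q. w \<preceq> w' \<Longrightarrow> (\<And>w''. w' \<preceq> w'' \<Longrightarrow> w'' \<in> A \<Longrightarrow> pr w'' q) \<Longrightarrow> pr w' q)
    \<Longrightarrow> w \<in> jcl A"
  unfolding jcl_def by blast

lemma jcl_D: "w \<in> jcl A \<Longrightarrow> w \<preceq> w' \<Longrightarrow> (\<And>w''. w' \<preceq> w'' \<Longrightarrow> w'' \<in> A \<Longrightarrow> pr w'' q) \<Longrightarrow> pr w' q"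
  unfolding jcl_def by blast

lemma jcl_inclI: "(\<And>w'. w \<preceq> w' \<Longrightarrow> w' \<in> A) \<Longrightarrow> w \<in> jcl A"
  unfolding jcl_def using ext_refl by blast

lemma jcl_up: "w \<in> jcl A \<Longrightarrow> w \<preceq> w' \<Longrightarrow> w' \<in> jcl A"
  by (rule jcl_I) (meson jcl_D ext_trans)

lemma jcl_idem: "jcl (jcl A) = jcl A"
proof
  show "jcl A \<subseteq> jcl (jcl A)" by (auto intro!: jcl_I dest: jcl_up)
  show "jcl (jcl A) \<subseteq> jcl A"
  proof
    fix w assume w: "w \<in> jcl (jcl A)"
    show "w \<in> jcl A"
    proof (rule jcl_I)
      fix w' q assume 1: "w \<preceq> w'" and 2: "\<And>w''. w' \<preceq> w'' \<Longrightarrow> w'' \<in> A \<Longrightarrow> pr w'' q"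
      show "pr w' q"
      proof (rule jcl_D[OF w 1])
        fix w'' assume "w' \<preceq> w''" "w'' \<in> jcl A"
        then show "pr w'' q" by (meson jcl_D 2 ext_trans ext_refl)
      qed
    qed
  qed
qed

text \<open>The truth values: upward closed sets of worlds stable under \<open>jcl\<close>.
  Idempotence makes the range the same as the set of fixed points.\<close>

typedef sprop = "range jcl"
  by blast

definition forces :: "world \<Rightarrow> sprop \<Rightarrow> bool" (infix "|=" 52) where
  "w |= A \<longleftrightarrow> w \<in> Rep_sprop A"

lemma jcl_Rep: "jcl (Rep_sprop A) = Rep_sprop A"
proof -
  obtain X where "Rep_sprop A = jcl X" using Rep_sprop[of A] by blast
  then show ?thesis by (simp only: jcl_idem)
qed

lemma forces_up: "w |= A \<Longrightarrow> w \<preceq> w' \<Longrightarrow> w' |= A"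
  unfolding forces_def using jcl_up[of w "Rep_sprop A" w'] by (simp add: jcl_Rep)

text \<open>Membership in \<open>jcl B\<close> licenses case analysis towards any truth value, not
  only towards a provable formula. The eliminations of falsity, disjunction and existence are its
  three instances.\<close>

lemma forces_jcl:
  assumes w: "w \<in> jcl B" and "\<And>w'. w \<preceq> w' \<Longrightarrow> w' \<in> B \<Longrightarrow> w' |= A"
  shows "w |= A"
proof -
  have "w \<in> jcl (jcl (Rep_sprop A))"
  proof (rule jcl_I)
    fix w' q assume w': "w \<preceq> w'" and *: "\<And>w''. w' \<preceq> w'' \<Longrightarrow> w'' \<in> jcl (Rep_sprop A) \<Longrightarrow> pr w'' q"
    show "pr w' q"
    proof (rule jcl_D[OF w w'])
      fix w'' assume w'': "w' \<preceq> w''" "w'' \<in> B"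
      then have "w'' |= A" using assms(2) w' ext_trans by blast
      then show "pr w'' q" using * w'' by (simp add: jcl_Rep forces_def)
    qed
  qed
  then show ?thesis by (simp add: jcl_idem jcl_Rep forces_def)
qed

lemma sprop_eqI: "(\<And>w. w |= A \<longleftrightarrow> w |= B) \<Longrightarrow> A = B"
  unfolding forces_def by (metis Rep_sprop_inject set_eqI)

lemma forces_Abs: "B = jcl B \<Longrightarrow> w |= Abs_sprop B \<longleftrightarrow> w \<in> B"
  unfolding forces_def by (metis Abs_sprop_inverse rangeI)

lemma forces_Abs_jcl: "w |= Abs_sprop (jcl B) \<longleftrightarrow> w \<in> jcl B"
  by (rule forces_Abs) (simp add: jcl_idem)

lemma stableI:
  assumes "\<And>w w'. w \<in> B \<Longrightarrow> w \<preceq> w' \<Longrightarrow> w' \<in> B" and "\<And>w. w \<in> jcl B \<Longrightarrow> w \<in> B"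
  shows "B = jcl B"
  using assms by (auto intro!: jcl_I)

section \<open>The connectives on truth values and their agreement with provability\<close>

definition sAnd :: "sprop \<Rightarrow> sprop \<Rightarrow> sprop" (infixr "\<sqinter>" 65) where
  "(A \<sqinter> B) = Abs_sprop {w. w |= A \<and> w |= B}"
definition sImp :: "sprop \<Rightarrow> sprop \<Rightarrow> sprop" (infixr "\<leadsto>" 55) where
  "(A \<leadsto> B) = Abs_sprop {w. \<forall>w'. w \<preceq> w' \<longrightarrow> w' |= A \<longrightarrow> w' |= B}"
definition sAll :: "(nat \<Rightarrow> sprop) \<Rightarrow> sprop" (binder "\<Sqinter>" 10) where
  "sAll P = Abs_sprop {w. \<forall>t. w |= P t}"
definition sBot :: sprop where
  "sBot = Abs_sprop (jcl {})"
definition sOr :: "sprop \<Rightarrow> sprop \<Rightarrow> sprop" (infixr "\<squnion>" 60) where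
  "(A \<squnion> B) = Abs_sprop (jcl {w. w |= A \<or> w |= B})"
definition sEx :: "(nat \<Rightarrow> sprop) \<Rightarrow> sprop" (binder "\<Squnion>" 10) where
  "sEx P = Abs_sprop (jcl {w. \<exists>t. w |= P t})"
definition sem :: "(nat \<Rightarrow> nat) \<Rightarrow> fm \<Rightarrow> sprop" where
  "sem v p = Abs_sprop {w. pr w (rename v p)}"

lemma forces_And [simp]: "w |= A \<sqinter> B \<longleftrightarrow> w |= A \<and> w |= B"
  unfolding sAnd_def
proof (subst forces_Abs)
  show "{w. w |= A \<and> w |= B} = jcl {w. w |= A \<and> w |= B}"
    by (rule stableI) (use forces_up in blast, use forces_jcl in blast)
qed simp

lemma forces_Imp: "w |= A \<leadsto> B \<longleftrightarrow> (\<forall>w'. w \<preceq> w' \<longrightarrow> w' |= A \<longrightarrow> w' |= B)"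
  unfolding sImp_def
proof (subst forces_Abs)
  let ?B = "{w. \<forall>w'. w \<preceq> w' \<longrightarrow> w' |= A \<longrightarrow> w' |= B}"
  show "?B = jcl ?B"
  proof (rule stableI)
    fix w assume w: "w \<in> jcl ?B"
    have "w' |= B" if "w \<preceq> w'" "w' |= A" for w'
    proof (rule forces_jcl[OF jcl_up[OF w that(1)]])
      fix w'' assume "w' \<preceq> w''" "w'' \<in> ?B"
      then show "w'' |= B" using forces_up[OF that(2), of w''] by simp
    qed
    then show "w \<in> ?B" by blast
  next
    fix w w' assume "w \<in> ?B" "w \<preceq> w'"
    then show "w' \<in> ?B" by (auto intro: ext_trans)
  qed
qed simp

lemma forces_All: "w |= sAll P \<longleftrightarrow> (\<forall>t. w |= P t)"
  unfolding sAll_def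
proof (subst forces_Abs)
  show "{w. \<forall>t. w |= P t} = jcl {w. \<forall>t. w |= P t}"
    by (rule stableI) (use forces_up in blast, use forces_jcl in blast)
qed simp

lemma forces_BotE: "w |= sBot \<Longrightarrow> w |= A"
  unfolding sBot_def forces_Abs_jcl by (rule forces_jcl) auto

lemma forces_OrI1: "w |= A \<Longrightarrow> w |= A \<squnion> B" and forces_OrI2: "w |= B \<Longrightarrow> w |= A \<squnion> B"
  unfolding sOr_def forces_Abs_jcl by (rule jcl_inclI, simp add: forces_up)+

lemma forces_OrE:
  assumes "w |= A \<squnion> B" and "\<And>w'. w \<preceq> w' \<Longrightarrow> w' |= A \<Longrightarrow> w' |= C"
    and "\<And>w'. w \<preceq> w' \<Longrightarrow> w' |= B \<Longrightarrow> w' |= C"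
  shows "w |= C"
  by (rule forces_jcl[OF assms(1)[unfolded sOr_def forces_Abs_jcl]]) (use assms in blast)

lemma forces_ExI: "w |= P t \<Longrightarrow> w |= sEx P"
  unfolding sEx_def forces_Abs_jcl by (rule jcl_inclI) (auto dest: forces_up)

lemma forces_ExE:
  assumes "w |= sEx P" and "\<And>w' t. w \<preceq> w' \<Longrightarrow> w' |= P t \<Longrightarrow> w' |= C"
  shows "w |= C"
  by (rule forces_jcl[OF assms(1)[unfolded sEx_def forces_Abs_jcl]]) (use assms in blast)

lemma forces_sem: "w |= sem v p \<longleftrightarrow> pr w (rename v p)"
  unfolding sem_def
proof (subst forces_Abs)
  show "{w. pr w (rename v p)} = jcl {w. pr w (rename v p)}"
  proof (rule stableI)
    fix w assume "w \<in> jcl {w. pr w (rename v p)}"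
    then have "pr w (rename v p)" by (rule jcl_D) simp_all
    then show "w \<in> {w. pr w (rename v p)}" by simp
  qed (use pr_mono in blast)
qed simp

text \<open>The clauses from here on are equations between truth values and not equivalences at a
  world, so the simplifier can translate a whole formula with them.\<close>

lemma sem_Conj [simp]: "sem v (Conj p q) = (sem v p \<sqinter> sem v q)"
  by (rule sprop_eqI) (simp add: forces_sem pr_def, blast intro: prv.ConjI dest: prv.ConjE1 prv.ConjE2)

lemma pr_ImplD: "pr w (Impl p q) \<Longrightarrow> w \<preceq> w' \<Longrightarrow> pr w' p \<Longrightarrow> pr w' q"
  by (drule (1) pr_mono) (simp add: pr_def prv.ImplE[of _ _ p q])

text \<open>Among the extensions of \<open>w\<close> that prove \<open>p\<close>, the one obtained
  by adding \<open>p\<close> to the hypotheses is generic; \<open>ImplI\<close> discharges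
  it.\<close>

lemma pr_ImplI: "(\<And>w'. w \<preceq> w' \<Longrightarrow> pr w' p \<Longrightarrow> pr w' q) \<Longrightarrow> pr w (Impl p q)"
proof -
  assume "\<And>w'. w \<preceq> w' \<Longrightarrow> pr w' p \<Longrightarrow> pr w' q"
  then have "pr (extend w p) q" by simp
  then show ?thesis by (simp add: pr_def extend_def prv.ImplI)
qed

lemma sem_Impl [simp]: "sem v (Impl p q) = (sem v p \<leadsto> sem v q)"
  by (rule sprop_eqI) (simp add: forces_sem forces_Imp, blast intro: pr_ImplI dest: pr_ImplD)

lemma sem_Forall [simp]: "sem v (Forall p) = (\<Sqinter>t. sem (case_nat t v) p)"
proof (rule sprop_eqI)
  fix w
  have "pr w (rename (case_nat t v) p)" if "pr w (rename v (Forall p))" for t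
    using that prv.ForallE[of "world_theory w" "world_hyps w" "rename (up v) p" t] by (simp add: pr_def inst0_rename_up)
  then show "w |= sem v (Forall p) \<longleftrightarrow> w |= (\<Sqinter>t. sem (case_nat t v) p)"
    unfolding forces_sem forces_All by (meson pr_def prv_Forall_fresh)
qed

lemma sem_Bot [simp]: "sem v Bot = sBot"
proof (rule sprop_eqI)
  fix w
  have "w |= sem v Bot" if "w |= sBot" using forces_BotE[OF that] .
  moreover have "w |= sBot" if "w |= sem v Bot"
    unfolding sBot_def forces_Abs_jcl
  proof (rule jcl_I)
    fix w' q assume "w \<preceq> w'"
    then have "pr w' Bot" using that by (auto simp: forces_sem dest: pr_mono)
    then show "pr w' q" by (simp add: pr_def prv.BotE)
  qed
  ultimately show "w |= sem v Bot \<longleftrightarrow> w |= sBot" by blast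
qed

lemma sem_Disj [simp]: "sem v (Disj p q) = (sem v p \<squnion> sem v q)"
proof (rule sprop_eqI)
  fix w
  have "w |= sem v (Disj p q)" if "w |= sem v p \<squnion> sem v q"
    using that by (rule forces_OrE) (simp_all add: forces_sem pr_def prv.DisjI1 prv.DisjI2)
  moreover have "w |= sem v p \<squnion> sem v q" if "w |= sem v (Disj p q)"
    unfolding sOr_def forces_Abs_jcl
  proof (rule jcl_I)
    fix w' r assume w': "w \<preceq> w'"
      and *: "\<And>w''. w' \<preceq> w'' \<Longrightarrow> w'' \<in> {w. w |= sem v p \<or> w |= sem v q} \<Longrightarrow> pr w'' r"
    \<comment> \<open>The two generic extensions correspond to the two branches of
      \<open>DisjE\<close>.\<close>
    have "pr (extend w' (rename v p)) r" "pr (extend w' (rename v q)) r"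
      by (auto intro!: * simp: forces_sem)
    moreover have "pr w' (rename v (Disj p q))" using that w' by (auto simp: forces_sem intro: pr_mono)
    ultimately show "pr w' r"
      by (simp add: pr_def extend_def prv.DisjE[of _ _ "rename v p" "rename v q"])
  qed
  ultimately show "w |= sem v (Disj p q) \<longleftrightarrow> w |= sem v p \<squnion> sem v q" by blast
qed

lemma sem_Exists [simp]: "sem v (Exists p) = (\<Squnion>t. sem (case_nat t v) p)"
proof (rule sprop_eqI)
  fix w
  have "w |= sem v (Exists p)" if "w |= (\<Squnion>t. sem (case_nat t v) p)"
    using that
  proof (rule forces_ExE)
    fix w' t assume "w' |= sem (case_nat t v) p"
    then show "w' |= sem v (Exists p)"
      using prv.ExistsI[of "world_theory w'" "world_hyps w'" "rename (up v) p" t]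
      by (simp add: forces_sem pr_def inst0_rename_up)
  qed
  moreover have "w |= (\<Squnion>t. sem (case_nat t v) p)" if "w |= sem v (Exists p)"
    unfolding sEx_def forces_Abs_jcl
  proof (rule jcl_I)
    fix w' r assume w': "w \<preceq> w'"
      and *: "\<And>w''. w' \<preceq> w'' \<Longrightarrow> w'' \<in> {w. \<exists>t. w |= sem (case_nat t v) p} \<Longrightarrow> pr w'' r"
    have "pr (extend w' (rename (case_nat t v) p)) r" for t
      by (rule *) (auto simp: forces_sem intro: exI[of _ t])
    moreover have "pr w' (rename v (Exists p))" using that w' by (auto simp: forces_sem intro: pr_mono)
    ultimately show "pr w' r"
      by (simp add: pr_def extend_def del: rename.simps) (rule prv_Exists_fresh)
  qed
  ultimately show "w |= sem v (Exists p) \<longleftrightarrow> w |= (\<Squnion>t. sem (case_nat t v) p)" by blast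
qed

lemma forces_Eql_refl: "w |= sem v (Eql i i)"
  by (simp add: forces_sem pr_def prv.EqlI)

lemma forces_Eql_subst:
  assumes "w |= sem v (Eql i j)" and "w |= sem (case_nat (v i) u) p"
  shows "w |= sem (case_nat (v j) u) p"
  using assms prv.EqlE[of "world_theory w" "world_hyps w" "v i" "v j" "rename (up u) p"]
  by (simp add: forces_sem pr_def inst0_rename_up)

lemma sem_rename: "sem v (rename r p) = sem (v \<circ> r) p"
  by (simp add: sem_def rename_rename)

lemma forces_axiom: "p \<in> world_theory w \<Longrightarrow> w |= sem v p"
  by (simp add: forces_sem pr_def prv_axiom_rename)

section \<open>Formal spaces under forcing\<close>

definition mem :: "nat \<Rightarrow> nat \<Rightarrow> sprop" where
  "mem a b = sem (\<lambda>n. n) (Mem a b)"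
definition eql :: "nat \<Rightarrow> nat \<Rightarrow> sprop" where
  "eql a b = sem (\<lambda>n. n) (Eql a b)"

lemma sem_Mem [simp]: "sem v (Mem i j) = mem (v i) (v j)"
  by (simp add: mem_def sem_def)

lemma sem_Eql [simp]: "sem v (Eql i j) = eql (v i) (v j)"
  by (simp add: eql_def sem_def)

lemma sem_cong: "(\<And>n. n \<in> fv p \<Longrightarrow> u n = v n) \<Longrightarrow> sem u p = sem v p"
  unfolding sem_def using rename_cong[of p u v] by simp

text \<open>Variables beyond the list are parameters of a scheme; under \<open>d\<close> binders
  they are read from position \<open>d\<close> on, which is why they become \<open>v (n + d)\<close>
  in the special cases below.\<close>

lemma sem_inst: "sem v (inst p xs d) =
    sem (\<lambda>n. if n < length xs then v ((xs ! n) d) else v (n - length xs + d)) p"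
  unfolding inst_def sem_rename by (rule sem_cong) simp

lemma sem_inst1: "sem v (inst p [x] d) = sem (case_nat (v (x d)) (\<lambda>n. v (n + d))) p"
  unfolding sem_inst by (rule sem_cong) (auto split: nat.split)

lemma sem_inst2: "sem v (inst p [x, y] d) =
    sem (case_nat (v (x d)) (case_nat (v (y d)) (\<lambda>n. v (n + d)))) p"
  unfolding sem_inst by (rule sem_cong) (auto split: nat.split simp: less_Suc_eq numeral_2_eq_2)

lemma sem_inst3: "sem v (inst p [x, y, z] d) =
    sem (case_nat (v (x d)) (case_nat (v (y d)) (case_nat (v (z d)) (\<lambda>n. v (n + d))))) p"
  unfolding sem_inst by (rule sem_cong) (auto split: nat.split simp: less_Suc_eq numeral_3_eq_3)

abbreviation els :: "nat \<Rightarrow> nat \<Rightarrow> sprop" where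
  "els U \<equiv> \<lambda>x. mem x U"
abbreviation none :: "nat \<Rightarrow> sprop" where
  "none \<equiv> \<lambda>_. sBot"

text \<open>The environment is constant from index 1 on; it is meant for \<open>c\<close> with free
  variables among 0 and 1.\<close>

definition cover_of :: "fm \<Rightarrow> nat \<Rightarrow> nat \<Rightarrow> sprop" where
  "cover_of c a U = sem (case_nat a (\<lambda>_. U)) c"

lemma sem_def_class:
  assumes "fv c \<subseteq> {0, 1}"
  shows "sem v (def_class c a U d) = cover_of c (v (a d)) (v (U d))"
  unfolding def_class_def sem_inst2 cover_of_def by (rule sem_cong) (use assms in \<open>auto split: nat.split\<close>)

section \<open>The vocabulary of formal spaces as operations on truth values\<close>

definition sIff :: "sprop \<Rightarrow> sprop \<Rightarrow> sprop" where
  "sIff A B = (A \<leadsto> B) \<sqinter> (B \<leadsto> A)"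
definition sSub :: "nat \<Rightarrow> nat \<Rightarrow> sprop" where
  "sSub U V = (\<Sqinter>x. mem x U \<leadsto> mem x V)"
definition sEmpty :: "nat \<Rightarrow> sprop" where
  "sEmpty z = (\<Sqinter>x. mem x z \<leadsto> sBot)"
definition sUpair :: "nat \<Rightarrow> nat \<Rightarrow> nat \<Rightarrow> sprop" where
  "sUpair z a b = (\<Sqinter>x. sIff (mem x z) (eql x a \<squnion> eql x b))"
definition sPair :: "nat \<Rightarrow> nat \<Rightarrow> nat \<Rightarrow> sprop" where
  "sPair p a b = (\<Sqinter>z. sIff (mem z p) (sUpair z a a \<squnion> sUpair z a b))"
definition sSucc :: "nat \<Rightarrow> nat \<Rightarrow> sprop" where
  "sSucc z y = (\<Sqinter>x. sIff (mem x z) (mem x y \<squnion> eql x y))"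
definition sInductive :: "nat \<Rightarrow> sprop" where
  "sInductive w = (\<Squnion>z. mem z w \<sqinter> sEmpty z) \<sqinter> (\<Sqinter>y. mem y w \<leadsto> (\<Squnion>z. mem z w \<sqinter> sSucc z y))"
definition sOmega :: "nat \<Rightarrow> sprop" where
  "sOmega w = sInductive w \<sqinter> (\<Sqinter>b. sInductive b \<leadsto> sSub w b)"

definition sCov :: "nat \<Rightarrow> (nat \<Rightarrow> nat \<Rightarrow> sprop) \<Rightarrow> nat \<Rightarrow> (nat \<Rightarrow> sprop) \<Rightarrow> sprop" where
  "sCov S C a P = (\<Squnion>U. (\<Sqinter>b. sIff (mem b U) (mem b S \<sqinter> P b)) \<sqinter> C a U)"
definition sCovers :: "nat \<Rightarrow> (nat \<Rightarrow> nat \<Rightarrow> sprop) \<Rightarrow> (nat \<Rightarrow> sprop) \<Rightarrow> (nat \<Rightarrow> sprop) \<Rightarrow> sprop" where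
  "sCovers S C P Q = (\<Sqinter>u. mem u S \<leadsto> P u \<leadsto> sCov S C u Q)"
definition sDown :: "nat \<Rightarrow> (nat \<Rightarrow> nat \<Rightarrow> sprop) \<Rightarrow> (nat \<Rightarrow> sprop) \<Rightarrow> (nat \<Rightarrow> sprop) \<Rightarrow> nat \<Rightarrow> sprop" where
  "sDown S C P Q d = mem d S \<sqinter> (\<Squnion>u. mem u S \<sqinter> P u \<sqinter> sCov S C d (\<lambda>x. eql x u)) \<sqinter>
     (\<Squnion>v. mem v S \<sqinter> Q v \<sqinter> sCov S C d (\<lambda>x. eql x v))"
definition sStar :: "nat \<Rightarrow> (nat \<Rightarrow> nat \<Rightarrow> sprop) \<Rightarrow> (nat \<Rightarrow> sprop) \<Rightarrow> nat \<Rightarrow> sprop" where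
  "sStar S C P a = mem a S \<sqinter> sCovers S C (sDown S C (\<lambda>x. eql x a) P) none"

definition sMapsTo :: "nat \<Rightarrow> nat \<Rightarrow> nat \<Rightarrow> sprop" where
  "sMapsTo f a v = (\<Squnion>p. mem p f \<sqinter> sPair p a v)"
definition sFun :: "nat \<Rightarrow> nat \<Rightarrow> nat \<Rightarrow> sprop" where
  "sFun f A B = (\<Sqinter>p. mem p f \<leadsto> (\<Squnion>a. mem a A \<sqinter> (\<Squnion>v. mem v B \<sqinter> sPair p a v))) \<sqinter>
     (\<Sqinter>a. mem a A \<leadsto> (\<Squnion>v. sMapsTo f a v \<sqinter> (\<Sqinter>y. sMapsTo f a y \<leadsto> eql y v)))"
definition sOnto :: "nat \<Rightarrow> nat \<Rightarrow> nat \<Rightarrow> sprop" where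
  "sOnto g n u = sFun g n u \<sqinter> (\<Sqinter>y. mem y u \<leadsto> (\<Squnion>i. mem i n \<sqinter> sMapsTo g i y))"

definition sReflexive :: "nat \<Rightarrow> (nat \<Rightarrow> nat \<Rightarrow> sprop) \<Rightarrow> sprop" where
  "sReflexive S C = (\<Sqinter>U. sSub U S \<leadsto> (\<Sqinter>a. mem a S \<leadsto> mem a U \<leadsto> sCov S C a (els U)))"
definition sTransitive :: "nat \<Rightarrow> (nat \<Rightarrow> nat \<Rightarrow> sprop) \<Rightarrow> sprop" where
  "sTransitive S C = (\<Sqinter>U. sSub U S \<leadsto> (\<Sqinter>V. sSub V S \<leadsto> (\<Sqinter>a. mem a S \<leadsto>
     sCov S C a (els U) \<sqinter> sCovers S C (els U) (els V) \<leadsto> sCov S C a (els V))))"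
definition sDeMorgan :: "nat \<Rightarrow> (nat \<Rightarrow> nat \<Rightarrow> sprop) \<Rightarrow> sprop" where
  "sDeMorgan S C = (\<Sqinter>U. sSub U S \<leadsto> sCovers S C (els S)
     (\<lambda>x. sStar S C (sStar S C (els U)) x \<squnion> sStar S C (els U) x))"
definition sCompact :: "nat \<Rightarrow> (nat \<Rightarrow> nat \<Rightarrow> sprop) \<Rightarrow> sprop" where
  "sCompact S C = (\<Sqinter>U. sSub U S \<leadsto> sCovers S C (els S) (els U) \<leadsto>
     (\<Squnion>u. (\<Squnion>w. sOmega w \<sqinter> (\<Squnion>n. mem n w \<sqinter> (\<Squnion>g. sOnto g n u))) \<sqinter> sSub u U \<sqinter>
        sCovers S C (els S) (els u)))"
definition sTrivial :: "nat \<Rightarrow> (nat \<Rightarrow> nat \<Rightarrow> sprop) \<Rightarrow> sprop" where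
  "sTrivial S C = sCovers S C (els S) none"

definition sImage :: "nat \<Rightarrow> nat \<Rightarrow> (nat \<Rightarrow> sprop) \<Rightarrow> nat \<Rightarrow> sprop" where
  "sImage S f P b = (\<Squnion>a. mem a S \<sqinter> P a \<sqinter> (\<Squnion>v. sMapsTo f a v \<sqinter> mem b v))"
definition sSurjective :: "nat \<Rightarrow> (nat \<Rightarrow> nat \<Rightarrow> sprop) \<Rightarrow> nat \<Rightarrow> (nat \<Rightarrow> nat \<Rightarrow> sprop) \<Rightarrow> nat \<Rightarrow> sprop" where
  "sSurjective G D S C f = (\<Sqinter>a. mem a S \<leadsto> (\<Sqinter>U. sSub U S \<leadsto>
     sCovers G D (sImage S f (\<lambda>x. eql x a)) (sImage S f (els U)) \<leadsto> sCov S C a (els U)))"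

lemmas formula_defs = fMem_def fEql_def fBot_def fConj_def fDisj_def fImpl_def fIff_def fNot_def
  fAll_def fEx_def fBall_def fBex_def fEx1_def subset_f_def is_empty_def is_upair_def is_pair_def
  is_succ_def is_inductive_def is_omega_def elem_of_def cz_empty_def cz_sing_def cz_cup_def
  cz_cov_def cz_covers_def cz_down_def cz_star_def all_sub_def maps_to_def is_fun_def is_finite_def
  cz_image_def

lemmas shallow_defs = sIff_def sSub_def sEmpty_def sUpair_def sPair_def sSucc_def sInductive_def
  sOmega_def sCov_def sCovers_def sDown_def sStar_def sMapsTo_def sFun_def sOnto_def sImage_def

text \<open>The depth is the one at which the property occurs in \<open>cz_gleason_cover_in\<close>:
  below the binders of \<open>S\<close>, \<open>G\<close> and \<open>f\<close>, so that
  \<open>S\<close> has index 2, \<open>G\<close> index 1 and \<open>f\<close> index 0.\<close>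

lemma sem_de_morgan:
  assumes "fv c \<subseteq> {0, 1}"
  shows "sem v (cz_de_morgan (\<lambda>e. e - Suc (Suc 0)) (def_class c) (Suc (Suc (Suc 0)))) = sDeMorgan (v 1) (cover_of c)"
  unfolding cz_de_morgan_def sDeMorgan_def
  by (simp add: formula_defs shallow_defs sem_def_class[OF assms])

lemma sem_compact:
  assumes "fv c \<subseteq> {0, 1}"
  shows "sem v (cz_compact (\<lambda>e. e - Suc (Suc 0)) (def_class c) (Suc (Suc (Suc 0)))) = sCompact (v 1) (cover_of c)"
  unfolding cz_compact_def sCompact_def
  by (simp add: formula_defs shallow_defs sem_def_class[OF assms])

section \<open>Rules for reasoning at a world\<close>

lemma forces_ImpI: "(\<And>w'. w \<preceq> w' \<Longrightarrow> w' |= A \<Longrightarrow> w' |= B) \<Longrightarrow> w |= A \<leadsto> B"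
  by (simp add: forces_Imp)

lemma forces_ImpE: "w |= A \<leadsto> B \<Longrightarrow> w |= A \<Longrightarrow> w |= B"
  using ext_refl forces_Imp by blast

lemma forces_AllI: "(\<And>t. w |= P t) \<Longrightarrow> w |= sAll P"
  by (simp add: forces_All)

lemma forces_AllE: "w |= sAll P \<Longrightarrow> w |= P t"
  by (simp add: forces_All)

lemma forces_IffI:
  assumes "\<And>w'. w \<preceq> w' \<Longrightarrow> w' |= A \<Longrightarrow> w' |= B" and "\<And>w'. w \<preceq> w' \<Longrightarrow> w' |= B \<Longrightarrow> w' |= A"
  shows "w |= sIff A B"
  using assms by (simp add: sIff_def forces_Imp)

lemma forces_IffD: "w |= sIff A B \<Longrightarrow> w |= A \<longleftrightarrow> w |= B"
  unfolding sIff_def forces_And by (blast intro: forces_ImpE)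

text \<open>The set that witnesses the cover is kept and only its description changes, so
  \<open>C\<close> is applied to the same set throughout.\<close>

lemma sCov_cong:
  assumes cov: "w |= sCov S C a P"
    and eq: "\<And>w' b. w \<preceq> w' \<Longrightarrow> w' |= mem b S \<Longrightarrow> w' |= P b \<longleftrightarrow> w' |= Q b"
  shows "w |= sCov S C a Q"
  using cov unfolding sCov_def
proof (rule forces_ExE)
  fix w' U assume w': "w \<preceq> w'" and U: "w' |= (\<Sqinter>b. sIff (mem b U) (mem b S \<sqinter> P b)) \<sqinter> C a U"
  have "w' |= sIff (mem b U) (mem b S \<sqinter> Q b)" for b
  proof -
    have iff: "w'' |= mem b U \<longleftrightarrow> w'' |= mem b S \<sqinter> Q b" if "w' \<preceq> w''" for w''
    proof -
      have "w'' |= sIff (mem b U) (mem b S \<sqinter> P b)"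
        using forces_up[OF _ that] U by (simp add: forces_All)
      from forces_IffD[OF this] eq[OF ext_trans[OF w' that], of b] show ?thesis by auto
    qed
    show ?thesis by (rule forces_IffI) (simp_all only: iff)
  qed
  with U show "w' |= (\<Squnion>U. (\<Sqinter>b. sIff (mem b U) (mem b S \<sqinter> Q b)) \<sqinter> C a U)"
    by (intro forces_ExI[where t = U]) (simp add: forces_All)
qed

lemma sCoversI:
  assumes "\<And>w' u. w \<preceq> w' \<Longrightarrow> w' |= mem u S \<Longrightarrow> w' |= P u \<Longrightarrow> w' |= sCov S C u Q"
  shows "w |= sCovers S C P Q"
  unfolding sCovers_def
  by (intro forces_AllI forces_ImpI) (meson assms ext_trans forces_up)

lemma sCoversD:
  assumes "w |= sCovers S C P Q" and "w |= mem u S" and "w |= P u"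
  shows "w |= sCov S C u Q"
  using assms unfolding sCovers_def forces_All by (meson forces_ImpE)

lemma sSubI: "(\<And>w' x. w \<preceq> w' \<Longrightarrow> w' |= mem x U \<Longrightarrow> w' |= mem x V) \<Longrightarrow> w |= sSub U V"
  unfolding sSub_def by (intro forces_AllI forces_ImpI)

lemma sSubD: "w |= sSub U V \<Longrightarrow> w |= mem x U \<Longrightarrow> w |= mem x V"
  unfolding sSub_def forces_All by (meson forces_ImpE)

lemma sEmptyD: "w |= sEmpty z \<Longrightarrow> w |= mem x z \<Longrightarrow> w |= A"
  unfolding sEmpty_def forces_All by (meson forces_ImpE forces_BotE)

lemma eql_refl [simp]: "w |= eql a a"
  using forces_Eql_refl[of w "\<lambda>n. n" a] by simp

text \<open>Leibniz substitution is available for functions on variables that come from a formula;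
  the last premise demands such a formula \<open>p\<close>, with its parameters in
  \<open>v\<close>.\<close>

lemma eql_subst:
  assumes "w |= eql a b" and "w |= P a" and "\<And>x. P x = sem (case_nat x v) p"
  shows "w |= P b"
  using assms forces_Eql_subst[of w "\<lambda>n. n" a b v p] by simp

lemma eql_sym: "w |= eql a b \<Longrightarrow> w |= eql b a"
  by (erule eql_subst[where P = "\<lambda>x. eql x a" and p = "Eql 0 1" and v = "\<lambda>_. a"]) simp_all

lemma eql_mem_left: "w |= eql a b \<Longrightarrow> w |= mem a c \<Longrightarrow> w |= mem b c"
  by (erule eql_subst[where P = "\<lambda>x. mem x c" and p = "Mem 0 1" and v = "\<lambda>_. c"]) simp_all

section \<open>Axioms of CZF and the uniformity scheme at a world\<close>

definition over :: "fm set \<Rightarrow> world \<Rightarrow> bool" where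
  "over T w \<longleftrightarrow> T \<subseteq> world_theory w"

lemma over_up: "over T w \<Longrightarrow> w \<preceq> w' \<Longrightarrow> over T w'"
  by (simp add: over_def ext_def)

lemma over_axiom: "over T w \<Longrightarrow> p \<in> T \<Longrightarrow> w |= sem v p"
  unfolding over_def by (blast intro: forces_axiom)

lemma CZF_extensionality:
  assumes "over CZF w" and "\<And>w' x. w \<preceq> w' \<Longrightarrow> w' |= mem x a \<longleftrightarrow> w' |= mem x b"
  shows "w |= eql a b"
proof -
  have "w |= sem (\<lambda>n. n) (extensionality 0)"
    by (rule over_axiom[OF assms(1)]) (simp add: CZF_def)
  then have "w |= (\<Sqinter>a b. (\<Sqinter>x. sIff (mem x a) (mem x b)) \<leadsto> eql a b)"
    by (simp add: extensionality_def formula_defs shallow_defs)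
  then have "w |= (\<Sqinter>x. sIff (mem x a) (mem x b)) \<leadsto> eql a b" by (simp add: forces_All)
  moreover have "w |= (\<Sqinter>x. sIff (mem x a) (mem x b))"
    by (intro forces_AllI forces_IffI) (simp_all add: assms(2))
  ultimately show ?thesis by (rule forces_ImpE)
qed

lemma CZF_pairing:
  assumes "over CZF w"
  shows "w |= (\<Squnion>z. sUpair z a b)"
proof -
  have "w |= sem (\<lambda>n. n) (pairing 0)"
    by (rule over_axiom[OF assms(1)]) (simp add: CZF_def)
  then have "w |= (\<Sqinter>a b. \<Squnion>z. sUpair z a b)"
    by (simp add: pairing_def formula_defs shallow_defs)
  then show ?thesis by (simp add: forces_All)
qed

lemma CZF_infinity:
  assumes "over CZF w"
  shows "w |= (\<Squnion>z. sOmega z)"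
proof -
  have "w |= sem (\<lambda>n. n) (strong_infinity 0)"
    by (rule over_axiom[OF assms(1)]) (simp add: CZF_def)
  then show ?thesis
    by (simp add: strong_infinity_def formula_defs shallow_defs)
qed

lemma CZF_inter:
  assumes "over CZF w"
  shows "w |= (\<Squnion>z. \<Sqinter>x. sIff (mem x z) (mem x a \<sqinter> mem x b))"
proof -
  \<comment> \<open>Variable 1 is a parameter of this instance; the constant environment used next
    gives it the value \<open>b\<close>.\<close>
  have "separation (Mem 0 1) 0 \<in> CZF" by (auto simp: CZF_def intro: bounded_fm.intros)
  then have "w |= sem (\<lambda>_. b) (separation (Mem 0 1) 0)" by (rule over_axiom[OF assms(1)])
  then have "w |= (\<Sqinter>a. \<Squnion>z. \<Sqinter>x. sIff (mem x z) (mem x a \<sqinter> mem x b))"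
    by (simp add: separation_def sem_inst1 formula_defs shallow_defs)
  then show ?thesis by (simp add: forces_All)
qed

text \<open>The instance for the relation that \<open>u\<close> sends \<open>x\<close> to
  \<open>y\<close>, with \<open>u\<close> itself as the parameter of the scheme. If \<open>u\<close>
  is a function from \<open>a\<close> to \<open>b\<close>, then \<open>d\<close> must be its image;
  so \<open>c\<close> contains the images of all functions from \<open>a\<close> to
  \<open>b\<close>.\<close>

lemma CZF_subset_collection:
  assumes "over CZF w"
  shows "w |= (\<Squnion>c. \<Sqinter>u. (\<Sqinter>x. mem x a \<leadsto> (\<Squnion>y. mem y b \<sqinter> sMapsTo u x y)) \<leadsto>
    (\<Squnion>d. mem d c \<sqinter> (\<Sqinter>x. mem x a \<leadsto> (\<Squnion>y. mem y d \<sqinter> sMapsTo u x y)) \<sqinter>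
      (\<Sqinter>y. mem y d \<leadsto> (\<Squnion>x. mem x a \<sqinter> sMapsTo u x y))))"
proof -
  let ?p = "maps_to (\<lambda>e. e + 2) (\<lambda>e. e) (\<lambda>e. e + 1) 0"
  have "subset_collection ?p 0 \<in> CZF" by (auto simp: CZF_def)
  then have "w |= sem (\<lambda>n. n) (subset_collection ?p 0)" by (rule over_axiom[OF assms(1)])
  then have "w |= (\<Sqinter>a b. \<Squnion>c. \<Sqinter>u. (\<Sqinter>x. mem x a \<leadsto> (\<Squnion>y. mem y b \<sqinter> sMapsTo u x y)) \<leadsto>
    (\<Squnion>d. mem d c \<sqinter> (\<Sqinter>x. mem x a \<leadsto> (\<Squnion>y. mem y d \<sqinter> sMapsTo u x y)) \<sqinter>
      (\<Sqinter>y. mem y d \<leadsto> (\<Squnion>x. mem x a \<sqinter> sMapsTo u x y))))"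
    by (simp add: subset_collection_def sem_inst3 formula_defs shallow_defs)
  then show ?thesis by (simp add: forces_All)
qed

text \<open>The scheme ranges over formulas, so the relation \<open>A\<close> has to be exhibited by
  some \<open>p\<close>. The lemmas \<open>sem_finite_decided\<close>, \<open>sem_decided\<close>
  and \<open>sem_choice\<close> serve this premise.\<close>

lemma GUP_CZF_instance:
  assumes "over GUP_CZF w" and "w |= (\<Sqinter>x. \<Squnion>y. mem y I \<sqinter> A x y)"
    and A: "\<And>x y. A x y = sem (case_nat x (case_nat y v)) p"
  shows "w |= (\<Squnion>y. mem y I \<sqinter> (\<Sqinter>x. A x y))"
proof -
  let ?g = "\<^bold>\<forall>I. (\<^bold>\<forall>x. fBex I (\<lambda>y. inst p [x, y])) \<^bold>\<longrightarrow> fBex I (\<lambda>y. \<^bold>\<forall>x. inst p [x, y])"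
  have "?g 0 \<in> GUP_CZF" by (auto simp: GUP_CZF_def)
  then have "w |= sem v (?g 0)" by (rule over_axiom[OF assms(1)])
  then have "w |= (\<Sqinter>I. (\<Sqinter>x. \<Squnion>y. mem y I \<sqinter> A x y) \<leadsto> (\<Squnion>y. mem y I \<sqinter> (\<Sqinter>x. A x y)))"
    by (simp add: sem_inst2 A formula_defs)
  then show ?thesis using assms(2) unfolding forces_All[where P = "\<lambda>I. _ I \<leadsto> _ I"] by (meson forces_ImpE)
qed

section \<open>The uniformity scheme trivialises compact De Morgan spaces\<close>

lemma forces_Or_same: "w |= A \<squnion> A \<longleftrightarrow> w |= A"
proof
  show "w |= A" if "w |= A \<squnion> A" using that by (rule forces_OrE)
qed (rule forces_OrI1)

lemma sUpairD: "w |= sUpair z a b \<Longrightarrow> w |= mem x z \<longleftrightarrow> w |= eql x a \<squnion> eql x b"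
  unfolding sUpair_def by (rule forces_IffD) (simp add: forces_All)

lemma sUpair_singleton: "w |= sUpair z a a \<Longrightarrow> w |= mem x z \<longleftrightarrow> w |= eql x a"
  by (simp only: sUpairD forces_Or_same)

lemma sReflexiveD:
  assumes "w |= sReflexive S C" and "w |= sSub U S" and "w |= mem a S" and "w |= mem a U"
  shows "w |= sCov S C a (els U)"
  using forces_ImpE[OF forces_ImpE[OF forces_AllE[OF forces_ImpE[OF forces_AllE[OF
    assms(1)[unfolded sReflexive_def]] assms(2)]] assms(3)] assms(4)] .

lemma sTransitiveD:
  assumes "w |= sTransitive S C" and "w |= sSub U S" and "w |= sSub V S" and "w |= mem a S"
    and "w |= sCov S C a (els U)" and "w |= sCovers S C (els U) (els V)"
  shows "w |= sCov S C a (els V)"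
  by (rule forces_ImpE[OF forces_ImpE[OF forces_AllE[OF forces_ImpE[OF forces_AllE[OF forces_ImpE[OF
    forces_AllE[OF assms(1)[unfolded sTransitive_def]] assms(2)]] assms(3)]] assms(4)]])
    (simp add: assms(5,6))

lemma sDeMorganD:
  assumes "w |= sDeMorgan S C" and "w |= sSub U S"
  shows "w |= sCovers S C (els S)
     (\<lambda>x. sStar S C (sStar S C (els U)) x \<squnion> sStar S C (els U) x)"
  by (rule forces_ImpE[OF forces_AllE[OF assms(1)[unfolded sDeMorgan_def]] assms(2)])

text \<open>Reflexivity speaks of subsets given as sets. Pairing turns the class of elements equal
  to \<open>a\<close> into one.\<close>

lemma cover_singleton:
  assumes "over CZF w" and r: "w |= sReflexive S C" and a: "w |= mem a S"
  shows "w |= sCov S C a (\<lambda>x. eql x a)"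
  using CZF_pairing[OF assms(1)]
proof (rule forces_ExE)
  fix w' U assume w': "w \<preceq> w'" and U: "w' |= sUpair U a a"
  note r' = forces_up[OF r w'] and a' = forces_up[OF a w']
  have mem_U: "w'' |= mem x U \<longleftrightarrow> w'' |= eql x a" if "w' \<preceq> w''" for w'' x
    by (rule sUpair_singleton[OF forces_up[OF U that]])
  have "w' |= sSub U S"
    by (rule sSubI) (use mem_U a' eql_sym eql_mem_left forces_up in blast)
  moreover have "w' |= mem a U" by (simp add: mem_U)
  ultimately have "w' |= sCov S C a (els U)"
    using r' a' by (blast intro: sReflexiveD)
  then show "w' |= sCov S C a (\<lambda>x. eql x a)"
    by (rule sCov_cong) (simp add: mem_U)
qed

text \<open>An element \<open>a\<close> of \<open>P\<close> belongs to \<open>a \<down> P\<close>,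
  because \<open>a\<close> is covered by its singleton; membership in the pseudocomplement covers
  all of \<open>a \<down> P\<close> by the empty set.\<close>

lemma star_covered_by_empty:
  assumes z: "over CZF w" and r: "w |= sReflexive S C" and st: "w |= sStar S C P a" and P: "w |= P a"
  shows "w |= sCov S C a none"
proof -
  have a: "w |= mem a S" and c: "w |= sCovers S C (sDown S C (\<lambda>x. eql x a) P) none"
    using st by (simp_all add: sStar_def)
  show ?thesis
    by (rule sCoversD[OF c a])
      (auto simp: sDown_def a P cover_singleton[OF z r a] intro!: forces_ExI[where t = a])
qed

text \<open>Nothing lies below an element of an empty \<open>U\<close>, so \<open>a\<close> is also
  in the pseudocomplement of \<open>U\<close>. The previous lemma applies with that pseudocomplement
  in the role of \<open>P\<close>.\<close>

lemma star_star_empty: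
  assumes z: "over CZF w" and r: "w |= sReflexive S C"
    and st: "w |= sStar S C (sStar S C (els U)) a" and U: "w |= sEmpty U"
  shows "w |= sCov S C a none"
proof (rule star_covered_by_empty[OF z r st])
  have a: "w |= mem a S" using st by (simp add: sStar_def)
  have "w |= sCovers S C (sDown S C (\<lambda>x. eql x a) (els U)) none"
  proof (rule sCoversI)
    fix w' u assume w': "w \<preceq> w'" and "w' |= sDown S C (\<lambda>x. eql x a) (els U) u"
    then have "w' |= (\<Squnion>v. mem v S \<sqinter> mem v U \<sqinter> sCov S C u (\<lambda>x. eql x v))"
      by (simp add: sDown_def)
    then show "w' |= sCov S C u none"
    proof (rule forces_ExE)
      fix w'' v assume w'': "w' \<preceq> w''" and "w'' |= mem v S \<sqinter> mem v U \<sqinter> sCov S C u (\<lambda>x. eql x v)"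
      then show "w'' |= sCov S C u none"
        using forces_up[OF U ext_trans[OF w' w'']] by (auto dest: sEmptyD)
    qed
  qed
  then show "w |= sStar S C (els U) a" by (simp add: sStar_def a)
qed

text \<open>What remains of \<open>u \<subseteq> U\<^sup>*\<^sup>* \<union> U\<^sup>*\<close> for \<open>U = S \<inter> x\<close>: if \<open>x\<close> is empty, then elements of
  \<open>U\<^sup>*\<^sup>*\<close> are covered by the empty set; if \<open>x\<close> contains \<open>S\<close>, then elements of \<open>U\<^sup>*\<close> are.\<close>

definition sDecided :: "nat \<Rightarrow> (nat \<Rightarrow> nat \<Rightarrow> sprop) \<Rightarrow> nat \<Rightarrow> nat \<Rightarrow> sprop" where
  "sDecided S C x u = sCovers S C (els S) (els u) \<sqinter>
     (\<Sqinter>y. mem y u \<leadsto> mem y S \<sqinter>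
        ((sEmpty x \<leadsto> sCov S C y none) \<squnion> (sSub S x \<leadsto> sCov S C y none)))"

definition sFinite :: "nat \<Rightarrow> sprop" where
  "sFinite u = (\<Squnion>z. sOmega z \<sqinter> (\<Squnion>n. mem n z \<sqinter> (\<Squnion>g. sOnto g n u)))"

lemma sCompactD:
  assumes "w |= sCompact S C" and "w |= sSub U S" and "w |= sCovers S C (els S) (els U)"
  shows "w |= (\<Squnion>u. sFinite u \<sqinter> sSub u U \<sqinter> sCovers S C (els S) (els u))"
  using forces_ImpE[OF forces_ImpE[OF forces_AllE[OF assms(1)[unfolded sCompact_def]] assms(2)] assms(3)]
  unfolding sFinite_def .

lemma de_morgan_decision:
  assumes z: "over CZF w" and r: "w |= sReflexive S C"
    and U: "\<And>w' y. w \<preceq> w' \<Longrightarrow> w' |= mem y U \<longleftrightarrow> w' |= mem y S \<sqinter> mem y x"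
    and st: "w |= sStar S C (sStar S C (els U)) y \<squnion> sStar S C (els U) y"
  shows "w |= (sEmpty x \<leadsto> sCov S C y none) \<squnion> (sSub S x \<leadsto> sCov S C y none)"
  using st
proof (rule forces_OrE)
  fix w' assume w': "w \<preceq> w'" and st: "w' |= sStar S C (sStar S C (els U)) y"
  show "w' |= (sEmpty x \<leadsto> sCov S C y none) \<squnion> (sSub S x \<leadsto> sCov S C y none)"
  proof (intro forces_OrI1 forces_ImpI)
    fix w'' assume w'': "w' \<preceq> w''" and x: "w'' |= sEmpty x"
    have ww: "w \<preceq> w''" using w' w'' by (rule ext_trans)
    have "w'' |= sEmpty U" unfolding sEmpty_def
    proof (intro forces_AllI forces_ImpI)
      fix t v assume v: "w'' \<preceq> v" and "v |= mem t U"
      then have "v |= mem t x" using U[OF ext_trans[OF ww v]] by simp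
      then show "v |= sBot" by (rule sEmptyD[OF forces_up[OF x v]])
    qed
    then show "w'' |= sCov S C y none"
      using star_star_empty over_up[OF z ww] forces_up[OF r ww] forces_up[OF st w''] by blast
  qed
next
  fix w' assume w': "w \<preceq> w'" and st: "w' |= sStar S C (els U) y"
  show "w' |= (sEmpty x \<leadsto> sCov S C y none) \<squnion> (sSub S x \<leadsto> sCov S C y none)"
  proof (intro forces_OrI2 forces_ImpI)
    fix w'' assume w'': "w' \<preceq> w''" and x: "w'' |= sSub S x"
    have ww: "w \<preceq> w''" using w' w'' by (rule ext_trans)
    note st' = forces_up[OF st w'']
    then have "w'' |= mem y S" by (simp add: sStar_def)
    with x have "w'' |= mem y U" using U[OF ww] sSubD by simp
    with st' show "w'' |= sCov S C y none"
      by (rule star_covered_by_empty[OF over_up[OF z ww] forces_up[OF r ww], of _ y])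
  qed
qed

lemma finite_decided_cover:
  assumes z: "over CZF w" and r: "w |= sReflexive S C" and dm: "w |= sDeMorgan S C"
    and cp: "w |= sCompact S C" and a: "w |= mem a S"
  shows "w |= (\<Squnion>u. sFinite u \<sqinter> sDecided S C x u)"
  using CZF_inter[OF z, of S x]
proof (rule forces_ExE)
  fix w1 U assume w1: "w \<preceq> w1" and U: "w1 |= (\<Sqinter>y. sIff (mem y U) (mem y S \<sqinter> mem y x))"
  let ?Q = "\<lambda>y. sStar S C (sStar S C (els U)) y \<squnion> sStar S C (els U) y"
  have mem_U: "v |= mem y U \<longleftrightarrow> v |= mem y S \<sqinter> mem y x" if "w1 \<preceq> v" for v y
    by (rule forces_IffD[OF forces_AllE[OF forces_up[OF U that]]])
  have "w1 |= sSub U S" by (rule sSubI) (simp add: mem_U)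
  then have dm1: "w1 |= sCovers S C (els S) ?Q"
    by (rule sDeMorganD[OF forces_up[OF dm w1]])
  \<comment> \<open>Compactness requires a set, while \<open>?Q\<close> is only a class. That
    \<open>a\<close> is covered by \<open>?Q\<close> includes a set \<open>W\<close> with exactly
    its elements; this is the purpose of having an element \<open>a\<close> of
    \<open>S\<close>.\<close>
  have "w1 |= sCov S C a ?Q" using forces_up[OF a w1] by (intro sCoversD[OF dm1])
  then show "w1 |= (\<Squnion>u. sFinite u \<sqinter> sDecided S C x u)"
    unfolding sCov_def[of S C a]
  proof (rule forces_ExE)
    fix w2 W assume w2: "w1 \<preceq> w2" and "w2 |= (\<Sqinter>b. sIff (mem b W) (mem b S \<sqinter> ?Q b)) \<sqinter> C a W"
    then have W: "w2 |= (\<Sqinter>b. sIff (mem b W) (mem b S \<sqinter> ?Q b))" by simp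
    have ww2: "w \<preceq> w2" using w1 w2 by (rule ext_trans)
    have mem_W: "v |= mem y W \<longleftrightarrow> v |= mem y S \<sqinter> ?Q y" if "w2 \<preceq> v" for v y
      by (rule forces_IffD[OF forces_AllE[OF forces_up[OF W that]]])
    have "w2 |= sSub W S" by (rule sSubI) (simp add: mem_W)
    moreover have "w2 |= sCovers S C (els S) (els W)"
    proof (rule sCoversI)
      fix v u assume v: "w2 \<preceq> v" and u: "v |= mem u S"
      have "v |= sCov S C u ?Q" by (rule sCoversD[OF forces_up[OF dm1 ext_trans[OF w2 v]] u u])
      then show "v |= sCov S C u (els W)"
        by (rule sCov_cong) (use mem_W ext_trans[OF v] in auto)
    qed
    ultimately have "w2 |= (\<Squnion>u. sFinite u \<sqinter> sSub u W \<sqinter>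
        sCovers S C (els S) (els u))"
      by (rule sCompactD[OF forces_up[OF cp ww2]])
    then show "w2 |= (\<Squnion>u. sFinite u \<sqinter> sDecided S C x u)"
    proof (rule forces_ExE)
      fix w3 u assume w3: "w2 \<preceq> w3"
        and u: "w3 |= sFinite u \<sqinter> sSub u W \<sqinter> sCovers S C (els S) (els u)"
      have "v |= mem y S \<sqinter> ((sEmpty x \<leadsto> sCov S C y none) \<squnion> (sSub S x \<leadsto> sCov S C y none))"
        if v: "w3 \<preceq> v" and y: "v |= mem y u" for v y
      proof -
        have v2: "w2 \<preceq> v" and v1: "w1 \<preceq> v" and v0: "w \<preceq> v"
          using v w3 w2 ww2 ext_trans by blast+
        have "v |= sSub u W" using u v by (auto dest: forces_up)
        then have "v |= mem y W" using y by (rule sSubD)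
        then have *: "v |= mem y S" "v |= ?Q y" using mem_W[OF v2] by auto
        from de_morgan_decision[OF over_up[OF z v0] forces_up[OF r v0] _ *(2)] mem_U ext_trans[OF v1] *(1)
        show ?thesis by simp
      qed
      then have "w3 |= sDecided S C x u"
        unfolding sDecided_def forces_And using u by (auto intro!: forces_AllI forces_ImpI)
      with u show "w3 |= (\<Squnion>u. sFinite u \<sqinter> sDecided S C x u)"
        by (intro forces_ExI[where t = u]) simp
    qed
  qed
qed

section \<open>Kuratowski pairs, functions and finite subsets\<close>

lemma sPair_singleton:
  assumes "w |= sPair p a b" and "w |= sUpair z a a"
  shows "w |= mem z p"
  using forces_IffD[OF forces_AllE[OF assms(1)[unfolded sPair_def], of z]] assms(2)
  by (blast intro: forces_OrI1)

text \<open>The singleton of \<open>a\<close> is an element of \<open>p\<close>, hence the singleton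
  of \<open>c\<close> or the pair of \<open>c\<close> and \<open>d\<close>. In both cases it
  contains \<open>c\<close>.\<close>

lemma sPair_first_eq:
  assumes z: "over CZF w" and p: "w |= sPair p a b" and q: "w |= sPair p c d"
  shows "w |= eql c a"
  using CZF_pairing[OF z]
proof (rule forces_ExE)
  fix w1 z assume w1: "w \<preceq> w1" and s: "w1 |= sUpair z a a"
  have "w1 |= mem z p" by (rule sPair_singleton[OF forces_up[OF p w1] s])
  then have "w1 |= sUpair z c c \<squnion> sUpair z c d"
    using forces_IffD[OF forces_AllE[OF forces_up[OF q w1, unfolded sPair_def], of z]] by simp
  then have "w1 |= mem c z"
    by (rule forces_OrE) (simp_all add: sUpairD forces_OrI1)
  then show "w1 |= eql c a" by (simp add: sUpair_singleton[OF s])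
qed

lemma eql_mapsTo: "w |= eql a b \<Longrightarrow> w |= sMapsTo f a v \<Longrightarrow> w |= sMapsTo f b v"
  by (erule eql_subst[where P = "\<lambda>x. sMapsTo f x v"
        and p = "maps_to (\<lambda>e. e + 1) (\<lambda>e. e) (\<lambda>e. e + 2) 0" and v = "case_nat f (\<lambda>_. v)"])
    (simp_all add: formula_defs shallow_defs)

lemma sFun_total:
  assumes "w |= sFun f A B" and "w |= mem a A"
  shows "w |= (\<Squnion>v. sMapsTo f a v \<sqinter> (\<Sqinter>y. sMapsTo f a y \<leadsto> eql y v))"
proof -
  have "w |= (\<Sqinter>a. mem a A \<leadsto> (\<Squnion>v. sMapsTo f a v \<sqinter> (\<Sqinter>y. sMapsTo f a y \<leadsto> eql y v)))"
    using assms(1) by (simp add: sFun_def)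
  from forces_ImpE[OF forces_AllE[OF this] assms(2)] show ?thesis .
qed

text \<open>The pair behind \<open>v\<close> is also a pair with second component \<open>v'\<close>
  in \<open>B\<close> and first component equal to \<open>a\<close>. Single-valuedness then
  identifies \<open>v\<close> and \<open>v'\<close>.\<close>

lemma sFun_range:
  assumes z: "over CZF w" and f: "w |= sFun f A B" and a: "w |= mem a A" and v: "w |= sMapsTo f a v"
  shows "w |= mem v B"
  using v unfolding sMapsTo_def
proof (rule forces_ExE)
  fix w1 p assume w1: "w \<preceq> w1" and p: "w1 |= mem p f \<sqinter> sPair p a v"
  have "w1 |= (\<Sqinter>p. mem p f \<leadsto> (\<Squnion>a. mem a A \<sqinter> (\<Squnion>v. mem v B \<sqinter> sPair p a v)))"
    using forces_up[OF f w1] by (simp add: sFun_def)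
  from forces_ImpE[OF forces_AllE[OF this, of p]] p
  have "w1 |= (\<Squnion>a. mem a A \<sqinter> (\<Squnion>v. mem v B \<sqinter> sPair p a v))" by simp
  then show "w1 |= mem v B"
  proof (rule forces_ExE)
    fix w2 a' assume w2: "w1 \<preceq> w2" and "w2 |= mem a' A \<sqinter> (\<Squnion>v. mem v B \<sqinter> sPair p a' v)"
    then have "w2 |= (\<Squnion>v. mem v B \<sqinter> sPair p a' v)" by simp
    then show "w2 |= mem v B"
    proof (rule forces_ExE)
      fix w3 v' assume w3: "w2 \<preceq> w3" and v': "w3 |= mem v' B \<sqinter> sPair p a' v'"
      have v13: "w1 \<preceq> w3" using w2 w3 by (rule ext_trans)
      have v03: "w \<preceq> w3" using w1 v13 by (rule ext_trans)
      have p3: "w3 |= mem p f" "w3 |= sPair p a v" using forces_up[OF p v13] by simp_all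
      have "w3 |= eql a' a" using sPair_first_eq[OF over_up[OF z v03] p3(2), of a' v'] v' by simp
      moreover have "w3 |= sMapsTo f a' v'"
        unfolding sMapsTo_def using p3 v' by (intro forces_ExI[where t = p]) simp
      ultimately have av': "w3 |= sMapsTo f a v'" by (rule eql_mapsTo)
      from sFun_total[OF forces_up[OF f v03] forces_up[OF a v03]] show "w3 |= mem v B"
      proof (rule forces_ExE)
        fix w4 v0 assume w4: "w3 \<preceq> w4"
          and "w4 |= sMapsTo f a v0 \<sqinter> (\<Sqinter>y. sMapsTo f a y \<leadsto> eql y v0)"
        then have *: "w4 |= (\<Sqinter>y. sMapsTo f a y \<leadsto> eql y v0)" by simp
        have "w4 |= eql v v0"
          by (rule forces_ImpE[OF forces_AllE[OF *] forces_up[OF v ext_trans[OF v03 w4]]])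
        moreover have "w4 |= eql v' v0"
          by (rule forces_ImpE[OF forces_AllE[OF *] forces_up[OF av' w4]])
        moreover have "w4 |= mem v' B" using forces_up[OF v' w4] by simp
        ultimately show "w4 |= mem v B" by (blast intro: eql_sym eql_mem_left)
      qed
    qed
  qed
qed

lemma sOmegaD: "w |= sOmega z \<Longrightarrow> w |= sInductive z"
  by (simp add: sOmega_def)

lemma sOmega_least:
  assumes "w |= sOmega z" and "w |= sInductive b"
  shows "w |= sSub z b"
proof -
  have "w |= (\<Sqinter>b. sInductive b \<leadsto> sSub z b)" using assms(1) by (simp add: sOmega_def)
  from forces_ImpE[OF forces_AllE[OF this] assms(2)] show ?thesis .
qed

definition sFiniteAt :: "nat \<Rightarrow> nat \<Rightarrow> sprop" where
  "sFiniteAt n u = (\<Squnion>g. sOnto g n u)"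

text \<open>Finiteness refers to some set satisfying \<open>sOmega\<close>. Minimality puts its
  numbers into any given one, as uniformity needs one index set for all \<open>x\<close>.\<close>

lemma sFinite_omega:
  assumes u: "w |= sFinite u" and z: "w |= sOmega z"
  shows "w |= (\<Squnion>n. mem n z \<sqinter> sFiniteAt n u)"
  using u unfolding sFinite_def
proof (rule forces_ExE)
  fix w1 z' assume w1: "w \<preceq> w1" and *: "w1 |= sOmega z' \<sqinter> (\<Squnion>n. mem n z' \<sqinter> (\<Squnion>g. sOnto g n u))"
  then have sub: "w1 |= sSub z' z"
    by (intro sOmega_least) (use forces_up[OF z w1] in \<open>simp_all add: sOmega_def\<close>)
  from * have "w1 |= (\<Squnion>n. mem n z' \<sqinter> sFiniteAt n u)" by (simp add: sFiniteAt_def)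
  then show "w1 |= (\<Squnion>n. mem n z \<sqinter> sFiniteAt n u)"
  proof (rule forces_ExE)
    fix w2 n assume w2: "w1 \<preceq> w2" and n: "w2 |= mem n z' \<sqinter> sFiniteAt n u"
    then have "w2 |= mem n z" using sSubD[OF forces_up[OF sub w2]] by simp
    with n show "w2 |= (\<Squnion>n. mem n z \<sqinter> sFiniteAt n u)" by (intro forces_ExI[where t = n]) simp
  qed
qed

text \<open>Subset collection describes \<open>d\<close> only by totality in both directions. As
  \<open>g\<close> is single-valued and onto \<open>u\<close>, extensionality identifies
  \<open>d\<close> with \<open>u\<close>.\<close>

lemma sOnto_image_eq:
  assumes z: "over CZF w" and g: "w |= sOnto g n u"
    and d1: "w |= (\<Sqinter>x. mem x n \<leadsto> (\<Squnion>y. mem y d \<sqinter> sMapsTo g x y))"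
    and d2: "w |= (\<Sqinter>y. mem y d \<leadsto> (\<Squnion>x. mem x n \<sqinter> sMapsTo g x y))"
  shows "w |= eql d u"
proof (rule CZF_extensionality[OF z])
  fix w1 y assume w1: "w \<preceq> w1"
  have f: "w1 |= sFun g n u" and onto: "w1 |= (\<Sqinter>y. mem y u \<leadsto> (\<Squnion>i. mem i n \<sqinter> sMapsTo g i y))"
    using forces_up[OF g w1] by (simp_all add: sOnto_def)
  note z1 = over_up[OF z w1]
  show "w1 |= mem y d \<longleftrightarrow> w1 |= mem y u"
  proof
    assume "w1 |= mem y d"
    from forces_ImpE[OF forces_AllE[OF forces_up[OF d2 w1]] this] show "w1 |= mem y u"
    proof (rule forces_ExE)
      fix w2 x assume w2: "w1 \<preceq> w2" and x: "w2 |= mem x n \<sqinter> sMapsTo g x y"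
      then show "w2 |= mem y u"
        by (intro sFun_range[OF over_up[OF z1 w2] forces_up[OF f w2], of x]) simp_all
    qed
  next
    assume "w1 |= mem y u"
    from forces_ImpE[OF forces_AllE[OF onto] this] show "w1 |= mem y d"
    proof (rule forces_ExE)
      fix w2 i assume w2: "w1 \<preceq> w2" and i: "w2 |= mem i n \<sqinter> sMapsTo g i y"
      then have i1: "w2 |= mem i n" and i2: "w2 |= sMapsTo g i y" by simp_all
      from forces_ImpE[OF forces_AllE[OF forces_up[OF d1 ext_trans[OF w1 w2]]] i1] show "w2 |= mem y d"
      proof (rule forces_ExE)
        fix w3 y' assume w3: "w2 \<preceq> w3" and y': "w3 |= mem y' d \<sqinter> sMapsTo g i y'"
        note f3 = forces_up[OF forces_up[OF f w2] w3]
        from sFun_total[OF f3 forces_up[OF i1 w3]] show "w3 |= mem y d"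
        proof (rule forces_ExE)
          fix w4 v assume w4: "w3 \<preceq> w4" and "w4 |= sMapsTo g i v \<sqinter> (\<Sqinter>y. sMapsTo g i y \<leadsto> eql y v)"
          then have *: "w4 |= (\<Sqinter>y. sMapsTo g i y \<leadsto> eql y v)" by simp
          have "w4 |= eql y v"
            by (rule forces_ImpE[OF forces_AllE[OF *] forces_up[OF i2 ext_trans[OF w3 w4]]])
          moreover have "w4 |= eql y' v" using forces_up[OF y' w4]
            by (intro forces_ImpE[OF forces_AllE[OF *]]) simp
          moreover have "w4 |= mem y' d" using forces_up[OF y' w4] by simp
          ultimately show "w4 |= mem y d" by (blast intro: eql_sym eql_mem_left)
        qed
      qed
    qed
  qed
qed

section \<open>Uniformity for the finite cover and for the disjunction\<close>

abbreviation fDecided :: "var \<Rightarrow> (var \<Rightarrow> cls) \<Rightarrow> var \<Rightarrow> var \<Rightarrow> form" where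
  "fDecided S C x u \<equiv> cz_covers S C (elem_of S) (elem_of u) \<^bold>\<and>
     fBall u (\<lambda>y. y \<^bold>\<in> S \<^bold>\<and> ((is_empty x \<^bold>\<longrightarrow> cz_cov S C y cz_empty) \<^bold>\<or>
       (S \<^bold>\<subseteq> x \<^bold>\<longrightarrow> cz_cov S C y cz_empty)))"

lemma sem_decided:
  assumes "fv c \<subseteq> {0, 1}"
  shows "sDecided S (cover_of c) x u =
    sem (case_nat x (case_nat u (\<lambda>_. S))) (fDecided (\<lambda>e. e + 2) (def_class c) (\<lambda>e. e) (\<lambda>e. e + 1) 0)"
  unfolding sDecided_def by (simp add: formula_defs shallow_defs sem_def_class[OF assms])

lemma sem_finite_decided:
  assumes "fv c \<subseteq> {0, 1}"
  shows "(\<Squnion>u. sFiniteAt n u \<sqinter> sDecided S (cover_of c) x u) =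
    sem (case_nat x (case_nat n (\<lambda>_. S)))
      ((\<^bold>\<exists>u. (\<^bold>\<exists>g. is_fun g (\<lambda>e. e + 1) (elem_of u) \<^bold>\<and>
          fBall u (\<lambda>y. fBex (\<lambda>e. e + 1) (\<lambda>i. maps_to g i y))) \<^bold>\<and>
        fDecided (\<lambda>e. e + 2) (def_class c) (\<lambda>e. e) u) 0)"
  unfolding sDecided_def sFiniteAt_def by (simp add: formula_defs shallow_defs sem_def_class[OF assms])

lemma sDecidedD:
  assumes "w |= sDecided S C x u" and "w |= mem y u"
  shows "w |= mem y S \<sqinter>
    ((sEmpty x \<leadsto> sCov S C y none) \<squnion> (sSub S x \<leadsto> sCov S C y none))"
proof -
  have "w |= (\<Sqinter>y. mem y u \<leadsto> mem y S \<sqinter>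
    ((sEmpty x \<leadsto> sCov S C y none) \<squnion> (sSub S x \<leadsto> sCov S C y none)))"
    using assms(1) by (simp add: sDecided_def)
  from forces_ImpE[OF forces_AllE[OF this] assms(2)] show ?thesis .
qed

text \<open>Uniformity needs a set of candidates for \<open>u\<close>. It is applied first to the
  number \<open>n\<close> in \<omega> and, once \<open>n\<close> is fixed, to the images of
  functions from \<open>n\<close> to \<open>S\<close>, which lie in a set by subset
  collection.\<close>

lemma uniform_decided_cover:
  assumes z: "over CZF w" and gup: "over GUP_CZF w" and c: "fv c \<subseteq> {0, 1}"
    and ex: "\<And>x. w |= (\<Squnion>u. sFinite u \<sqinter> sDecided S (cover_of c) x u)"
  shows "w |= (\<Squnion>u. \<Sqinter>x. sDecided S (cover_of c) x u)"
  using CZF_infinity[OF z]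
proof (rule forces_ExE)
  let ?D = "sDecided S (cover_of c)"
  fix w1 z0 assume w1: "w \<preceq> w1" and z0: "w1 |= sOmega z0"
  have "w1 |= (\<Sqinter>x. \<Squnion>n. mem n z0 \<sqinter> (\<Squnion>u. sFiniteAt n u \<sqinter> ?D x u))"
  proof (rule forces_AllI)
    fix x
    from forces_up[OF ex w1, of x] show "w1 |= (\<Squnion>n. mem n z0 \<sqinter> (\<Squnion>u. sFiniteAt n u \<sqinter> ?D x u))"
    proof (rule forces_ExE)
      fix w2 u assume w2: "w1 \<preceq> w2" and u: "w2 |= sFinite u \<sqinter> ?D x u"
      then have "w2 |= sFinite u" by simp
      from sFinite_omega[OF this forces_up[OF z0 w2]]
      show "w2 |= (\<Squnion>n. mem n z0 \<sqinter> (\<Squnion>u. sFiniteAt n u \<sqinter> ?D x u))"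
      proof (rule forces_ExE)
        fix w3 n assume w3: "w2 \<preceq> w3" and n: "w3 |= mem n z0 \<sqinter> sFiniteAt n u"
        with forces_up[OF u w3] show "w3 |= (\<Squnion>n. mem n z0 \<sqinter> (\<Squnion>u. sFiniteAt n u \<sqinter> ?D x u))"
          by (intro forces_ExI[where t = n]) (simp, intro forces_ExI[where t = u], simp)
      qed
    qed
  qed
  from GUP_CZF_instance[OF over_up[OF gup w1] this sem_finite_decided[OF c]]
  have "w1 |= (\<Squnion>n. mem n z0 \<sqinter> (\<Sqinter>x. \<Squnion>u. sFiniteAt n u \<sqinter> ?D x u))" .
  then show "w1 |= (\<Squnion>u. \<Sqinter>x. ?D x u)"
  proof (rule forces_ExE)
    fix w2 n assume w2: "w1 \<preceq> w2" and "w2 |= mem n z0 \<sqinter> (\<Sqinter>x. \<Squnion>u. sFiniteAt n u \<sqinter> ?D x u)"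
    then have n: "w2 |= (\<Sqinter>x. \<Squnion>u. sFiniteAt n u \<sqinter> ?D x u)" by simp
    have ww2: "w \<preceq> w2" using w1 w2 by (rule ext_trans)
    from CZF_subset_collection[OF over_up[OF z ww2], of n S] show "w2 |= (\<Squnion>u. \<Sqinter>x. ?D x u)"
    proof (rule forces_ExE)
      fix w3 C assume w3: "w2 \<preceq> w3"
        and C: "w3 |= (\<Sqinter>u. (\<Sqinter>x. mem x n \<leadsto> (\<Squnion>y. mem y S \<sqinter> sMapsTo u x y)) \<leadsto>
          (\<Squnion>d. mem d C \<sqinter> (\<Sqinter>x. mem x n \<leadsto> (\<Squnion>y. mem y d \<sqinter> sMapsTo u x y)) \<sqinter>
            (\<Sqinter>y. mem y d \<leadsto> (\<Squnion>x. mem x n \<sqinter> sMapsTo u x y))))"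
      have ww3: "w \<preceq> w3" using ww2 w3 by (rule ext_trans)
      have "w3 |= (\<Sqinter>x. \<Squnion>u. mem u C \<sqinter> ?D x u)"
      proof (rule forces_AllI)
        fix x
        from forces_AllE[OF forces_up[OF n w3]] show "w3 |= (\<Squnion>u. mem u C \<sqinter> ?D x u)"
        proof (rule forces_ExE)
          fix w4 u assume w4: "w3 \<preceq> w4" and u: "w4 |= sFiniteAt n u \<sqinter> ?D x u"
          then have "w4 |= (\<Squnion>g. sOnto g n u)" by (simp add: sFiniteAt_def)
          then show "w4 |= (\<Squnion>u. mem u C \<sqinter> ?D x u)"
          proof (rule forces_ExE)
            fix w5 g assume w5: "w4 \<preceq> w5" and g: "w5 |= sOnto g n u"
            have ww5: "w \<preceq> w5" and w35: "w3 \<preceq> w5" using ww3 w4 w5 ext_trans by blast+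
            have f: "w5 |= sFun g n u" using g by (simp add: sOnto_def)
            have D5: "w5 |= ?D x u" using forces_up[OF u w5] by simp
            have "w5 |= (\<Sqinter>x. mem x n \<leadsto> (\<Squnion>y. mem y S \<sqinter> sMapsTo g x y))"
            proof (intro forces_AllI forces_ImpI)
              fix i w6 assume w6: "w5 \<preceq> w6" and i: "w6 |= mem i n"
              from sFun_total[OF forces_up[OF f w6] i] show "w6 |= (\<Squnion>y. mem y S \<sqinter> sMapsTo g i y)"
              proof (rule forces_ExE)
                fix w7 y assume w7: "w6 \<preceq> w7"
                  and y: "w7 |= sMapsTo g i y \<sqinter> (\<Sqinter>v. sMapsTo g i v \<leadsto> eql v y)"
                have w57: "w5 \<preceq> w7" using w6 w7 by (rule ext_trans)
                have "w7 |= mem y u"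
                  using sFun_range[OF over_up[OF z ext_trans[OF ww5 w57]] forces_up[OF f w57] forces_up[OF i w7], of y] y
                  by simp
                \<comment> \<open>That \<open>u\<close> is a subset of \<open>S\<close> is part of
                  \<open>sDecided\<close>; it turns \<open>g\<close> into a total relation from
                  \<open>n\<close> to \<open>S\<close>.\<close>
                then have "w7 |= mem y S" using sDecidedD[OF forces_up[OF D5 w57]] by simp
                with y show "w7 |= (\<Squnion>y. mem y S \<sqinter> sMapsTo g i y)"
                  by (intro forces_ExI[where t = y]) simp
              qed
            qed
            from forces_ImpE[OF forces_AllE[OF forces_up[OF C w35]] this]
            show "w5 |= (\<Squnion>u. mem u C \<sqinter> ?D x u)"
            proof (rule forces_ExE)
              fix w6 d assume w6: "w5 \<preceq> w6"
                and d: "w6 |= mem d C \<sqinter> (\<Sqinter>x. mem x n \<leadsto> (\<Squnion>y. mem y d \<sqinter> sMapsTo g x y)) \<sqinter>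
                  (\<Sqinter>y. mem y d \<leadsto> (\<Squnion>x. mem x n \<sqinter> sMapsTo g x y))"
              then have "w6 |= eql d u"
                by (intro sOnto_image_eq[OF over_up[OF z ext_trans[OF ww5 w6]] forces_up[OF g w6]]) simp_all
              then have "w6 |= mem u C" using d eql_mem_left by simp
              with forces_up[OF D5 w6] show "w6 |= (\<Squnion>u. mem u C \<sqinter> ?D x u)"
                by (intro forces_ExI[where t = u]) simp
            qed
          qed
        qed
      qed
      from GUP_CZF_instance[OF over_up[OF gup ww3] this sem_decided[OF c]]
      have "w3 |= (\<Squnion>u. mem u C \<sqinter> (\<Sqinter>x. ?D x u))" .
      then show "w3 |= (\<Squnion>u. \<Sqinter>x. ?D x u)"
      proof (rule forces_ExE)
        fix w4 u assume "w4 |= mem u C \<sqinter> (\<Sqinter>x. ?D x u)"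
        then show "w4 |= (\<Squnion>u. \<Sqinter>x. ?D x u)" by (intro forces_ExI[where t = u]) simp
      qed
    qed
  qed
qed

text \<open>The environment lists \<open>x\<close>, the tag \<open>z\<close>, \<open>S\<close> and
  then \<open>y\<close>. Emptiness of the tag, or its negation, is written into the disjuncts, so
  that the tag determines the disjunct.\<close>

lemma sem_choice:
  assumes "fv c \<subseteq> {0, 1}"
  shows "((sEmpty z \<sqinter> (sEmpty x \<leadsto> sCov S (cover_of c) y none)) \<squnion>
      ((sEmpty z \<leadsto> sBot) \<sqinter> (sSub S x \<leadsto> sCov S (cover_of c) y none))) =
    sem (case_nat x (case_nat z (case_nat S (\<lambda>_. y))))
      (((is_empty (\<lambda>e. e + 1) \<^bold>\<and> (is_empty (\<lambda>e. e) \<^bold>\<longrightarrow> cz_cov (\<lambda>e. e + 2) (def_class c) (\<lambda>e. e + 3) cz_empty)) \<^bold>\<or>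
        (\<^bold>\<not> is_empty (\<lambda>e. e + 1) \<^bold>\<and> ((\<lambda>e. e + 2) \<^bold>\<subseteq> (\<lambda>e. e) \<^bold>\<longrightarrow> cz_cov (\<lambda>e. e + 2) (def_class c) (\<lambda>e. e + 3) cz_empty))) 0)"
  by (simp add: formula_defs shallow_defs sem_def_class[OF assms] numeral_3_eq_3)

lemma sInductive_empty: "w |= sInductive z \<Longrightarrow> w |= (\<Squnion>e. mem e z \<sqinter> sEmpty e)"
  by (simp add: sInductive_def)

lemma CZF_empty:
  assumes "over CZF w"
  shows "w |= (\<Squnion>e. sEmpty e)"
  using CZF_infinity[OF assms]
proof (rule forces_ExE)
  fix w' z assume "w' |= sOmega z"
  from sInductive_empty[OF sOmegaD[OF this]] show "w' |= (\<Squnion>e. sEmpty e)"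
  proof (rule forces_ExE)
    fix w'' e assume "w'' |= mem e z \<sqinter> sEmpty e"
    then show "w'' |= (\<Squnion>e. sEmpty e)" by (intro forces_ExI[where t = e]) simp
  qed
qed

text \<open>Applying the uniformity scheme to the tag set \<open>\<omega>\<close>, where the empty set marks the first
  disjunct and any nonempty set the second, makes the choice of disjunct independent of \<open>x\<close>.\<close>

lemma uniform_decision:
  assumes z: "over CZF w" and gup: "over GUP_CZF w" and c: "fv c \<subseteq> {0, 1}"
    and dec: "\<And>x. w |= (sEmpty x \<leadsto> sCov S (cover_of c) y none) \<squnion>
      (sSub S x \<leadsto> sCov S (cover_of c) y none)"
  shows "w |= sCov S (cover_of c) y none"
  using CZF_infinity[OF z]
proof (rule forces_ExE)
  let ?E = "sCov S (cover_of c) y none"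
  let ?R = "\<lambda>x t. (sEmpty t \<sqinter> (sEmpty x \<leadsto> ?E)) \<squnion> ((sEmpty t \<leadsto> sBot) \<sqinter> (sSub S x \<leadsto> ?E))"
  fix w1 z0 assume w1: "w \<preceq> w1" and z0: "w1 |= sOmega z0"
  from sInductive_empty[OF sOmegaD[OF z0]] show "w1 |= ?E"
  proof (rule forces_ExE)
    fix w2 o' assume w2: "w1 \<preceq> w2" and o': "w2 |= mem o' z0 \<sqinter> sEmpty o'"
    have "w2 |= sInductive z0" using forces_up[OF z0 w2] by (rule sOmegaD)
    then have "w2 |= (\<Sqinter>y. mem y z0 \<leadsto> (\<Squnion>z. mem z z0 \<sqinter> sSucc z y))" by (simp add: sInductive_def)
    from forces_ImpE[OF forces_AllE[OF this, of o']] o'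
    have "w2 |= (\<Squnion>s. mem s z0 \<sqinter> sSucc s o')" by simp
    then show "w2 |= ?E"
    proof (rule forces_ExE)
      fix w3 s assume w3: "w2 \<preceq> w3" and s: "w3 |= mem s z0 \<sqinter> sSucc s o'"
      have ww3: "w \<preceq> w3" using w1 w2 w3 ext_trans by blast
      have o3: "w3 |= mem o' z0" "w3 |= sEmpty o'" using forces_up[OF o' w3] by simp_all
      \<comment> \<open>The successor of the empty set contains it, so \<open>s\<close> is a
        nonempty tag in \<omega>.\<close>
      have "w3 |= sIff (mem o' s) (mem o' o' \<squnion> eql o' o')"
        using s by (simp add: sSucc_def forces_All)
      from forces_IffD[OF this] have os: "w3 |= mem o' s" by (simp add: forces_OrI2)
      have "w3 |= (\<Sqinter>x. \<Squnion>t. mem t z0 \<sqinter> ?R x t)"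
      proof (rule forces_AllI)
        fix x
        from forces_up[OF dec ww3, of x] show "w3 |= (\<Squnion>t. mem t z0 \<sqinter> ?R x t)"
        proof (rule forces_OrE)
          fix w4 assume w4: "w3 \<preceq> w4" and "w4 |= sEmpty x \<leadsto> ?E"
          then show "w4 |= (\<Squnion>t. mem t z0 \<sqinter> ?R x t)"
            using forces_up[OF o3(1) w4] forces_up[OF o3(2) w4]
            by (intro forces_ExI[where t = o']) (simp add: forces_OrI1)
        next
          fix w4 assume w4: "w3 \<preceq> w4" and *: "w4 |= sSub S x \<leadsto> ?E"
          have "w4 |= sEmpty s \<leadsto> sBot"
            by (rule forces_ImpI) (rule sEmptyD, assumption, rule forces_up[OF os ext_trans[OF w4]])
          then show "w4 |= (\<Squnion>t. mem t z0 \<sqinter> ?R x t)"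
            using forces_up[OF s w4] * by (intro forces_ExI[where t = s]) (simp add: forces_OrI2)
        qed
      qed
      from GUP_CZF_instance[OF over_up[OF gup ww3] this sem_choice[OF c]]
      have "w3 |= (\<Squnion>t. mem t z0 \<sqinter> (\<Sqinter>x. ?R x t))" .
      then show "w3 |= ?E"
      proof (rule forces_ExE)
        fix w4 t assume w4: "w3 \<preceq> w4" and "w4 |= mem t z0 \<sqinter> (\<Sqinter>x. ?R x t)"
        then have R: "w4 |= ?R x t" for x by (simp add: forces_All)
        have refl: "v |= sSub S S" for v by (rule sSubI)
        \<comment> \<open>The instance at \<open>S\<close> plays the true proposition. If it falls
          into the first disjunct, then \<open>t\<close> is empty, and the instance at the empty
          set, which plays the false one, cannot fall into the second.\<close>
        from R[of S] show "w4 |= ?E"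
        proof (rule forces_OrE)
          fix w5 assume w5: "w4 \<preceq> w5" and t: "w5 |= sEmpty t \<sqinter> (sEmpty S \<leadsto> ?E)"
          from forces_up[OF R[of o'] w5] show "w5 |= ?E"
          proof (rule forces_OrE)
            fix w6 assume w6: "w5 \<preceq> w6" and t': "w6 |= sEmpty t \<sqinter> (sEmpty o' \<leadsto> ?E)"
            from t' have "w6 |= sEmpty o' \<leadsto> ?E" by simp
            moreover have "w6 |= sEmpty o'"
              by (rule forces_up[OF o3(2)]) (use w4 w5 w6 ext_trans in blast)
            ultimately show "w6 |= ?E" by (rule forces_ImpE)
          next
            fix w6 assume w6: "w5 \<preceq> w6" and t': "w6 |= (sEmpty t \<leadsto> sBot) \<sqinter> (sSub S o' \<leadsto> ?E)"
            then have "w6 |= sEmpty t \<leadsto> sBot" by simp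
            moreover have "w6 |= sEmpty t" using forces_up[OF t w6] by simp
            ultimately have "w6 |= sBot" by (rule forces_ImpE)
            then show "w6 |= ?E" by (rule forces_BotE)
          qed
        next
          fix w5 assume "w5 |= (sEmpty t \<leadsto> sBot) \<sqinter> (sSub S S \<leadsto> ?E)"
          then have "w5 |= sSub S S \<leadsto> ?E" by simp
          then show "w5 |= ?E" using refl by (rule forces_ImpE)
        qed
      qed
    qed
  qed
qed

lemma compact_de_morgan_trivial:
  assumes z: "over CZF w" and gup: "over GUP_CZF w" and c: "fv c \<subseteq> {0, 1}"
    and r: "w |= sReflexive S (cover_of c)" and tr: "w |= sTransitive S (cover_of c)"
    and dm: "w |= sDeMorgan S (cover_of c)" and cp: "w |= sCompact S (cover_of c)"
  shows "w |= sTrivial S (cover_of c)"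
  unfolding sTrivial_def
proof (rule sCoversI)
  let ?D = "sDecided S (cover_of c)" and ?E = "\<lambda>y. sCov S (cover_of c) y none"
  fix w1 a assume w1: "w \<preceq> w1" and a: "w1 |= mem a S"
  have z1: "over CZF w1" and gup1: "over GUP_CZF w1" using over_up z gup w1 by blast+
  have "w1 |= (\<Squnion>u. sFinite u \<sqinter> ?D x u)" for x
    by (rule finite_decided_cover[OF z1 forces_up[OF r w1] forces_up[OF dm w1] forces_up[OF cp w1] a])
  from uniform_decided_cover[OF z1 gup1 c this] show "w1 |= ?E a"
  proof (rule forces_ExE)
    fix w2 u assume w2: "w1 \<preceq> w2" and u: "w2 |= (\<Sqinter>x. ?D x u)"
    \<comment> \<open>Transitivity is stated for sets, so the class \<open>none\<close> is replaced
      by an actual empty set until the end.\<close>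
    from CZF_empty[OF over_up[OF z1 w2]] show "w2 |= ?E a"
    proof (rule forces_ExE)
      fix w3 o' assume w23: "w2 \<preceq> w3" and o': "w3 |= sEmpty o'"
      have w13: "w1 \<preceq> w3" and ww3: "w \<preceq> w3" using w1 w2 w23 ext_trans by blast+
      have D: "v |= ?D x u" if "w3 \<preceq> v" for v x
        by (rule forces_AllE[OF forces_up[OF u ext_trans[OF w23 that]]])
      have "w3 |= sCov S (cover_of c) a (els o')"
      proof (rule sTransitiveD[OF forces_up[OF tr ww3]])
        show "w3 |= sSub u S" by (rule sSubI) (use sDecidedD[OF D] in simp)
        show "w3 |= sSub o' S" by (rule sSubI) (use sEmptyD forces_up[OF o'] in blast)
        show a3: "w3 |= mem a S" by (rule forces_up[OF a w13])
        have "w3 |= sCovers S (cover_of c) (els S) (els u)"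
          using D[OF ext_refl] by (simp add: sDecided_def)
        then show "w3 |= sCov S (cover_of c) a (els u)" using a3 a3 by (rule sCoversD)
        show "w3 |= sCovers S (cover_of c) (els u) (els o')"
        proof (rule sCoversI)
          fix v y assume v: "w3 \<preceq> v" and y: "v |= mem y u"
          have "v |= ?E y"
            by (rule uniform_decision[OF over_up[OF z] over_up[OF gup] c])
              (use ext_trans[OF ww3 v] sDecidedD[OF D[OF v] y] in simp_all)
          then show "v |= sCov S (cover_of c) y (els o')"
            by (rule sCov_cong) (use forces_up[OF o' ext_trans[OF v]] sEmptyD forces_BotE in blast)
        qed
      qed
      then show "w3 |= ?E a"
        by (rule sCov_cong) (use forces_up[OF o'] sEmptyD forces_BotE in blast)
    qed
  qed
qed

text \<open>Everything in the trivial space \<open>G\<close> is covered by the image of the empty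
  set, in particular the image of \<open>a\<close>; surjectivity reflects this to
  \<open>a\<close>.\<close>

lemma surjective_trivial:
  assumes z: "over CZF w" and f: "w |= sSurjective G D S C f" and G: "w |= sTrivial G D"
  shows "w |= sTrivial S C"
  unfolding sTrivial_def
proof (rule sCoversI)
  fix w1 a assume w1: "w \<preceq> w1" and a: "w1 |= mem a S"
  from CZF_empty[OF over_up[OF z w1]] show "w1 |= sCov S C a none"
  proof (rule forces_ExE)
    fix w3 o' assume w13: "w1 \<preceq> w3" and o': "w3 |= sEmpty o'"
    have ww3: "w \<preceq> w3" using w1 w13 by (rule ext_trans)
    have emp: "v |= mem x o' \<longleftrightarrow> v |= sBot" if "w3 \<preceq> v" for v x
      using forces_up[OF o' that] sEmptyD forces_BotE by blast
    have "w3 |= sCovers G D (sImage S f (\<lambda>x. eql x a)) (sImage S f (els o'))"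
    proof (rule sCoversI)
      fix v u assume v: "w3 \<preceq> v" and u: "v |= mem u G"
      have "v |= sCov G D u none"
        using forces_up[OF G ext_trans[OF ww3 v]] u u unfolding sTrivial_def by (rule sCoversD)
      then show "v |= sCov G D u (sImage S f (els o'))"
      proof (rule sCov_cong)
        fix v' b assume v': "v \<preceq> v'"
        have "v' |= sBot" if "v' |= sImage S f (els o') b"
          using that unfolding sImage_def
        proof (rule forces_ExE)
          fix v'' c assume v'': "v' \<preceq> v''"
            and "v'' |= mem c S \<sqinter> mem c o' \<sqinter> (\<Squnion>va. sMapsTo f c va \<sqinter> mem b va)"
          then show "v'' |= sBot" using emp[OF ext_trans[OF v ext_trans[OF v' v'']], of c] by simp
        qed
        then show "v' |= sBot \<longleftrightarrow> v' |= sImage S f (els o') b" using forces_BotE by blast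
      qed
    qed
    moreover have "w3 |= sSub o' S" by (rule sSubI) (use emp forces_BotE in blast)
    ultimately have "w3 |= sCov S C a (els o')"
      using forces_ImpE[OF forces_ImpE[OF forces_AllE[OF forces_ImpE[OF forces_AllE[OF
        forces_up[OF f ww3, unfolded sSurjective_def]] forces_up[OF a w13]]]]] by blast
    then show "w3 |= sCov S C a none" by (rule sCov_cong) (simp add: emp)
  qed
qed

section \<open>Passage from the formal statement to truth values\<close>

lemma sem_space:
  assumes "fv c \<subseteq> {0, 1}" and "w |= sem v (cz_space (\<lambda>e. e - Suc (Suc 0)) (def_class c) (Suc (Suc (Suc 0))))"
  shows "w |= sReflexive (v 1) (cover_of c)" and "w |= sTransitive (v 1) (cover_of c)"
  using assms(2) unfolding cz_space_def sReflexive_def sTransitive_def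
  by (simp_all add: formula_defs shallow_defs sem_def_class[OF assms(1)])

lemma sem_surjective:
  assumes "fv c \<subseteq> {0, 1}" and "fv d \<subseteq> {0, 1}"
  shows "sem v (cz_surjective (\<lambda>e. e - Suc (Suc 0)) (def_class d) (\<lambda>e. e - Suc 0) (def_class c)
      (\<lambda>e. e - Suc (Suc (Suc 0))) (Suc (Suc (Suc 0)))) = sSurjective (v 1) (cover_of d) (v 2) (cover_of c) (v 0)"
  unfolding cz_surjective_def sSurjective_def
  by (simp add: formula_defs shallow_defs sem_def_class[OF assms(1)] sem_def_class[OF assms(2)] numeral_2_eq_2)

lemma sem_nontrivial:
  assumes "fv c \<subseteq> {0, 1}"
  shows "sem v (cz_nontrivial (\<lambda>e. e - Suc 0) (def_class c) (Suc 0)) = (sTrivial (v 0) (cover_of c) \<leadsto> sBot)"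
  unfolding cz_nontrivial_def sTrivial_def
  by (simp add: formula_defs shallow_defs sem_def_class[OF assms(1)])

lemma eql_trivial:
  assumes "fv c \<subseteq> {0, 1}" and "w |= eql S S'" and "w |= sTrivial S (cover_of c)"
  shows "w |= sTrivial S' (cover_of c)"
  using assms(2,3)
  by (rule eql_subst[where P = "\<lambda>S. sTrivial S (cover_of c)" and v = "\<lambda>n. n"
        and p = "cz_covers (\<lambda>e. e) (def_class c) (elem_of (\<lambda>e. e)) cz_empty 0"])
    (simp add: sTrivial_def formula_defs shallow_defs sem_def_class[OF assms(1)])

lemma sem_def_set:
  assumes "fv s \<subseteq> {0}"
  shows "sem v (def_set s (\<lambda>e. e - Suc 0) (Suc 0)) = (\<Sqinter>y. sIff (sem (\<lambda>_. y) s) (eql y (v 0)))"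
proof -
  have "sem (case_nat y u) s = sem (\<lambda>_. y) s" for y u
    by (rule sem_cong) (use assms in auto)
  then show ?thesis unfolding def_set_def by (simp add: formula_defs shallow_defs sem_inst1)
qed

lemma proves_forces:
  assumes "proves T P" and "T \<subseteq> world_theory w"
  shows "w |= sem (\<lambda>n. n) (P 0)"
  using assms prv_weaken[of T "[]" "P 0" "world_theory w" "world_hyps w"]
  by (simp add: forces_sem pr_def rename_id proves_def)

lemma forces_fEx:
  assumes "w |= sem v (fEx F e)"
    and "\<And>w' t. w \<preceq> w' \<Longrightarrow> w' |= sem (case_nat t v) (F (\<lambda>i. i - Suc e) (Suc e)) \<Longrightarrow> w' |= C"
  shows "w |= C"
  using assms(1) unfolding fEx_def sem_Exists by (rule forces_ExE) (rule assms(2))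

lemma forces_fConj: "w |= sem v ((P \<^bold>\<and> Q) e) \<longleftrightarrow> w |= sem v (P e) \<and> w |= sem v (Q e)"
  by (simp add: fConj_def)

theorem CZF_no_gleason_cover:
  assumes T: "CZF \<subseteq> T" "consistent_fm (T \<union> GUP_CZF)"
    and S: "cz_ntcr_space_in T s c"
  shows "\<not> cz_gleason_cover_in T g d s c p"
proof
  assume G: "cz_gleason_cover_in T g d s c p"
  \<comment> \<open>The root world has no hypotheses, and its theory is \<open>T\<close> with the
    scheme added. Falsity forced here is a proof of falsity from that theory.\<close>
  define w where "w = World (T \<union> GUP_CZF) []"
  have w: "T \<subseteq> world_theory w" by (simp add: w_def)
  have z: "over CZF w" and gup: "over GUP_CZF w" using T(1) by (auto simp: over_def w_def)
  have fv: "fv s \<subseteq> {0}" "fv c \<subseteq> {0, 1}" "fv d \<subseteq> {0, 1}"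
    using S G by (auto simp: cz_ntcr_space_in_def cz_gleason_cover_in_def)
  let ?F = "\<lambda>S. def_set s S \<^bold>\<and> cz_space S (def_class c) \<^bold>\<and> cz_nontrivial S (def_class c) \<^bold>\<and>
                    cz_compact S (def_class c) \<^bold>\<and> cz_regular S (def_class c)"
  let ?G = "\<lambda>S. def_set s S \<^bold>\<and> (\<^bold>\<exists>G. def_set g G \<^bold>\<and> (\<^bold>\<exists>f. def_set p f \<^bold>\<and>
                    cz_gleason_cover G (def_class d) S (def_class c) f))"
  have F: "w |= sem (\<lambda>n. n) (fEx ?F 0)" and G: "w |= sem (\<lambda>n. n) (fEx ?G 0)"
    using S G by (auto simp: cz_ntcr_space_in_def cz_gleason_cover_in_def intro!: proves_forces[OF _ w])
  from F have "w |= sBot"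
  proof (rule forces_fEx)
    fix w1 S0 assume w1: "w \<preceq> w1"
      and "w1 |= sem (case_nat S0 (\<lambda>n. n)) (?F (\<lambda>i. i - Suc 0) (Suc 0))"
    then have S0: "w1 |= (\<Sqinter>y. sIff (sem (\<lambda>_. y) s) (eql y S0))"
      and nontriv: "w1 |= sTrivial S0 (cover_of c) \<leadsto> sBot"
      by (simp_all add: forces_fConj sem_def_set[OF fv(1)] sem_nontrivial[OF fv(2)])
    from forces_up[OF G w1] show "w1 |= sBot"
    proof (rule forces_fEx)
      fix w2 S1 assume w2: "w1 \<preceq> w2"
        and "w2 |= sem (case_nat S1 (\<lambda>n. n)) (?G (\<lambda>i. i - Suc 0) (Suc 0))"
      then have S1: "w2 |= (\<Sqinter>y. sIff (sem (\<lambda>_. y) s) (eql y S1))"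
        and G: "w2 |= sem (case_nat S1 (\<lambda>n. n)) ((\<^bold>\<exists>G. def_set g G \<^bold>\<and> (\<^bold>\<exists>f. def_set p f \<^bold>\<and>
                    cz_gleason_cover G (def_class d) (\<lambda>i. i - Suc 0) (def_class c) f)) (Suc 0))"
        by (simp_all add: forces_fConj sem_def_set[OF fv(1)])
      \<comment> \<open>\<open>S0\<close> and \<open>S1\<close> stem from two separate existence
        statements; as \<open>s\<close> defines at most one set, they are equal.\<close>
      have "w2 |= sem (\<lambda>_. S1) s" using forces_IffD[OF forces_AllE[OF S1, of S1]] by simp
      then have eq: "w2 |= eql S1 S0" using forces_IffD[OF forces_AllE[OF forces_up[OF S0 w2], of S1]] by simp
      from G show "w2 |= sBot"
      proof (rule forces_fEx)
        fix w3 G assume w3: "w2 \<preceq> w3"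
          and "w3 |= sem (case_nat G (case_nat S1 (\<lambda>n. n)))
            ((def_set g (\<lambda>i. i - Suc (Suc 0)) \<^bold>\<and> (\<^bold>\<exists>f. def_set p f \<^bold>\<and>
              cz_gleason_cover (\<lambda>i. i - Suc (Suc 0)) (def_class d) (\<lambda>i. i - Suc 0) (def_class c) f)) (Suc (Suc 0)))"
        then have "w3 |= sem (case_nat G (case_nat S1 (\<lambda>n. n)))
            ((\<^bold>\<exists>f. def_set p f \<^bold>\<and>
              cz_gleason_cover (\<lambda>i. i - Suc (Suc 0)) (def_class d) (\<lambda>i. i - Suc 0) (def_class c) f) (Suc (Suc 0)))"
          by (simp add: forces_fConj)
        then show "w3 |= sBot"
        proof (rule forces_fEx)
          let ?v = "\<lambda>f. case_nat f (case_nat G (case_nat S1 (\<lambda>n. n)))"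
          fix w4 f assume w4: "w3 \<preceq> w4"
            and "w4 |= sem (?v f) ((def_set p (\<lambda>i. i - Suc (Suc (Suc 0))) \<^bold>\<and>
              cz_gleason_cover (\<lambda>i. i - Suc (Suc 0)) (def_class d) (\<lambda>i. i - Suc 0) (def_class c)
                (\<lambda>i. i - Suc (Suc (Suc 0)))) (Suc (Suc (Suc 0))))"
          then have 1: "w4 |= sem (?v f) (cz_space (\<lambda>e. e - Suc (Suc 0)) (def_class d) (Suc (Suc (Suc 0))))"
            and cp: "w4 |= sCompact G (cover_of d)" and dm: "w4 |= sDeMorgan G (cover_of d)"
            and su: "w4 |= sSurjective G (cover_of d) S1 (cover_of c) f"
            using sem_compact[OF fv(3), of "?v f"] sem_de_morgan[OF fv(3), of "?v f"]
              sem_surjective[OF fv(2,3), of "?v f"]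
            by (simp_all add: forces_fConj cz_gleason_cover_def)
          have w14: "w1 \<preceq> w4" and ww4: "w \<preceq> w4" and w24: "w2 \<preceq> w4"
            using w1 w2 w3 w4 ext_trans by blast+
          note z4 = over_up[OF z ww4] and gup4 = over_up[OF gup ww4]
          have "w4 |= sTrivial G (cover_of d)"
            by (rule compact_de_morgan_trivial[OF z4 gup4 fv(3) _ _ dm cp])
              (use sem_space[OF fv(3) 1] in simp_all)
          then have "w4 |= sTrivial S1 (cover_of c)" by (rule surjective_trivial[OF z4 su])
          then have "w4 |= sTrivial S0 (cover_of c)"
            by (rule eql_trivial[OF fv(2) forces_up[OF eq w24]])
          with forces_up[OF nontriv w14] show "w4 |= sBot" by (rule forces_ImpE)
        qed
      qed
    qed
  qed
  then have "w |= sem (\<lambda>n. n) Bot" by simp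
  then have "proves (T \<union> GUP_CZF) \<^bold>\<bottom>"
    by (simp add: forces_sem pr_def rename_id proves_def fBot_def w_def del: sem_Bot)
  then show False using T(2) by (simp add: consistent_fm_def)
qed

section \<open>Structural properties of the logical framework\<close>

lemma up_apply_Suc_comp: "up r \<circ> Suc = Suc \<circ> r"
  by auto

lemma ren_ren: "ren_tm r (ren_tm s t) = ren_tm (r \<circ> s) t"
  by (induction t arbitrary: r s) (auto simp: up_comp)

lemma up_sub_comp_up: "up_sub s \<circ> up r = up_sub (s \<circ> r)"
proof
  fix n show "(up_sub s \<circ> up r) n = up_sub (s \<circ> r) n" by (cases n) auto
qed

lemma sub_ren: "sub_tm s (ren_tm r t) = sub_tm (s \<circ> r) t"
  by (induction t arbitrary: r s) (auto simp: up_sub_comp_up)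

lemma ren_up_comp_up_sub: "ren_tm (up r) \<circ> up_sub s = up_sub (ren_tm r \<circ> s)"
proof
  fix n show "(ren_tm (up r) \<circ> up_sub s) n = up_sub (ren_tm r \<circ> s) n"
    by (cases n) (auto simp: ren_ren up_apply_Suc_comp)
qed

lemma ren_sub: "ren_tm r (sub_tm s t) = sub_tm (ren_tm r \<circ> s) t"
  by (induction t arbitrary: r s) (auto simp: ren_up_comp_up_sub)

lemma ren_Suc_sub: "ren_tm Suc (sub_tm s t) = sub_tm (up_sub s) (ren_tm Suc t)"
  unfolding ren_sub sub_ren by (rule arg_cong[of _ _ "\<lambda>s. sub_tm s t"]) auto

lemma up_sub_comp: "sub_tm (up_sub r) \<circ> up_sub s = up_sub (sub_tm r \<circ> s)"
proof
  fix n show "(sub_tm (up_sub r) \<circ> up_sub s) n = up_sub (sub_tm r \<circ> s) n"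
    by (cases n) (auto simp: ren_Suc_sub)
qed

lemma sub_sub: "sub_tm r (sub_tm s t) = sub_tm (sub_tm r \<circ> s) t"
  by (induction t arbitrary: r s) (auto simp: up_sub_comp)

lemma up_sub_Var: "up_sub Var = Var"
proof
  fix n show "up_sub Var n = Var n" by (cases n) auto
qed

lemma sub_Var [simp]: "sub_tm Var t = t"
  by (induction t) (auto simp: up_sub_Var)

lemma up_sub_Var_comp: "up_sub (Var \<circ> r) = Var \<circ> up r"
proof
  fix n show "up_sub (Var \<circ> r) n = (Var \<circ> up r) n" by (cases n) auto
qed

lemma ren_eq_sub: "ren_tm r t = sub_tm (Var \<circ> r) t"
  by (induction t arbitrary: r) (auto simp: up_sub_Var_comp[unfolded comp_def] comp_def)

lemma sub_ty_sub_ty: "sub_ty r (sub_ty s X) = sub_ty (sub_tm r \<circ> s) X"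
  by (induction X arbitrary: r s) (auto simp: sub_sub up_sub_comp)

lemma sub_ty_Var [simp]: "sub_ty Var X = X"
  by (induction X) (auto simp: up_sub_Var)

lemma sub_jdg_Var [simp]: "sub_jdg Var J = J"
  by (cases J) auto

lemma sub_scoped: "scoped k t \<Longrightarrow> (\<And>i. i < k \<Longrightarrow> s i = Var i) \<Longrightarrow> sub_tm s t = t"
proof (induction t arbitrary: k s)
  case (Lam t)
  have "up_sub s i = Var i" if "i < Suc k" for i using that Lam.prems by (cases i) auto
  with Lam.IH[of "Suc k" "up_sub s"] Lam.prems show ?case by simp
qed auto

lemma sub_closed: "scoped 0 t \<Longrightarrow> sub_tm s t = t"
  by (rule sub_scoped) auto

lemma ren_closed: "scoped 0 t \<Longrightarrow> ren_tm r t = t"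
  by (simp add: ren_eq_sub sub_closed)

lemma sub_one_ren_Suc [simp]: "sub_tm (one a) (ren_tm Suc t) = t"
proof -
  have "one a \<circ> Suc = Var" by (auto simp: one_def)
  then show ?thesis by (simp add: sub_ren)
qed

lemma one_0 [simp]: "one a 0 = a" and one_Suc [simp]: "one a (Suc n) = Var n"
  by (simp_all add: one_def)

lemma sub_up_sub_ren_Suc [simp]: "sub_tm (up_sub s) (ren_tm Suc t) = ren_tm Suc (sub_tm s t)"
  by (simp add: ren_Suc_sub)

lemma ren_up_ren_Suc [simp]: "ren_tm (up r) (ren_tm Suc t) = ren_tm Suc (ren_tm r t)"
  unfolding ren_ren up_apply_Suc_comp ..

lemma sub_Var_Suc: "sub_tm (\<lambda>n. Var (Suc n)) t = ren_tm Suc t"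
  by (simp add: ren_eq_sub comp_def)

text \<open>Types carry no renaming function of their own, so weakening is a substitution; the rule
  \<open>subst\<close> delivers it in this shape.\<close>

definition wk :: "'c ty \<Rightarrow> 'c ty" where
  "wk = sub_ty (\<lambda>n. Var (Suc n))"

lemma wk_simps [simp]:
  "wk SetT = SetT" "wk (El t) = El (ren_tm Suc t)"
  by (simp_all add: wk_def sub_Var_Suc)

lemma shift_ty_Suc: "shift_ty (Suc k) X = wk (shift_ty k X)"
  unfolding shift_ty_def wk_def sub_ty_sub_ty by (simp add: comp_def)

lemma shift_ty_0 [simp]: "shift_ty 0 X = X"
  by (simp add: shift_ty_def)

lemma sub_one_wk [simp]: "sub_ty (one a) (wk X) = X"
  unfolding wk_def sub_ty_sub_ty by (simp add: comp_def)

locale framework =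
  fixes A :: "'c judgement set"
begin

abbreviation ctx :: "'c ty list \<Rightarrow> bool" where
  "ctx \<Gamma> \<equiv> derivable A \<Gamma> Ctx"
abbreviation isty :: "'c ty list \<Rightarrow> 'c ty \<Rightarrow> bool" where
  "isty \<Gamma> X \<equiv> derivable A \<Gamma> (IsTy X)"
abbreviation has :: "'c ty list \<Rightarrow> 'c tm \<Rightarrow> 'c ty \<Rightarrow> bool" where
  "has \<Gamma> t X \<equiv> derivable A \<Gamma> (HasTy t X)"
abbreviation eqt :: "'c ty list \<Rightarrow> 'c tm \<Rightarrow> 'c tm \<Rightarrow> 'c ty \<Rightarrow> bool" where
  "eqt \<Gamma> t u X \<equiv> derivable A \<Gamma> (EqTm t u X)"
abbreviation eqty :: "'c ty list \<Rightarrow> 'c ty \<Rightarrow> 'c ty \<Rightarrow> bool" where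
  "eqty \<Gamma> X Y \<equiv> derivable A \<Gamma> (EqTy X Y)"

lemma derivable_closed_subst: "derivable A [] J \<Longrightarrow> ctx \<Gamma> \<Longrightarrow> derivable A \<Gamma> (sub_jdg s J)"
  by (erule derivable.subst) simp_all

lemma derivable_closed: "derivable A [] J \<Longrightarrow> ctx \<Gamma> \<Longrightarrow> derivable A \<Gamma> J"
  using derivable_closed_subst[where s = Var] by simp

lemma derivable_weaken:
  assumes "derivable A \<Gamma> J" and "ctx (X # \<Gamma>)"
  shows "derivable A (X # \<Gamma>) (sub_jdg (\<lambda>n. Var (Suc n)) J)"
proof (rule derivable.subst[OF assms], intro allI impI)
  fix i assume "i < length \<Gamma>"
  then show "has (X # \<Gamma>) (Var (Suc i)) (sub_ty (\<lambda>n. Var (Suc n)) (shift_ty (Suc i) (\<Gamma> ! i)))"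
    using derivable.var[OF assms(2), of "Suc i"] by (simp add: shift_ty_Suc[of "Suc i"] wk_def)
qed

lemma derivable_one:
  assumes "derivable A (X # \<Gamma>) J" and "has \<Gamma> a X" and "ctx \<Gamma>"
  shows "derivable A \<Gamma> (sub_jdg (one a) J)"
proof (rule derivable.subst[OF assms(1,3)], intro allI impI)
  fix i assume i: "i < length (X # \<Gamma>)"
  show "has \<Gamma> (one a i) (sub_ty (one a) (shift_ty (Suc i) ((X # \<Gamma>) ! i)))"
  proof (cases i)
    case 0
    then show ?thesis using assms(2) by (simp add: shift_ty_Suc)
  next
    case (Suc j)
    then show ?thesis using i derivable.var[OF assms(3), of j] by (simp add: shift_ty_Suc[of "Suc j"])
  qed
qed

lemma has_app:
  assumes "has \<Gamma> f (Fun X Y)" and "has \<Gamma> a X" and "Z = sub_ty (one a) Y"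
  shows "has \<Gamma> (App f a) Z"
  using derivable.app[OF assms(1,2)] assms(3) by simp

lemma has_weaken: "has \<Gamma> t (El P) \<Longrightarrow> ctx (X # \<Gamma>) \<Longrightarrow> has (X # \<Gamma>) (ren_tm Suc t) (El (ren_tm Suc P))"
  using derivable_weaken[of \<Gamma> "HasTy t (El P)" X] by (simp add: sub_Var_Suc)

lemma set_weaken: "has \<Gamma> t SetT \<Longrightarrow> ctx (X # \<Gamma>) \<Longrightarrow> has (X # \<Gamma>) (ren_tm Suc t) SetT"
  using derivable_weaken[of \<Gamma> "HasTy t SetT" X] by (simp add: sub_Var_Suc)

lemma has_conv: "has \<Gamma> t (El P) \<Longrightarrow> eqt \<Gamma> P Q SetT \<Longrightarrow> has \<Gamma> t (El Q)"
  by (rule derivable.conv) (auto intro: derivable.el_eq)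

lemma eqt_beta:
  assumes "has (X # \<Gamma>) b SetT" and "has \<Gamma> a X"
  shows "eqt \<Gamma> (App (Lam b) a) (sub_tm (one a) b) SetT"
  using derivable.beta[OF assms] by simp

lemma ctx_El: "ctx \<Gamma> \<Longrightarrow> has \<Gamma> P SetT \<Longrightarrow> ctx (El P # \<Gamma>)"
  by (simp add: derivable.ctx_cons derivable.el_ty)

lemma ctx_SetT: "ctx \<Gamma> \<Longrightarrow> ctx (SetT # \<Gamma>)"
  by (simp add: derivable.ctx_cons derivable.set_ty)

lemma ctx_Nil: "ctx []"
  by (rule derivable.ctx_nil)

lemma has_Var0: "ctx (X # \<Gamma>) \<Longrightarrow> has (X # \<Gamma>) (Var 0) (wk X)"
  using derivable.var[of A "X # \<Gamma>" 0] by (simp add: shift_ty_Suc)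

lemma has_VarSuc: "ctx (X # \<Gamma>) \<Longrightarrow> has \<Gamma> (Var i) Y \<Longrightarrow> has (X # \<Gamma>) (Var (Suc i)) (wk Y)"
  using derivable_weaken[of \<Gamma> "HasTy (Var i) Y" X] by (simp add: wk_def)

definition tru :: "'c ty list \<Rightarrow> 'c tm \<Rightarrow> bool" where
  "tru \<Gamma> P \<longleftrightarrow> (\<exists>t. has \<Gamma> t (El P))"

lemma truI: "has \<Gamma> t (El P) \<Longrightarrow> tru \<Gamma> P"
  by (auto simp: tru_def)

lemma tru_conv: "tru \<Gamma> P \<Longrightarrow> eqt \<Gamma> P Q SetT \<Longrightarrow> tru \<Gamma> Q"
  unfolding tru_def by (blast intro: has_conv)

lemma tru_weaken: "tru \<Gamma> P \<Longrightarrow> ctx (X # \<Gamma>) \<Longrightarrow> tru (X # \<Gamma>) (ren_tm Suc P)"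
  unfolding tru_def by (blast intro: has_weaken)

lemma tru_hyp: "ctx (El P # \<Gamma>) \<Longrightarrow> tru (El P # \<Gamma>) (ren_tm Suc P)"
  using has_Var0[of "El P" \<Gamma>] by (auto simp: tru_def)

lemma tru_beta:
  assumes "has (X # \<Gamma>) b SetT" and "has \<Gamma> a X"
  shows "tru \<Gamma> (App (Lam b) a) \<longleftrightarrow> tru \<Gamma> (sub_tm (one a) b)"
  using eqt_beta[OF assms] by (blast intro: tru_conv derivable.tm_sym)

end

section \<open>Typing rules of the constants\<close>

lemmas framework_syntax = fn_def arr_def el_def set_p_def cst_def app_p_def lam_p_def fam_def
  Pi_s_def Sig_s_def W_s_def imp_s_def and_s_def

lemma one_numeral [simp]: "one a (numeral k) = Var (pred_numeral k)"
  by (simp add: numeral_eq_Suc)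

lemma up_sub_numeral [simp]: "up_sub s (numeral k) = ren_tm Suc (s (pred_numeral k))"
  by (simp add: numeral_eq_Suc)

lemma up_numeral [simp]: "up r (numeral k) = Suc (r (pred_numeral k))"
  by (simp add: numeral_eq_Suc)

abbreviation piB :: "'c tm \<Rightarrow> 'c tm \<Rightarrow> 'c tm" where
  "piB P B \<equiv> App (App (Con CPi) P) B"
abbreviation sigB :: "'c tm \<Rightarrow> 'c tm \<Rightarrow> 'c tm" where
  "sigB P B \<equiv> App (App (Con CSig) P) B"
abbreviation plusT :: "'c tm \<Rightarrow> 'c tm \<Rightarrow> 'c tm" where
  "plusT P Q \<equiv> App (App (Con CPlus) P) Q"
abbreviation idT :: "'c tm \<Rightarrow> 'c tm \<Rightarrow> 'c tm \<Rightarrow> 'c tm" where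
  "idT P a b \<equiv> App (App (App (Con CId) P) a) b"
abbreviation pairT :: "'c tm \<Rightarrow> 'c tm \<Rightarrow> 'c tm \<Rightarrow> 'c tm \<Rightarrow> 'c tm" where
  "pairT P B a b \<equiv> App (App (App (App (Con CPair) P) B) a) b"
abbreviation splitT :: "'c tm \<Rightarrow> 'c tm \<Rightarrow> 'c tm \<Rightarrow> 'c tm \<Rightarrow> 'c tm \<Rightarrow> 'c tm" where
  "splitT P B C c p \<equiv> App (App (App (App (App (Con CSplit) P) B) C) c) p"
abbreviation whenT :: "'c tm \<Rightarrow> 'c tm \<Rightarrow> 'c tm \<Rightarrow> 'c tm \<Rightarrow> 'c tm \<Rightarrow> 'c tm \<Rightarrow> 'c tm" where
  "whenT P Q C c d p \<equiv> App (App (App (App (App (App (Con CWhen) P) Q) C) c) d) p"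
abbreviation famTy :: "'c tm \<Rightarrow> 'c ty" where
  "famTy P \<equiv> Fun (El P) SetT"
abbreviation wkt :: "'c tm \<Rightarrow> 'c tm" where
  "wkt \<equiv> ren_tm Suc"

lemma sub_up_Suc: "sub_tm (up_sub (\<lambda>n. Var (Suc n))) t = ren_tm (up Suc) t"
  by (simp add: ren_eq_sub up_sub_Var_comp[unfolded comp_def] comp_def)

lemma one_Var0_under [simp]: "sub_tm (one (Var 0)) (ren_tm (up Suc) t) = t" for t :: "'c tm"
proof -
  have "one (Var 0) \<circ> up Suc = (Var :: nat \<Rightarrow> 'c tm)"
  proof
    fix n show "(one (Var 0) \<circ> up Suc) n = (Var n :: 'c tm)" by (cases n) auto
  qed
  then show ?thesis by (simp add: sub_ren)
qed

lemma one_Var0_under_ty [simp]: "sub_ty (one (Var 0)) (sub_ty (up_sub (\<lambda>n. Var (Suc n))) X) = X" for X :: "'c ty"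
proof -
  have "sub_tm (one (Var 0)) \<circ> up_sub (\<lambda>n. Var (Suc n)) = (Var :: nat \<Rightarrow> 'c tm)"
  proof
    fix n show "(sub_tm (one (Var 0)) \<circ> up_sub (\<lambda>n. Var (Suc n))) n = (Var n :: 'c tm)"
      by (cases n) auto
  qed
  then show ?thesis by (simp add: sub_ty_sub_ty)
qed

section \<open>Weakening below a binder and inversion of abstraction\<close>

context framework
begin

text \<open>Weakening by \<open>Y\<close> below the last assumption \<open>X\<close> serves the
  bodies of abstractions and the contexts that must end with the variable proposition.\<close>

lemma derivable_weaken_under:
  assumes "derivable A (X # \<Gamma>) J" and "ctx (wk X # Y # \<Gamma>)"
  shows "derivable A (wk X # Y # \<Gamma>) (sub_jdg (up_sub (\<lambda>n. Var (Suc n))) J)"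
proof (rule derivable.subst[OF assms], intro allI impI)
  let ?s = "up_sub (\<lambda>n. Var (Suc n) :: 'c tm)"
  have wk2: "sub_ty ?s (wk Z) = wk (wk Z)" for Z :: "'c ty"
    unfolding wk_def sub_ty_sub_ty by (simp add: comp_def)
  fix i assume i: "i < length (X # \<Gamma>)"
  show "has (wk X # Y # \<Gamma>) (?s i) (sub_ty ?s (shift_ty (Suc i) ((X # \<Gamma>) ! i)))"
  proof (cases i)
    case 0
    then show ?thesis using has_Var0[OF assms(2)] by (simp add: shift_ty_Suc wk2)
  next
    case (Suc j)
    then show ?thesis using i derivable.var[OF assms(2), of "Suc (Suc j)"]
      by (simp add: shift_ty_Suc[of "Suc j"] shift_ty_Suc[of "Suc (Suc j)"] wk2)
  qed
qed

lemma isty_weaken: "isty \<Gamma> Y \<Longrightarrow> ctx (X # \<Gamma>) \<Longrightarrow> isty (X # \<Gamma>) (wk Y)"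
  using derivable_weaken[of \<Gamma> "IsTy Y" X] by (simp add: wk_def)

lemma ctx_twice: "ctx \<Gamma> \<Longrightarrow> isty \<Gamma> X \<Longrightarrow> ctx (wk X # X # \<Gamma>)"
  by (simp add: derivable.ctx_cons isty_weaken)

text \<open>By \<open>beta\<close>, since \<open>ren_tm (up Suc) b\<close> is the body of the
  weakened \<open>Lam b\<close>. Many conversions below are of this kind: a family given as
  \<open>Lam Q\<close> is applied to the new variable.\<close>

lemma eqt_app_Var0:
  assumes "ctx \<Gamma>" and "isty \<Gamma> X" and "has (X # \<Gamma>) b Y"
  shows "eqt (X # \<Gamma>) (App (Lam (ren_tm (up Suc) b)) (Var 0)) b Y"
proof -
  have c: "ctx (X # \<Gamma>)" by (simp add: derivable.ctx_cons assms)
  have "has (wk X # X # \<Gamma>) (ren_tm (up Suc) b) (sub_ty (up_sub (\<lambda>n. Var (Suc n))) Y)"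
    using derivable_weaken_under[OF assms(3) ctx_twice[OF assms(1,2)]] by (simp add: sub_up_Suc)
  from derivable.beta[OF this has_Var0[OF c]] show ?thesis by simp
qed

text \<open>Equations of the theory are declared between closed abstractions. Applying both sides to
  the new variable and reducing recovers the equation of the bodies; the typings of the bodies
  license the reductions.\<close>

lemma eqt_unlam:
  assumes eq: "eqt \<Gamma> (Lam b) (Lam c) (Fun X Y)" and X: "ctx \<Gamma>" "isty \<Gamma> X"
    and b: "has (X # \<Gamma>) b Y" and c: "has (X # \<Gamma>) c Y"
  shows "eqt (X # \<Gamma>) b c Y"
proof -
  have cx: "ctx (X # \<Gamma>)" by (simp add: derivable.ctx_cons X)
  have "eqt (X # \<Gamma>) (Lam (ren_tm (up Suc) b)) (Lam (ren_tm (up Suc) c))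
      (Fun (wk X) (sub_ty (up_sub (\<lambda>n. Var (Suc n))) Y))"
    using derivable_weaken[OF eq cx] by (simp add: sub_up_Suc wk_def)
  from derivable.app_eq[OF this derivable.tm_refl[OF has_Var0[OF cx]]]
  have "eqt (X # \<Gamma>) (App (Lam (ren_tm (up Suc) b)) (Var 0)) (App (Lam (ren_tm (up Suc) c)) (Var 0)) Y"
    by simp
  then show ?thesis
    using eqt_app_Var0[OF X b] eqt_app_Var0[OF X c] by (meson derivable.tm_sym derivable.tm_trans)
qed

lemma has_Var: "ctx \<Gamma> \<Longrightarrow> i < length \<Gamma> \<Longrightarrow> X = shift_ty (Suc i) (\<Gamma> ! i) \<Longrightarrow> has \<Gamma> (Var i) X"
  by (simp add: derivable.var)

end

locale ctt = framework A for A :: "'c judgement set" +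
  assumes CTT: "CTT \<subseteq> A"
begin

text \<open>Quantified over the whole list, so that unfolding it once produces the typing rules of
  all constants.\<close>

lemma ctt_const:
  assumes "ctx \<Gamma>"
  shows "\<forall>(c, X) \<in> set (ctt_constants :: ('c con \<times> 'c pty) list). has \<Gamma> (Con c) (X 0)"
proof clarify
  fix c X assume "(c, X) \<in> set (ctt_constants :: ('c con \<times> 'c pty) list)"
  then have "([], HasTy (Con c) (X 0)) \<in> A"
    using CTT by (force simp: CTT_def declare_const_def)
  then have "has [] (Con c) (X 0)" by (rule derivable.axiom)
  then show "has \<Gamma> (Con c) (X 0)" using assms by (rule derivable_closed)
qed

lemma ctt_eqn: "\<forall>(l, r, X) \<in> set (ctt_equations :: 'c peq list). eqt [] (l 0) (r 0) (X 0)"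
proof clarify
  fix l r X assume "(l, r, X) \<in> set (ctt_equations :: 'c peq list)"
  then have "([], EqTm (l 0) (r 0) (X 0)) \<in> A"
    using CTT by (force simp: CTT_def declare_eqn_def)
  then show "eqt [] (l 0) (r 0) (X 0)" by (rule derivable.axiom)
qed

lemmas ctt_consts = ctt_const[unfolded ctt_constants_def framework_syntax, simplified]

lemma has_const:
  assumes "ctx \<Gamma>"
  shows CPi: "has \<Gamma> (Con CPi) (Fun SetT (Fun (famTy (Var 0)) SetT))"
    and CLambda: "has \<Gamma> (Con CLambda) (Fun SetT (Fun (famTy (Var 0))
      (Fun (Fun (El (Var (Suc 0))) (El (App (Var (Suc 0)) (Var 0)))) (El (piB (Var 2) (Var (Suc 0)))))))"
    and CAp: "has \<Gamma> (Con CAp) (Fun SetT (Fun (famTy (Var 0))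
      (Fun (El (piB (Var (Suc 0)) (Var 0))) (Fun (El (Var 2)) (El (App (Var 2) (Var 0)))))))"
    and CSig: "has \<Gamma> (Con CSig) (Fun SetT (Fun (famTy (Var 0)) SetT))"
    and CPair: "has \<Gamma> (Con CPair) (Fun SetT (Fun (famTy (Var 0)) (Fun (El (Var (Suc 0)))
      (Fun (El (App (Var (Suc 0)) (Var 0))) (El (sigB (Var 3) (Var 2)))))))"
    and CSplit: "has \<Gamma> (Con CSplit) (Fun SetT (Fun (famTy (Var 0)) (Fun (famTy (sigB (Var (Suc 0)) (Var 0)))
      (Fun (Fun (El (Var 2)) (Fun (El (App (Var 2) (Var 0)))
          (El (App (Var 2) (pairT (Var 4) (Var 3) (Var (Suc 0)) (Var 0))))))
        (Fun (El (sigB (Var 3) (Var 2))) (El (App (Var 2) (Var 0))))))))"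
    and CPlus: "has \<Gamma> (Con CPlus) (Fun SetT (Fun SetT SetT))"
    and CInl: "has \<Gamma> (Con CInl) (Fun SetT (Fun SetT (Fun (El (Var (Suc 0))) (El (plusT (Var 2) (Var (Suc 0)))))))"
    and CInr: "has \<Gamma> (Con CInr) (Fun SetT (Fun SetT (Fun (El (Var 0)) (El (plusT (Var 2) (Var (Suc 0)))))))"
    and CWhen: "has \<Gamma> (Con CWhen) (Fun SetT (Fun SetT (Fun (famTy (plusT (Var (Suc 0)) (Var 0)))
      (Fun (Fun (El (Var 2)) (El (App (Var (Suc 0)) (App (App (App (Con CInl) (Var 3)) (Var 2)) (Var 0)))))
      (Fun (Fun (El (Var 2)) (El (App (Var 2) (App (App (App (Con CInr) (Var 4)) (Var 3)) (Var 0)))))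
      (Fun (El (plusT (Var 4) (Var 3))) (El (App (Var 3) (Var 0)))))))))"
    and CN0: "has \<Gamma> (Con CN0) SetT"
    and CCase0: "has \<Gamma> (Con CCase0) (Fun (famTy (Con CN0)) (Fun (El (Con CN0)) (El (App (Var (Suc 0)) (Var 0)))))"
    and CN1: "has \<Gamma> (Con CN1) SetT"
    and CTt: "has \<Gamma> (Con CTt) (El (Con CN1))"
    and CN: "has \<Gamma> (Con CN) SetT"
    and CZero: "has \<Gamma> (Con CZero) (El (Con CN))"
    and CSucc: "has \<Gamma> (Con CSucc) (Fun (El (Con CN)) (El (Con CN)))"
    and CNatrec: "has \<Gamma> (Con CNatrec) (Fun (famTy (Con CN)) (Fun (El (App (Var 0) (Con CZero)))
      (Fun (Fun (El (Con CN)) (Fun (El (App (Var 2) (Var 0))) (El (App (Var 3) (App (Con CSucc) (Var (Suc 0)))))))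
      (Fun (El (Con CN)) (El (App (Var 3) (Var 0)))))))"
    and CId: "has \<Gamma> (Con CId) (Fun SetT (Fun (El (Var 0)) (famTy (Var (Suc 0)))))"
    and CRefl: "has \<Gamma> (Con CRefl) (Fun SetT (Fun (El (Var 0)) (El (idT (Var (Suc 0)) (Var 0) (Var 0)))))"
    and CU: "has \<Gamma> (Con CU) SetT"
    and CT: "has \<Gamma> (Con CT) (famTy (Con CU))"
    and CodePlus: "has \<Gamma> (Con CodePlus) (Fun (El (Con CU)) (Fun (El (Con CU)) (El (Con CU))))"
    and CodeN0: "has \<Gamma> (Con CodeN0) (El (Con CU))"
    and CodeN1: "has \<Gamma> (Con CodeN1) (El (Con CU))"
  using ctt_consts[OF assms] by blast+

lemma has_Pi:
  assumes c: "ctx \<Gamma>" and "has \<Gamma> P SetT" and "has \<Gamma> B (famTy P)"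
  shows "has \<Gamma> (piB P B) SetT"
proof -
  note 1 = has_app[OF CPi[OF c] assms(2) refl, simplified]
  show ?thesis using has_app[OF 1 assms(3) refl] by simp
qed

lemma has_Lambda:
  assumes c: "ctx \<Gamma>" and "has \<Gamma> P SetT" and "has \<Gamma> B (famTy P)"
    and "has \<Gamma> f (Fun (El P) (El (App (wkt B) (Var 0))))"
  shows "has \<Gamma> (App (App (App (Con CLambda) P) B) f) (El (piB P B))"
proof -
  note 1 = has_app[OF CLambda[OF c] assms(2) refl, simplified]
  note 2 = has_app[OF 1 assms(3) refl, simplified]
  show ?thesis using has_app[OF 2 assms(4) refl] by simp
qed

lemma has_Ap:
  assumes c: "ctx \<Gamma>" and "has \<Gamma> P SetT" and "has \<Gamma> B (famTy P)"
    and "has \<Gamma> f (El (piB P B))" and "has \<Gamma> a (El P)"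
  shows "has \<Gamma> (App (App (App (App (Con CAp) P) B) f) a) (El (App B a))"
proof -
  note 1 = has_app[OF CAp[OF c] assms(2) refl, simplified]
  note 2 = has_app[OF 1 assms(3) refl, simplified]
  note 3 = has_app[OF 2 assms(4) refl, simplified]
  show ?thesis using has_app[OF 3 assms(5) refl] by simp
qed

lemma has_Sig:
  assumes c: "ctx \<Gamma>" and "has \<Gamma> P SetT" and "has \<Gamma> B (famTy P)"
  shows "has \<Gamma> (sigB P B) SetT"
proof -
  note 1 = has_app[OF CSig[OF c] assms(2) refl, simplified]
  show ?thesis using has_app[OF 1 assms(3) refl] by simp
qed

lemma has_Pair:
  assumes c: "ctx \<Gamma>" and "has \<Gamma> P SetT" and "has \<Gamma> B (famTy P)"
    and "has \<Gamma> a (El P)" and "has \<Gamma> b (El (App B a))"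
  shows "has \<Gamma> (pairT P B a b) (El (sigB P B))"
proof -
  note 1 = has_app[OF CPair[OF c] assms(2) refl, simplified]
  note 2 = has_app[OF 1 assms(3) refl, simplified]
  note 3 = has_app[OF 2 assms(4) refl, simplified]
  show ?thesis using has_app[OF 3 assms(5) refl] by simp
qed

lemma has_Split:
  assumes c: "ctx \<Gamma>" and "has \<Gamma> P SetT" and "has \<Gamma> B (famTy P)"
    and "has \<Gamma> C (famTy (sigB P B))"
    and "has \<Gamma> f (Fun (El P) (Fun (El (App (wkt B) (Var 0)))
      (El (App (wkt (wkt C)) (pairT (wkt (wkt P)) (wkt (wkt B)) (Var (Suc 0)) (Var 0))))))"
    and "has \<Gamma> p (El (sigB P B))"
  shows "has \<Gamma> (splitT P B C f p) (El (App C p))"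
proof -
  note 1 = has_app[OF CSplit[OF c] assms(2) refl, simplified]
  note 2 = has_app[OF 1 assms(3) refl, simplified]
  note 3 = has_app[OF 2 assms(4) refl, simplified]
  note 4 = has_app[OF 3 assms(5) refl, simplified]
  show ?thesis using has_app[OF 4 assms(6) refl] by simp
qed

lemma has_Plus:
  assumes c: "ctx \<Gamma>" and "has \<Gamma> P SetT" and "has \<Gamma> Q SetT"
  shows "has \<Gamma> (plusT P Q) SetT"
proof -
  note 1 = has_app[OF CPlus[OF c] assms(2) refl, simplified]
  show ?thesis using has_app[OF 1 assms(3) refl] by simp
qed

lemma has_Inl:
  assumes c: "ctx \<Gamma>" and "has \<Gamma> P SetT" and "has \<Gamma> Q SetT" and "has \<Gamma> a (El P)"
  shows "has \<Gamma> (App (App (App (Con CInl) P) Q) a) (El (plusT P Q))"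
proof -
  note 1 = has_app[OF CInl[OF c] assms(2) refl, simplified]
  note 2 = has_app[OF 1 assms(3) refl, simplified]
  show ?thesis using has_app[OF 2 assms(4) refl] by simp
qed

lemma has_Inr:
  assumes c: "ctx \<Gamma>" and "has \<Gamma> P SetT" and "has \<Gamma> Q SetT" and "has \<Gamma> a (El Q)"
  shows "has \<Gamma> (App (App (App (Con CInr) P) Q) a) (El (plusT P Q))"
proof -
  note 1 = has_app[OF CInr[OF c] assms(2) refl, simplified]
  note 2 = has_app[OF 1 assms(3) refl, simplified]
  show ?thesis using has_app[OF 2 assms(4) refl] by simp
qed

lemma has_When:
  assumes c: "ctx \<Gamma>" and "has \<Gamma> P SetT" and "has \<Gamma> Q SetT" and "has \<Gamma> C (famTy (plusT P Q))"
    and "has \<Gamma> f (Fun (El P) (El (App (wkt C) (App (App (App (Con CInl) (wkt P)) (wkt Q)) (Var 0)))))"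
    and "has \<Gamma> g (Fun (El Q) (El (App (wkt C) (App (App (App (Con CInr) (wkt P)) (wkt Q)) (Var 0)))))"
    and "has \<Gamma> p (El (plusT P Q))"
  shows "has \<Gamma> (whenT P Q C f g p) (El (App C p))"
proof -
  note 1 = has_app[OF CWhen[OF c] assms(2) refl, simplified]
  note 2 = has_app[OF 1 assms(3) refl, simplified]
  note 3 = has_app[OF 2 assms(4) refl, simplified]
  note 4 = has_app[OF 3 assms(5) refl, simplified]
  note 5 = has_app[OF 4 assms(6) refl, simplified]
  show ?thesis using has_app[OF 5 assms(7) refl] by simp
qed

lemma has_Case0:
  assumes c: "ctx \<Gamma>" and "has \<Gamma> C (famTy (Con CN0))" and "has \<Gamma> p (El (Con CN0))"
  shows "has \<Gamma> (App (App (Con CCase0) C) p) (El (App C p))"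
proof -
  note 1 = has_app[OF CCase0[OF c] assms(2) refl, simplified]
  show ?thesis using has_app[OF 1 assms(3) refl] by simp
qed

lemma has_Natrec:
  assumes c: "ctx \<Gamma>" and "has \<Gamma> C (famTy (Con CN))" and "has \<Gamma> z (El (App C (Con CZero)))"
    and "has \<Gamma> f (Fun (El (Con CN)) (Fun (El (App (wkt C) (Var 0)))
      (El (App (wkt (wkt C)) (App (Con CSucc) (Var (Suc 0)))))))"
    and "has \<Gamma> n (El (Con CN))"
  shows "has \<Gamma> (App (App (App (App (Con CNatrec) C) z) f) n) (El (App C n))"
proof -
  note 1 = has_app[OF CNatrec[OF c] assms(2) refl, simplified]
  note 2 = has_app[OF 1 assms(3) refl, simplified]
  note 3 = has_app[OF 2 assms(4) refl, simplified]
  show ?thesis using has_app[OF 3 assms(5) refl] by simp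
qed

lemma has_Succ: "ctx \<Gamma> \<Longrightarrow> has \<Gamma> n (El (Con CN)) \<Longrightarrow> has \<Gamma> (App (Con CSucc) n) (El (Con CN))"
  using has_app[OF CSucc] by simp

lemma has_Id:
  assumes c: "ctx \<Gamma>" and "has \<Gamma> P SetT" and "has \<Gamma> a (El P)" and "has \<Gamma> b (El P)"
  shows "has \<Gamma> (idT P a b) SetT"
proof -
  note 1 = has_app[OF CId[OF c] assms(2) refl, simplified]
  note 2 = has_app[OF 1 assms(3) refl, simplified]
  show ?thesis using has_app[OF 2 assms(4) refl] by simp
qed

lemma has_Refl:
  assumes c: "ctx \<Gamma>" and "has \<Gamma> P SetT" and "has \<Gamma> a (El P)"
  shows "has \<Gamma> (App (App (Con CRefl) P) a) (El (idT P a a))"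
proof -
  note 1 = has_app[OF CRefl[OF c] assms(2) refl, simplified]
  show ?thesis using has_app[OF 1 assms(3) refl] by simp
qed

lemma has_T: "ctx \<Gamma> \<Longrightarrow> has \<Gamma> a (El (Con CU)) \<Longrightarrow> has \<Gamma> (App (Con CT) a) SetT"
  using has_app[OF CT] by simp

lemma has_CodePlus:
  assumes c: "ctx \<Gamma>" and "has \<Gamma> a (El (Con CU))" and "has \<Gamma> b (El (Con CU))"
  shows "has \<Gamma> (App (App (Con CodePlus) a) b) (El (Con CU))"
proof -
  note 1 = has_app[OF CodePlus[OF c] assms(2) refl, simplified]
  show ?thesis using has_app[OF 1 assms(3) refl] by simp
qed

lemma has_fam_app: "has \<Gamma> B (famTy P) \<Longrightarrow> has \<Gamma> a (El P) \<Longrightarrow> has \<Gamma> (App B a) SetT"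
  using has_app[of \<Gamma> B "El P" SetT a SetT] by simp

lemma eqt_T_CodeN0: "ctx \<Gamma> \<Longrightarrow> eqt \<Gamma> (App (Con CT) (Con CodeN0)) (Con CN0) SetT"
  and eqt_T_CodeN1: "ctx \<Gamma> \<Longrightarrow> eqt \<Gamma> (App (Con CT) (Con CodeN1)) (Con CN1) SetT"
  using ctt_eqn by (auto intro!: derivable_closed simp: ctt_equations_def framework_syntax)

lemma isty_fun_El: "has \<Gamma> P SetT \<Longrightarrow> isty (El P # \<Gamma>) Y \<Longrightarrow> isty \<Gamma> (Fun (El P) Y)"
  by (simp add: derivable.fun_ty derivable.el_ty)

text \<open>The computation rule of \<open>CSplit\<close> as declared, with six nested abstractions
  on either side. The second projection in \<open>gup_sigma\<close> depends on it.\<close>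

lemma split_eqn_closed: "eqt []
  (Lam (Lam (Lam (Lam (Lam (Lam (splitT (Var 5) (Var 4) (Var 3) (Var 2)
    (pairT (Var 5) (Var 4) (Var (Suc 0)) (Var 0)))))))))
  (Lam (Lam (Lam (Lam (Lam (Lam (App (App (Var 2) (Var (Suc 0))) (Var 0))))))))
  (Fun SetT (Fun (famTy (Var 0)) (Fun (famTy (sigB (Var (Suc 0)) (Var 0)))
    (Fun (Fun (El (Var 2)) (Fun (El (App (Var 2) (Var 0)))
        (El (App (Var 2) (pairT (Var 4) (Var 3) (Var (Suc 0)) (Var 0))))))
      (Fun (El (Var 3)) (Fun (El (App (Var 3) (Var 0)))
        (El (App (Var 3) (pairT (Var 5) (Var 4) (Var (Suc 0)) (Var 0))))))))))"
  using ctt_eqn[unfolded ctt_equations_def] by (simp add: given_def framework_syntax)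

end

section \<open>Inhabited sets\<close>

abbreviation impT :: "'c tm \<Rightarrow> 'c tm \<Rightarrow> 'c tm" where
  "impT P Q \<equiv> piB P (Lam (wkt Q))"
abbreviation andT :: "'c tm \<Rightarrow> 'c tm \<Rightarrow> 'c tm" where
  "andT P Q \<equiv> sigB P (Lam (wkt Q))"

context ctt
begin

lemma eqt_weaken: "eqt \<Gamma> t u SetT \<Longrightarrow> ctx (X # \<Gamma>) \<Longrightarrow> eqt (X # \<Gamma>) (wkt t) (wkt u) SetT"
  using derivable_weaken[of \<Gamma> "EqTm t u SetT" X] by (simp add: sub_Var_Suc)

lemma fam_weaken: "has \<Gamma> B (famTy P) \<Longrightarrow> ctx (X # \<Gamma>) \<Longrightarrow> has (X # \<Gamma>) (wkt B) (famTy (wkt P))"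
  using derivable_weaken[of \<Gamma> "HasTy B (famTy P)" X] by (simp add: sub_Var_Suc)

lemma isty_El: "has \<Gamma> P SetT \<Longrightarrow> isty \<Gamma> (El P)"
  by (rule derivable.el_ty)

lemma has_const_fam:
  "ctx \<Gamma> \<Longrightarrow> has \<Gamma> P SetT \<Longrightarrow> has \<Gamma> R SetT \<Longrightarrow> has \<Gamma> (Lam (wkt R)) (famTy P)"
  by (intro derivable.lam set_weaken ctx_El)

text \<open>Eliminators produce elements of \<open>App C p\<close>. For a constant motive this is a
  redex, and the equation leads back to \<open>R\<close>.\<close>

lemma eqt_const_fam:
  "ctx \<Gamma> \<Longrightarrow> has \<Gamma> P SetT \<Longrightarrow> has \<Gamma> R SetT \<Longrightarrow> has \<Gamma> a (El P) \<Longrightarrow>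
   eqt \<Gamma> (App (Lam (wkt R)) a) R SetT"
  using eqt_beta[OF set_weaken[OF _ ctx_El], of \<Gamma> R P a] by simp

lemma has_conv_sym: "has \<Gamma> t (El P) \<Longrightarrow> eqt \<Gamma> Q P SetT \<Longrightarrow> has \<Gamma> t (El Q)"
  by (rule has_conv) (auto intro: derivable.tm_sym)

lemma has_Var0_El: "ctx (El P # \<Gamma>) \<Longrightarrow> has (El P # \<Gamma>) (Var 0) (El (wkt P))"
  using has_Var0[of "El P" \<Gamma>] by simp

lemma tru_PiI:
  assumes c: "ctx \<Gamma>" and P: "has \<Gamma> P SetT" and Q: "has (El P # \<Gamma>) Q SetT" and t: "tru (El P # \<Gamma>) Q"
  shows "tru \<Gamma> (piB P (Lam Q))"
proof -
  obtain t where "has (El P # \<Gamma>) t (El Q)" using t by (auto simp: tru_def)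
  \<comment> \<open>\<open>CLambda\<close> expects a body over the redex formed from the declared
    family instead of over \<open>Q\<close>.\<close>
  then have "has (El P # \<Gamma>) t (El (App (wkt (Lam Q)) (Var 0)))"
    by (rule has_conv_sym) (use eqt_app_Var0[OF c isty_El[OF P] Q] in simp)
  then show ?thesis
    by (rule truI[OF has_Lambda[OF c P derivable.lam[OF Q] derivable.lam]])
qed

lemma tru_PiE:
  assumes c: "ctx \<Gamma>" and P: "has \<Gamma> P SetT" and Q: "has (El P # \<Gamma>) Q SetT"
    and t: "tru \<Gamma> (piB P (Lam Q))" and a: "has \<Gamma> a (El P)"
  shows "tru \<Gamma> (sub_tm (one a) Q)"
proof -
  obtain t where "has \<Gamma> t (El (piB P (Lam Q)))" using t by (auto simp: tru_def)
  from has_Ap[OF c P derivable.lam[OF Q] this a] show ?thesis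
    by (intro tru_conv[OF truI eqt_beta[OF Q a]])
qed

lemma tru_SigI:
  assumes c: "ctx \<Gamma>" and P: "has \<Gamma> P SetT" and Q: "has (El P # \<Gamma>) Q SetT"
    and a: "has \<Gamma> a (El P)" and b: "tru \<Gamma> (sub_tm (one a) Q)"
  shows "tru \<Gamma> (sigB P (Lam Q))"
proof -
  obtain b where "has \<Gamma> b (El (sub_tm (one a) Q))" using b by (auto simp: tru_def)
  then have "has \<Gamma> b (El (App (Lam Q) a))" by (rule has_conv_sym[OF _ eqt_beta[OF Q a]])
  from has_Pair[OF c P derivable.lam[OF Q] a this] show ?thesis by (rule truI)
qed

text \<open>The branch of an eliminator lives over \<open>El ((\<lambda>x. Q) x)\<close>, a redex; the next two lemmas pass
  to the context whose last entry is \<open>El Q\<close>.\<close>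

lemma has_pair_vars:
  assumes c: "ctx \<Gamma>" and P: "has \<Gamma> P SetT" and Q: "has (El P # \<Gamma>) Q SetT"
  shows "has (El Q # El P # \<Gamma>)
    (pairT (wkt (wkt P)) (wkt (wkt (Lam Q))) (Var (Suc 0)) (Var 0)) (El (sigB (wkt (wkt P)) (wkt (wkt (Lam Q)))))"
proof -
  have c1: "ctx (El P # \<Gamma>)" by (rule ctx_El[OF c P])
  have c2: "ctx (El Q # El P # \<Gamma>)" by (rule ctx_El[OF c1 Q])
  have "has (El Q # El P # \<Gamma>) (Var 0) (El (wkt Q))" by (rule has_Var0_El[OF c2])
  then have "has (El Q # El P # \<Gamma>) (Var 0) (El (App (wkt (wkt (Lam Q))) (Var (Suc 0))))"
    by (rule has_conv_sym) (use eqt_weaken[OF eqt_app_Var0[OF c isty_El[OF P] Q] c2] in simp)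
  moreover have "has (El Q # El P # \<Gamma>) (Var (Suc 0)) (El (wkt (wkt P)))"
    using has_VarSuc[OF c2 has_Var0_El[OF c1]] by simp
  moreover have "has (El Q # El P # \<Gamma>) (wkt (wkt P)) SetT"
    by (rule set_weaken[OF set_weaken[OF P c1] c2])
  moreover have "has (El Q # El P # \<Gamma>) (wkt (wkt (Lam Q))) (famTy (wkt (wkt P)))"
    by (rule fam_weaken[OF fam_weaken[OF derivable.lam[OF Q] c1] c2])
  ultimately show ?thesis by (intro has_Pair[OF c2])
qed

lemma has_split_branch:
  assumes c: "ctx \<Gamma>" and P: "has \<Gamma> P SetT" and Q: "has (El P # \<Gamma>) Q SetT"
    and t: "has (El Q # El P # \<Gamma>) t (El T)"
    and T: "eqt (El Q # El P # \<Gamma>)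
      (App (wkt (wkt C)) (pairT (wkt (wkt P)) (wkt (wkt (Lam Q))) (Var (Suc 0)) (Var 0))) T SetT"
  shows "has \<Gamma> (Lam (Lam t)) (Fun (El P) (Fun (El (App (wkt (Lam Q)) (Var 0)))
      (El (App (wkt (wkt C)) (pairT (wkt (wkt P)) (wkt (wkt (Lam Q))) (Var (Suc 0)) (Var 0))))))"
proof (rule derivable.lam)
  have "eqt (El P # \<Gamma>) Q (App (wkt (Lam Q)) (Var 0)) SetT"
    using derivable.tm_sym[OF eqt_app_Var0[OF c isty_El[OF P] Q]] by simp
  then have "eqty (El P # \<Gamma>) (El Q) (El (App (wkt (Lam Q)) (Var 0)))" by (rule derivable.el_eq)
  from derivable.fun_eq[OF this derivable.el_eq[OF derivable.tm_sym[OF T]]]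
  show "has (El P # \<Gamma>) (Lam t) (Fun (El (App (wkt (Lam Q)) (Var 0)))
      (El (App (wkt (wkt C)) (pairT (wkt (wkt P)) (wkt (wkt (Lam Q))) (Var (Suc 0)) (Var 0)))))"
    by (rule derivable.conv[OF derivable.lam[OF t]])
qed

lemma eqt_const_fam_pair:
  assumes c: "ctx \<Gamma>" and P: "has \<Gamma> P SetT" and Q: "has (El P # \<Gamma>) Q SetT" and R: "has \<Gamma> R SetT"
  shows "eqt (El Q # El P # \<Gamma>)
    (App (wkt (wkt (Lam (wkt R)))) (pairT (wkt (wkt P)) (wkt (wkt (Lam Q))) (Var (Suc 0)) (Var 0)))
    (wkt (wkt R)) SetT"
proof -
  have c1: "ctx (El P # \<Gamma>)" by (rule ctx_El[OF c P])
  have c2: "ctx (El Q # El P # \<Gamma>)" by (rule ctx_El[OF c1 Q])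
  have S: "has (El Q # El P # \<Gamma>) (wkt (wkt (sigB P (Lam Q)))) SetT"
    by (rule set_weaken[OF set_weaken[OF has_Sig[OF c P derivable.lam[OF Q]] c1] c2])
  have R2: "has (El Q # El P # \<Gamma>) (wkt (wkt R)) SetT"
    by (rule set_weaken[OF set_weaken[OF R c1] c2])
  show ?thesis
    using eqt_const_fam[OF c2 S R2] has_pair_vars[OF c P Q] by simp
qed

lemma has_split_const:
  assumes c: "ctx \<Gamma>" and P: "has \<Gamma> P SetT" and Q: "has (El P # \<Gamma>) Q SetT" and R: "has \<Gamma> R SetT"
    and p: "has \<Gamma> p (El (sigB P (Lam Q)))" and t: "has (El Q # El P # \<Gamma>) t (El (wkt (wkt R)))"
  shows "has \<Gamma> (splitT P (Lam Q) (Lam (wkt R)) (Lam (Lam t)) p) (El R)"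
proof -
  note S = has_Sig[OF c P derivable.lam[OF Q]]
  have "has \<Gamma> (splitT P (Lam Q) (Lam (wkt R)) (Lam (Lam t)) p) (El (App (Lam (wkt R)) p))"
    by (rule has_Split[OF c P derivable.lam[OF Q] has_const_fam[OF c S R] _ p])
      (rule has_split_branch[OF c P Q t eqt_const_fam_pair[OF c P Q R]])
  then show ?thesis by (rule has_conv[OF _ eqt_const_fam[OF c S R p]])
qed

lemma tru_SigE:
  assumes c: "ctx \<Gamma>" and P: "has \<Gamma> P SetT" and Q: "has (El P # \<Gamma>) Q SetT" and R: "has \<Gamma> R SetT"
    and p: "tru \<Gamma> (sigB P (Lam Q))" and t: "tru (El Q # El P # \<Gamma>) (wkt (wkt R))"
  shows "tru \<Gamma> R"
  using p t has_split_const[OF c P Q R] unfolding tru_def by blast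

lemma tru_PlusI1: "ctx \<Gamma> \<Longrightarrow> has \<Gamma> P SetT \<Longrightarrow> has \<Gamma> Q SetT \<Longrightarrow> tru \<Gamma> P \<Longrightarrow> tru \<Gamma> (plusT P Q)"
  and tru_PlusI2: "ctx \<Gamma> \<Longrightarrow> has \<Gamma> P SetT \<Longrightarrow> has \<Gamma> Q SetT \<Longrightarrow> tru \<Gamma> Q \<Longrightarrow> tru \<Gamma> (plusT P Q)"
  unfolding tru_def by (blast intro: has_Inl has_Inr)+

lemma tru_PlusE:
  assumes c: "ctx \<Gamma>" and P: "has \<Gamma> P SetT" and Q: "has \<Gamma> Q SetT" and R: "has \<Gamma> R SetT"
    and p: "tru \<Gamma> (plusT P Q)" and t: "tru (El P # \<Gamma>) (wkt R)" and u: "tru (El Q # \<Gamma>) (wkt R)"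
  shows "tru \<Gamma> R"
proof -
  obtain t u p where t: "has (El P # \<Gamma>) t (El (wkt R))" and u: "has (El Q # \<Gamma>) u (El (wkt R))"
    and p: "has \<Gamma> p (El (plusT P Q))" using p t u by (auto simp: tru_def)
  note S = has_Plus[OF c P Q]
  have cP: "ctx (El P # \<Gamma>)" and cQ: "ctx (El Q # \<Gamma>)" by (rule ctx_El[OF c], fact)+
  have "has (El P # \<Gamma>) t (El (App (wkt (Lam (wkt R))) (App (App (App (Con CInl) (wkt P)) (wkt Q)) (Var 0))))"
    using eqt_const_fam[OF cP set_weaken[OF S cP, simplified] set_weaken[OF R cP]
        has_Inl[OF cP set_weaken[OF P cP] set_weaken[OF Q cP] has_Var0_El[OF cP], simplified]]
    by (intro has_conv_sym[OF t]) simp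
  moreover have "has (El Q # \<Gamma>) u (El (App (wkt (Lam (wkt R))) (App (App (App (Con CInr) (wkt P)) (wkt Q)) (Var 0))))"
    using eqt_const_fam[OF cQ set_weaken[OF S cQ, simplified] set_weaken[OF R cQ]
        has_Inr[OF cQ set_weaken[OF P cQ] set_weaken[OF Q cQ] has_Var0_El[OF cQ], simplified]]
    by (intro has_conv_sym[OF u]) simp
  ultimately have "has \<Gamma> (whenT P Q (Lam (wkt R)) (Lam t) (Lam u) p) (El (App (Lam (wkt R)) p))"
    by (intro has_When[OF c P Q has_const_fam[OF c S R] _ _ p] derivable.lam)
  then show ?thesis by (intro truI[OF has_conv[OF _ eqt_const_fam[OF c S R p]]])
qed

lemma tru_N0E:
  assumes c: "ctx \<Gamma>" and R: "has \<Gamma> R SetT" and p: "tru \<Gamma> (Con CN0)"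
  shows "tru \<Gamma> R"
proof -
  obtain p where p: "has \<Gamma> p (El (Con CN0))" using p by (auto simp: tru_def)
  note S = CN0[OF c]
  from has_Case0[OF c has_const_fam[OF c S R] p] show ?thesis
    by (intro truI[OF has_conv[OF _ eqt_const_fam[OF c S R p]]])
qed

lemma tru_N1: "ctx \<Gamma> \<Longrightarrow> tru \<Gamma> (Con CN1)"
  by (rule truI[OF CTt])

lemma has_imp: "ctx \<Gamma> \<Longrightarrow> has \<Gamma> P SetT \<Longrightarrow> has \<Gamma> Q SetT \<Longrightarrow> has \<Gamma> (impT P Q) SetT"
  by (intro has_Pi has_const_fam)

lemma has_and: "ctx \<Gamma> \<Longrightarrow> has \<Gamma> P SetT \<Longrightarrow> has \<Gamma> Q SetT \<Longrightarrow> has \<Gamma> (andT P Q) SetT"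
  by (intro has_Sig has_const_fam)

lemma tru_impI:
  "ctx \<Gamma> \<Longrightarrow> has \<Gamma> P SetT \<Longrightarrow> has \<Gamma> Q SetT \<Longrightarrow> tru (El P # \<Gamma>) (wkt Q) \<Longrightarrow> tru \<Gamma> (impT P Q)"
  by (intro tru_PiI set_weaken ctx_El)

lemma tru_impE:
  assumes c: "ctx \<Gamma>" and P: "has \<Gamma> P SetT" and Q: "has \<Gamma> Q SetT" and i: "tru \<Gamma> (impT P Q)" and p: "tru \<Gamma> P"
  shows "tru \<Gamma> Q"
proof -
  obtain p where "has \<Gamma> p (El P)" using p by (auto simp: tru_def)
  from tru_PiE[OF c P set_weaken[OF Q ctx_El[OF c P]] i this] show ?thesis by simp
qed

lemma tru_andI:
  assumes c: "ctx \<Gamma>" and P: "has \<Gamma> P SetT" and Q: "has \<Gamma> Q SetT" and p: "tru \<Gamma> P" and q: "tru \<Gamma> Q"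
  shows "tru \<Gamma> (andT P Q)"
proof -
  obtain p where "has \<Gamma> p (El P)" using p by (auto simp: tru_def)
  from tru_SigI[OF c P set_weaken[OF Q ctx_El[OF c P]] this] q show ?thesis by simp
qed

lemma tru_andE:
  assumes c: "ctx \<Gamma>" and P: "has \<Gamma> P SetT" and Q: "has \<Gamma> Q SetT" and p: "tru \<Gamma> (andT P Q)"
  shows "tru \<Gamma> P" and "tru \<Gamma> Q"
proof -
  have c1: "ctx (El P # \<Gamma>)" by (rule ctx_El[OF c P])
  note Q1 = set_weaken[OF Q c1]
  have c2: "ctx (El (wkt Q) # El P # \<Gamma>)" by (rule ctx_El[OF c1 Q1])
  show "tru \<Gamma> P" by (rule tru_SigE[OF c P Q1 P p tru_weaken[OF tru_hyp[OF c1] c2]])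
  show "tru \<Gamma> Q" by (rule tru_SigE[OF c P Q1 Q p tru_hyp[OF c2]])
qed

end

section \<open>Projections and the uniformity rule\<close>

abbreviation fstT :: "'c tm \<Rightarrow> 'c tm \<Rightarrow> 'c tm \<Rightarrow> 'c tm" where
  "fstT P B p \<equiv> splitT P B (Lam (wkt P)) (Lam (Lam (Var (Suc 0)))) p"

context ctt
begin

abbreviation split_branch_ty :: "'c ty" where
  "split_branch_ty \<equiv> Fun (El (Var 2)) (Fun (El (App (Var 2) (Var 0)))
    (El (App (Var 2) (pairT (Var 4) (Var 3) (Var (Suc 0)) (Var 0)))))"

text \<open>\<open>eqt_unlam\<close> removes one binder at a time and wants the context formed and
  both sides typed at each stage, hence the telescope of six contexts.\<close>

lemma split_eqn_open: "eqt
   [El (App (Var 3) (Var 0)), El (Var 3), split_branch_ty, famTy (sigB (Var (Suc 0)) (Var 0)), famTy (Var 0), SetT]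
   (splitT (Var 5) (Var 4) (Var 3) (Var 2) (pairT (Var 5) (Var 4) (Var (Suc 0)) (Var 0)))
   (App (App (Var 2) (Var (Suc 0))) (Var 0))
   (El (App (Var 3) (pairT (Var 5) (Var 4) (Var (Suc 0)) (Var 0))))"
proof -
  note comp = shift_ty_def
  let ?X1 = "SetT :: 'c ty" and ?X2 = "famTy (Var 0 :: 'c tm)" and ?X3 = "famTy (sigB (Var (Suc 0)) (Var 0) :: 'c tm)"
    and ?X4 = split_branch_ty and ?X5 = "El (Var 3 :: 'c tm)" and ?X6 = "El (App (Var 3) (Var 0) :: 'c tm)"
  have i1: "isty [] ?X1" by (simp add: derivable.set_ty ctx_Nil)
  have c1: "ctx [?X1]" by (simp add: ctx_SetT ctx_Nil)
  have i2: "isty [?X1] ?X2"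
    by (intro isty_fun_El has_Var c1 derivable.set_ty ctx_El) (simp_all add: comp)
  have c2: "ctx [?X2, ?X1]" by (rule derivable.ctx_cons[OF c1 i2])
  have v2: "has [?X2, ?X1] (Var 0) (famTy (Var (Suc 0)))" "has [?X2, ?X1] (Var (Suc 0)) SetT"
    by (rule has_Var[OF c2]; simp add: comp)+
  have s2: "has [?X2, ?X1] (sigB (Var (Suc 0)) (Var 0)) SetT" by (rule has_Sig[OF c2 v2(2,1)])
  have i3: "isty [?X2, ?X1] ?X3" by (intro isty_fun_El derivable.set_ty ctx_El c2 s2)
  have c3: "ctx [?X3, ?X2, ?X1]" by (rule derivable.ctx_cons[OF c2 i3])
  have v3: "has [?X3, ?X2, ?X1] (Var 0) (famTy (sigB (Var 2) (Var (Suc 0))))"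
    "has [?X3, ?X2, ?X1] (Var (Suc 0)) (famTy (Var 2))" "has [?X3, ?X2, ?X1] (Var 2) SetT"
    by (rule has_Var[OF c3]; simp add: comp)+
  have d1: "ctx [El (Var 2), ?X3, ?X2, ?X1]" by (rule ctx_El[OF c3 v3(3)])
  have d2: "has [El (Var 2), ?X3, ?X2, ?X1] (App (Var 2) (Var 0)) SetT"
    by (rule has_fam_app[where P = "Var 3"]; rule has_Var[OF d1]; simp add: comp)
  have d3: "ctx [El (App (Var 2) (Var 0)), El (Var 2), ?X3, ?X2, ?X1]" by (rule ctx_El[OF d1 d2])
  have d4: "has [El (App (Var 2) (Var 0)), El (Var 2), ?X3, ?X2, ?X1]
      (pairT (Var 4) (Var 3) (Var (Suc 0)) (Var 0)) (El (sigB (Var 4) (Var 3)))"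
    by (rule has_Pair[OF d3]; rule has_Var[OF d3]; simp add: comp)
  have d5: "has [El (App (Var 2) (Var 0)), El (Var 2), ?X3, ?X2, ?X1]
      (App (Var 2) (pairT (Var 4) (Var 3) (Var (Suc 0)) (Var 0))) SetT"
    by (rule has_fam_app[OF _ d4]; rule has_Var[OF d3]; simp add: comp)
  have i4: "isty [?X3, ?X2, ?X1] ?X4" by (intro isty_fun_El v3 d2 isty_El d5)
  have c4: "ctx [?X4, ?X3, ?X2, ?X1]" by (rule derivable.ctx_cons[OF c3 i4])
  have i5: "isty [?X4, ?X3, ?X2, ?X1] ?X5"
    by (rule isty_El; rule has_Var[OF c4]; simp add: comp)
  have c5: "ctx [?X5, ?X4, ?X3, ?X2, ?X1]" by (rule derivable.ctx_cons[OF c4 i5])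
  have i6: "isty [?X5, ?X4, ?X3, ?X2, ?X1] ?X6"
    by (rule isty_El; rule has_fam_app[where P = "Var 4"]; rule has_Var[OF c5]; simp add: comp)
  have c6: "ctx [?X6, ?X5, ?X4, ?X3, ?X2, ?X1]" by (rule derivable.ctx_cons[OF c5 i6])
  let ?\<Gamma> = "[?X6, ?X5, ?X4, ?X3, ?X2, ?X1]"
  have v6: "has ?\<Gamma> (Var 5) SetT" "has ?\<Gamma> (Var 4) (famTy (Var 5))" "has ?\<Gamma> (Var 3) (famTy (sigB (Var 5) (Var 4)))"
    "has ?\<Gamma> (Var (Suc 0)) (El (Var 5))" "has ?\<Gamma> (Var 0) (El (App (Var 4) (Var (Suc 0))))"
    by (rule has_Var[OF c6]; simp add: comp)+
  have v6c: "has ?\<Gamma> (Var 2) (Fun (El (Var 5)) (Fun (El (App (Var 5) (Var 0)))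
      (El (App (Var 5) (pairT (Var 7) (Var 6) (Var (Suc 0)) (Var 0))))))"
    by (rule has_Var[OF c6]; simp add: comp)
  let ?T = "El (App (Var 3) (pairT (Var 5) (Var 4) (Var (Suc 0)) (Var 0))) :: 'c ty"
  let ?l = "splitT (Var 5) (Var 4) (Var 3) (Var 2) (pairT (Var 5) (Var 4) (Var (Suc 0)) (Var 0)) :: 'c tm"
  let ?r = "App (App (Var 2) (Var (Suc 0))) (Var 0) :: 'c tm"
  have l: "has ?\<Gamma> ?l ?T"
    by (rule has_Split[OF c6 v6(1,2,3) _ has_Pair[OF c6 v6(1,2,4,5)]]) (use v6c in simp)
  have r: "has ?\<Gamma> ?r ?T"
    using has_app[OF has_app[OF v6c v6(4) refl, simplified] v6(5) refl] by simp
  \<comment> \<open>Typings of the partially abstracted sides are built from the innermost body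
    outwards; the equation is then opened in the opposite order.\<close>
  note l5 = derivable.lam[OF l] and r5 = derivable.lam[OF r]
  note l4 = derivable.lam[OF l5] and r4 = derivable.lam[OF r5]
  note l3 = derivable.lam[OF l4] and r3 = derivable.lam[OF r4]
  note l2 = derivable.lam[OF l3] and r2 = derivable.lam[OF r3]
  note l1 = derivable.lam[OF l2] and r1 = derivable.lam[OF r2]
  note e1 = eqt_unlam[OF split_eqn_closed ctx_Nil i1 l1 r1]
  note e2 = eqt_unlam[OF e1 c1 i2 l2 r2]
  note e3 = eqt_unlam[OF e2 c2 i3 l3 r3]
  note e4 = eqt_unlam[OF e3 c3 i4 l4 r4]
  note e5 = eqt_unlam[OF e4 c4 i5 l5 r5]
  show ?thesis by (rule eqt_unlam[OF e5 c5 i6 l r])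
qed

lemma split_pair:
  assumes c: "ctx \<Gamma>" and P: "has \<Gamma> P SetT" and B: "has \<Gamma> B (famTy P)" and C: "has \<Gamma> C (famTy (sigB P B))"
    and f: "has \<Gamma> f (Fun (El P) (Fun (El (App (wkt B) (Var 0)))
      (El (App (wkt (wkt C)) (pairT (wkt (wkt P)) (wkt (wkt B)) (Var (Suc 0)) (Var 0))))))"
    and a: "has \<Gamma> a (El P)" and b: "has \<Gamma> b (El (App B a))"
  shows "eqt \<Gamma> (splitT P B C f (pairT P B a b)) (App (App f a) b) (El (App C (pairT P B a b)))"
proof -
  \<comment> \<open>The head of a context is its latest assumption, so the arguments appear in
    reverse order.\<close>
  let ?s = "\<lambda>n. [b, a, f, C, B, P] ! n"
  have "derivable A \<Gamma> (sub_jdg ?s (EqTm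
   (splitT (Var 5) (Var 4) (Var 3) (Var 2) (pairT (Var 5) (Var 4) (Var (Suc 0)) (Var 0)))
   (App (App (Var 2) (Var (Suc 0))) (Var 0))
   (El (App (Var 3) (pairT (Var 5) (Var 4) (Var (Suc 0)) (Var 0))))))"
    by (rule derivable.subst[OF split_eqn_open c])
      (use P B C f a b in \<open>simp add: shift_ty_def All_less_Suc numeral_eq_Suc\<close>)
  then show ?thesis by (simp add: numeral_eq_Suc)
qed

lemma has_fst_branch:
  assumes c: "ctx \<Gamma>" and P: "has \<Gamma> P SetT" and B: "has \<Gamma> B (famTy P)"
  shows "has \<Gamma> (Lam (Lam (Var (Suc 0)))) (Fun (El P) (Fun (El (App (wkt B) (Var 0)))
      (El (App (wkt (wkt (Lam (wkt P)))) (pairT (wkt (wkt P)) (wkt (wkt B)) (Var (Suc 0)) (Var 0))))))"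
proof -
  have c1: "ctx (El P # \<Gamma>)" by (rule ctx_El[OF c P])
  have Q: "has (El P # \<Gamma>) (App (wkt B) (Var 0)) SetT"
    by (rule has_fam_app[OF fam_weaken[OF B c1] has_Var0_El[OF c1]])
  have c2: "ctx (El (App (wkt B) (Var 0)) # El P # \<Gamma>)" by (rule ctx_El[OF c1 Q])
  note P2 = set_weaken[OF set_weaken[OF P c1] c2] and B2 = fam_weaken[OF fam_weaken[OF B c1] c2]
  have v1: "has (El (App (wkt B) (Var 0)) # El P # \<Gamma>) (Var (Suc 0)) (El (wkt (wkt P)))"
    using has_VarSuc[OF c2 has_Var0_El[OF c1]] by simp
  have v0: "has (El (App (wkt B) (Var 0)) # El P # \<Gamma>) (Var 0) (El (App (wkt (wkt B)) (Var (Suc 0))))"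
    using has_Var0_El[OF c2] by simp
  have "eqt (El (App (wkt B) (Var 0)) # El P # \<Gamma>)
     (App (wkt (wkt (Lam (wkt P)))) (pairT (wkt (wkt P)) (wkt (wkt B)) (Var (Suc 0)) (Var 0))) (wkt (wkt P)) SetT"
    using eqt_const_fam[OF c2 has_Sig[OF c2 P2 B2] P2 has_Pair[OF c2 P2 B2 v1 v0]] by simp
  then show ?thesis by (intro derivable.lam has_conv_sym[OF v1])
qed

lemma has_fst:
  assumes c: "ctx \<Gamma>" and P: "has \<Gamma> P SetT" and B: "has \<Gamma> B (famTy P)" and p: "has \<Gamma> p (El (sigB P B))"
  shows "has \<Gamma> (fstT P B p) (El P)"
proof -
  note S = has_Sig[OF c P B]
  show ?thesis
    by (rule has_conv[OF has_Split[OF c P B has_const_fam[OF c S P] has_fst_branch[OF c P B] p]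
          eqt_const_fam[OF c S P p]])
qed

text \<open>After \<open>split_pair\<close> two beta steps remain, one for each variable of the
  branch.\<close>

lemma fst_pair:
  assumes c: "ctx \<Gamma>" and P: "has \<Gamma> P SetT" and B: "has \<Gamma> B (famTy P)"
    and a: "has \<Gamma> a (El P)" and b: "has \<Gamma> b (El (App B a))"
  shows "eqt \<Gamma> (fstT P B (pairT P B a b)) a (El P)"
proof -
  note S = has_Sig[OF c P B] and p = has_Pair[OF c P B a b]
  have T: "eqty \<Gamma> (El (App (Lam (wkt P)) (pairT P B a b))) (El P)"
    by (rule derivable.el_eq[OF eqt_const_fam[OF c S P p]])
  have c1: "ctx (El P # \<Gamma>)" by (rule ctx_El[OF c P])
  have Q: "has (El P # \<Gamma>) (App (wkt B) (Var 0)) SetT"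
    by (rule has_fam_app[OF fam_weaken[OF B c1] has_Var0_El[OF c1]])
  have c2: "ctx (El (App (wkt B) (Var 0)) # El P # \<Gamma>)" by (rule ctx_El[OF c1 Q])
  have v1: "has (El (App (wkt B) (Var 0)) # El P # \<Gamma>) (Var (Suc 0)) (El (wkt (wkt P)))"
    using has_VarSuc[OF c2 has_Var0_El[OF c1]] by simp
  have "eqt \<Gamma> (App (Lam (Lam (Var (Suc 0)))) a) (Lam (wkt a)) (Fun (El (App B a)) (El (wkt P)))"
    using derivable.beta[OF derivable.lam[OF v1] a] by simp
  from derivable.app_eq[OF this derivable.tm_refl[OF b]]
  have e1: "eqt \<Gamma> (App (App (Lam (Lam (Var (Suc 0)))) a) b) (App (Lam (wkt a)) b) (El P)" by simp
  have Ba: "has \<Gamma> (App B a) SetT" by (rule has_fam_app[OF B a])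
  have e2: "eqt \<Gamma> (App (Lam (wkt a)) b) a (El P)"
    using derivable.beta[OF has_weaken[OF a ctx_El[OF c Ba]] b] by simp
  have "eqt \<Gamma> (fstT P B (pairT P B a b)) (App (App (Lam (Lam (Var (Suc 0)))) a) b) (El P)"
    by (rule derivable.conv_eq[OF split_pair[OF c P B has_const_fam[OF c S P] has_fst_branch[OF c P B] a b] T])
  from derivable.tm_trans[OF this derivable.tm_trans[OF e1 e2]] show ?thesis .
qed

end

locale ctt_gup = ctt +
  assumes GUP: "GUP_CTT \<subseteq> A"
begin

abbreviation gupI :: "'c tm \<Rightarrow> 'c tm \<Rightarrow> 'c tm \<Rightarrow> 'c tm \<Rightarrow> 'c tm" where
  "gupI I R F r \<equiv> App (App (App (App (Con CGupI) I) R) F) r"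

lemma CGupI: "ctx \<Gamma> \<Longrightarrow> has \<Gamma> (Con CGupI) (Fun SetT
    (Fun (Fun SetT (famTy (Var (Suc 0)))) (Fun (Fun SetT (El (Var 2)))
      (Fun (Fun SetT (El (App (App (Var 2) (Var 0)) (App (Var (Suc 0)) (Var 0))))) (El (Var 3))))))"
  and CGupR: "ctx \<Gamma> \<Longrightarrow> has \<Gamma> (Con CGupR) (Fun SetT
    (Fun (Fun SetT (famTy (Var (Suc 0)))) (Fun (Fun SetT (El (Var 2)))
      (Fun (Fun SetT (El (App (App (Var 2) (Var 0)) (App (Var (Suc 0)) (Var 0)))))
        (Fun SetT (El (App (App (Var 3) (Var 0)) (gupI (Var 4) (Var 3) (Var 2) (Var (Suc 0))))))))))"
  by (rule derivable_closed[OF derivable.axiom],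
      use GUP in \<open>simp add: GUP_CTT_def declare_const_def gup_rule_def framework_syntax\<close>, assumption)+

lemma tru_of_Fun:
  assumes "has \<Gamma> t (Fun X (El P))" and "ctx (X # \<Gamma>)"
  shows "tru (X # \<Gamma>) P"
proof -
  have "has (X # \<Gamma>) (wkt t) (Fun (wk X) (El (ren_tm (up Suc) P)))"
    using derivable_weaken[OF assms] by (simp add: sub_Var_Suc sub_up_Suc wk_def)
  from has_app[OF this has_Var0[OF assms(2)] refl] show ?thesis by (auto intro: truI)
qed

lemma gup_rules:
  assumes c: "ctx \<Gamma>" and I: "has \<Gamma> I SetT" and R: "has \<Gamma> R (Fun SetT (famTy (wkt I)))"
    and F: "has \<Gamma> F (Fun SetT (El (wkt I)))"
    and r: "has \<Gamma> r (Fun SetT (El (App (App (wkt R) (Var 0)) (App (wkt F) (Var 0)))))"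
  shows "has \<Gamma> (gupI I R F r) (El I)"
    and "\<exists>t. has \<Gamma> t (Fun SetT (El (App (App (wkt R) (Var 0)) (wkt (gupI I R F r)))))"
proof -
  note 1 = has_app[OF CGupI[OF c] I refl, simplified]
  note 2 = has_app[OF 1 R refl, simplified]
  note 3 = has_app[OF 2 F refl, simplified]
  show "has \<Gamma> (gupI I R F r) (El I)" using has_app[OF 3 r refl] by simp
  note 1 = has_app[OF CGupR[OF c] I refl, simplified]
  note 2 = has_app[OF 1 R refl, simplified]
  note 3 = has_app[OF 2 F refl, simplified]
  show "\<exists>t. has \<Gamma> t (Fun SetT (El (App (App (wkt R) (Var 0)) (wkt (gupI I R F r)))))"
    using has_app[OF 3 r refl] by auto
qed

text \<open>The uniformity rule for a relation given by a single proof of \<open>\<Sum>i. R(P, i)\<close>, with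
  \<open>F\<close> the first and \<open>r\<close> the second projection.\<close>

lemma gup_sigma:
  assumes c: "ctx \<Gamma>" and I: "has \<Gamma> I SetT" and R: "has (El (wkt I) # SetT # \<Gamma>) R SetT"
    and w: "tru (SetT # \<Gamma>) (sigB (wkt I) (Lam R))"
  shows "\<exists>i. has \<Gamma> i (El I) \<and> tru (SetT # \<Gamma>) (sub_tm (one (wkt i)) R)"
proof -
  let ?G = "SetT # \<Gamma>"
  have iS: "isty \<Gamma> SetT" by (rule derivable.set_ty[OF c])
  have c1: "ctx ?G" by (rule ctx_SetT[OF c])
  have I1: "has ?G (wkt I) SetT" by (rule set_weaken[OF I c1])
  \<comment> \<open>\<open>Lam R\<close> is hidden behind a name, lest renamings be pushed into its
    body and the lemmas on families no longer match.\<close>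
  define L where "L = Lam R"
  have B: "has ?G L (famTy (wkt I))" unfolding L_def by (rule derivable.lam[OF R])
  obtain w where w: "has ?G w (El (sigB (wkt I) L))" using w by (auto simp: tru_def L_def)
  let ?RR = "Lam L" and ?fst = "\<lambda>p. fstT (wkt I) L p"
  have RR: "has \<Gamma> ?RR (Fun SetT (famTy (wkt I)))" by (rule derivable.lam[OF B])
  have fst: "has ?G (?fst w) (El (wkt I))" by (rule has_fst[OF c1 I1 B w])
  have F: "has \<Gamma> (Lam (?fst w)) (Fun SetT (El (wkt I)))" by (rule derivable.lam[OF fst])

  \<comment> \<open>The motive of the second projection is the fibre over the first projection of
    the argument.\<close>
  let ?C = "Lam (App (wkt L) (fstT (wkt (wkt I)) (wkt L) (Var 0)))"
  have S: "has ?G (sigB (wkt I) L) SetT" by (rule has_Sig[OF c1 I1 B])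
  have cS: "ctx (El (sigB (wkt I) L) # ?G)" by (rule ctx_El[OF c1 S])
  have Cbody: "has (El (sigB (wkt I) L) # ?G)
      (App (wkt L) (fstT (wkt (wkt I)) (wkt L) (Var 0))) SetT"
    by (rule has_fam_app[OF fam_weaken[OF B cS] has_fst[OF cS set_weaken[OF I1 cS] fam_weaken[OF B cS]]])
      (use has_Var0_El[OF cS] in simp)
  have C: "has ?G ?C (famTy (sigB (wkt I) L))" by (rule derivable.lam[OF Cbody])
  have c2: "ctx (El (wkt I) # ?G)" by (rule ctx_El[OF c1 I1])
  have c3: "ctx (El R # El (wkt I) # ?G)" by (rule ctx_El[OF c2 R])
  let ?G3 = "El R # El (wkt I) # ?G"
  note I3 = set_weaken[OF set_weaken[OF I1 c2] c3] and B3 = fam_weaken[OF fam_weaken[OF B c2] c3]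
  have v1: "has ?G3 (Var (Suc 0)) (El (wkt (wkt (wkt I))))"
    using has_VarSuc[OF c3 has_Var0_El[OF c2]] by simp
  have redR: "eqt ?G3 (App (wkt (wkt L)) (Var (Suc 0))) (wkt R) SetT"
    using eqt_weaken[OF eqt_app_Var0[OF c1 isty_El[OF I1] R] c3] by (simp add: L_def)
  have v0: "has ?G3 (Var 0) (El (App (wkt (wkt L)) (Var (Suc 0))))"
    by (rule has_conv_sym[OF has_Var0_El[OF c3] redR])
  let ?pair = "pairT (wkt (wkt (wkt I))) (wkt (wkt L)) (Var (Suc 0)) (Var 0)"
  have p3: "has ?G3 ?pair (El (sigB (wkt (wkt (wkt I))) (wkt (wkt L))))"
    by (rule has_Pair[OF c3 I3 B3 v1 v0])
  have S3: "has ?G3 (sigB (wkt (wkt (wkt I))) (wkt (wkt L))) SetT" by (rule has_Sig[OF c3 I3 B3])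
  have c4: "ctx (El (sigB (wkt (wkt (wkt I))) (wkt (wkt L))) # ?G3)" by (rule ctx_El[OF c3 S3])
  have Cbody3: "has (El (sigB (wkt (wkt (wkt I))) (wkt (wkt L))) # ?G3)
      (App (wkt (wkt (wkt L))) (fstT (wkt (wkt (wkt (wkt I)))) (wkt (wkt (wkt L))) (Var 0))) SetT"
    by (rule has_fam_app[OF fam_weaken[OF B3 c4] has_fst[OF c4 set_weaken[OF I3 c4] fam_weaken[OF B3 c4]]])
      (use has_Var0_El[OF c4] in simp)
  have "eqt ?G3 (App (wkt (wkt ?C)) ?pair)
      (App (wkt (wkt L)) (fstT (wkt (wkt (wkt I))) (wkt (wkt L)) ?pair)) SetT"
    using eqt_beta[OF Cbody3 p3] by simp
  moreover have "eqt ?G3 (App (wkt (wkt L)) (fstT (wkt (wkt (wkt I))) (wkt (wkt L)) ?pair))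
      (App (wkt (wkt L)) (Var (Suc 0))) SetT"
    using derivable.app_eq[OF derivable.tm_refl[OF B3] fst_pair[OF c3 I3 B3 v1 v0]] by simp
  \<comment> \<open>On a pair of variables the motive reduces to \<open>R\<close>, so the branch may
    return its second variable; this is where \<open>fst_pair\<close> enters.\<close>
  ultimately have redC: "eqt ?G3 (App (wkt (wkt ?C)) ?pair) (wkt R) SetT"
    using redR by (meson derivable.tm_trans)
  have "has ?G (Lam (Lam (Var 0))) (Fun (El (wkt I)) (Fun (El (App (wkt L) (Var 0)))
      (El (App (wkt (wkt ?C)) ?pair))))"
    unfolding L_def by (rule has_split_branch[OF c1 I1 R has_Var0_El[OF c3] redC[unfolded L_def]])
  from has_Split[OF c1 I1 B C this w]
  have "has ?G (splitT (wkt I) L ?C (Lam (Lam (Var 0))) w) (El (App ?C w))" .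
  then have snd: "has ?G (splitT (wkt I) L ?C (Lam (Lam (Var 0))) w) (El (App L (?fst w)))"
    by (rule has_conv) (use eqt_beta[OF Cbody w] in simp)
  let ?snd = "splitT (wkt I) L ?C (Lam (Lam (Var 0))) w"
  have redRR: "eqt ?G (App (wkt ?RR) (Var 0)) L (famTy (wkt I))"
    using eqt_app_Var0[OF c iS B] by simp
  have redF: "eqt ?G (App (wkt (Lam (?fst w))) (Var 0)) (?fst w) (El (wkt I))"
    using eqt_app_Var0[OF c iS fst] by simp
  have "eqt ?G (App (App (wkt ?RR) (Var 0)) (App (wkt (Lam (?fst w))) (Var 0))) (App L (?fst w)) SetT"
    using derivable.app_eq[OF redRR redF] by simp
  from has_conv_sym[OF snd this]
  have r: "has \<Gamma> (Lam ?snd) (Fun SetT (El (App (App (wkt ?RR) (Var 0)) (App (wkt (Lam (?fst w))) (Var 0)))))"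
    by (rule derivable.lam)
  let ?i = "gupI I ?RR (Lam (?fst w)) (Lam ?snd)"
  have i: "has \<Gamma> ?i (El I)" by (rule gup_rules(1)[OF c I RR F r])
  have "tru ?G (App (App (wkt ?RR) (Var 0)) (wkt ?i))"
    using gup_rules(2)[OF c I RR F r] c1 by (blast intro: tru_of_Fun)
  moreover have "eqt ?G (App (App (wkt ?RR) (Var 0)) (wkt ?i)) (App L (wkt ?i)) SetT"
    using derivable.app_eq[OF redRR derivable.tm_refl[OF has_weaken[OF i c1]]] by simp
  ultimately have "tru ?G (App L (wkt ?i))" by (rule tru_conv)
  moreover have "eqt ?G (App L (wkt ?i)) (sub_tm (one (wkt ?i)) R) SetT"
    using eqt_beta[OF R has_weaken[OF i c1]] by (simp add: L_def)
  ultimately have "tru ?G (sub_tm (one (wkt ?i)) R)" by (rule tru_conv)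
  with i show ?thesis by blast
qed

end

section \<open>Formal spaces in type theory\<close>

definition covT :: "'c tm \<Rightarrow> 'c tm \<Rightarrow> 'c tm \<Rightarrow> 'c tm \<Rightarrow> 'c tm" where
  "covT G D U V = piB G (Lam (impT (App (wkt U) (Var 0)) (App (App D (Var 0)) (wkt V))))"
definition singT :: "'c tm \<Rightarrow> 'c tm \<Rightarrow> 'c tm" where
  "singT G a = Lam (idT G (Var 0) (wkt a))"
definition cupT :: "'c tm \<Rightarrow> 'c tm \<Rightarrow> 'c tm" where
  "cupT U V = Lam (plusT (App (wkt U) (Var 0)) (App (wkt V) (Var 0)))"
text \<open>One of the two conjuncts of \<open>downT\<close>, separated so that typing and
  substitution are treated once for both.\<close>

definition meetT :: "'c tm \<Rightarrow> 'c tm \<Rightarrow> 'c tm \<Rightarrow> 'c tm \<Rightarrow> 'c tm" where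
  "meetT G D U d = sigB G (Lam (andT (App (wkt U) (Var 0)) (App (App D (wkt d)) (singT G (Var 0)))))"
definition downT :: "'c tm \<Rightarrow> 'c tm \<Rightarrow> 'c tm \<Rightarrow> 'c tm \<Rightarrow> 'c tm" where
  "downT G D U V = Lam (andT (meetT G D (wkt U) (Var 0)) (meetT G D (wkt V) (Var 0)))"
abbreviation emptyT :: "'c tm" where
  "emptyT \<equiv> Lam (Con CN0)"
abbreviation wholeT :: "'c tm" where
  "wholeT \<equiv> Lam (Con CN1)"
definition starT :: "'c tm \<Rightarrow> 'c tm \<Rightarrow> 'c tm \<Rightarrow> 'c tm" where
  "starT G D U = Lam (covT G D (downT G D (singT G (Var 0)) (wkt U)) emptyT)"

text \<open>The data of a space without the rules of its cover, so that it also describes the target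
  of the surjection. Closedness makes \<open>G\<close> and \<open>D\<close> invariant under renaming
  and substitution.\<close>

locale ctt_presite = ctt A for A :: "'c judgement set" +
  fixes G D :: "'c tm"
  assumes scoped_G: "scoped 0 G" and scoped_D: "scoped 0 D"
    and G: "has [] G SetT" and D: "has [] D (Fun (El G) (Fun (famTy G) SetT))"
begin

lemma closed [simp]: "ren_tm r G = G" "ren_tm r D = D" "sub_tm s G = G" "sub_tm s D = D"
  by (simp_all add: ren_closed sub_closed scoped_G scoped_D)

abbreviation cov where "cov \<equiv> covT G D"
abbreviation star where "star \<equiv> starT G D"
abbreviation down where "down \<equiv> downT G D"
abbreviation meet where "meet \<equiv> meetT G D"
abbreviation sing where "sing \<equiv> singT G"
abbreviation cvr where "cvr a U \<equiv> App (App D a) U"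
abbreviation fam where "fam \<Gamma> U \<equiv> has \<Gamma> U (famTy G)"

lemma ren_space [simp]:
  "ren_tm r (cov U V) = cov (ren_tm r U) (ren_tm r V)"
  "ren_tm r (sing a) = sing (ren_tm r a)"
  "ren_tm r (meet U a) = meet (ren_tm r U) (ren_tm r a)"
  "ren_tm r (down U V) = down (ren_tm r U) (ren_tm r V)"
  "ren_tm r (star U) = star (ren_tm r U)"
  by (simp_all add: covT_def singT_def meetT_def downT_def starT_def)

lemma sub_space [simp]:
  "sub_tm s (cov U V) = cov (sub_tm s U) (sub_tm s V)"
  "sub_tm s (sing a) = sing (sub_tm s a)"
  "sub_tm s (meet U a) = meet (sub_tm s U) (sub_tm s a)"
  "sub_tm s (down U V) = down (sub_tm s U) (sub_tm s V)"
  "sub_tm s (star U) = star (sub_tm s U)"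
  by (simp_all add: covT_def singT_def meetT_def downT_def starT_def)

lemma ren_cupT [simp]: "ren_tm r (cupT U V) = cupT (ren_tm r U) (ren_tm r V)"
  and sub_cupT [simp]: "sub_tm s (cupT U V) = cupT (sub_tm s U) (sub_tm s V)"
  by (simp_all add: cupT_def)

lemma has_G: "ctx \<Gamma> \<Longrightarrow> has \<Gamma> G SetT"
  using derivable_closed[OF G] .

lemma ctx_G: "ctx \<Gamma> \<Longrightarrow> ctx (El G # \<Gamma>)"
  by (intro ctx_El has_G)

lemma has_D: "ctx \<Gamma> \<Longrightarrow> has \<Gamma> a (El G) \<Longrightarrow> fam \<Gamma> U \<Longrightarrow> has \<Gamma> (cvr a U) SetT"
  using has_app[OF has_app[OF derivable_closed[OF D, of \<Gamma>], of a "Fun (famTy G) SetT"], of U SetT] by simp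

lemma fam_wk: "fam \<Gamma> U \<Longrightarrow> ctx (X # \<Gamma>) \<Longrightarrow> fam (X # \<Gamma>) (wkt U)"
  using fam_weaken[of \<Gamma> U G X] by simp

lemma elem_wk: "has \<Gamma> a (El G) \<Longrightarrow> ctx (X # \<Gamma>) \<Longrightarrow> has (X # \<Gamma>) (wkt a) (El G)"
  using has_weaken[of \<Gamma> a G X] by simp

lemma var_G: "ctx \<Gamma> \<Longrightarrow> has (El G # \<Gamma>) (Var 0) (El G)"
  using has_Var0_El[OF ctx_G, of \<Gamma>] by simp

lemma fam_Lam: "ctx \<Gamma> \<Longrightarrow> has (El G # \<Gamma>) P SetT \<Longrightarrow> fam \<Gamma> (Lam P)"
  by (rule derivable.lam)

lemma fam_empty: "ctx \<Gamma> \<Longrightarrow> fam \<Gamma> emptyT" and fam_whole: "ctx \<Gamma> \<Longrightarrow> fam \<Gamma> wholeT"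
  by (intro fam_Lam CN0 CN1 ctx_G; assumption)+

lemma fam_sing: "ctx \<Gamma> \<Longrightarrow> has \<Gamma> a (El G) \<Longrightarrow> fam \<Gamma> (sing a)"
  unfolding singT_def by (intro fam_Lam has_Id has_G ctx_G var_G elem_wk)

lemma fam_cup: "ctx \<Gamma> \<Longrightarrow> fam \<Gamma> U \<Longrightarrow> fam \<Gamma> V \<Longrightarrow> fam \<Gamma> (cupT U V)"
  unfolding cupT_def by (intro fam_Lam has_Plus ctx_G has_fam_app[where P = G] fam_wk var_G)

lemma has_meet_body: "ctx \<Gamma> \<Longrightarrow> fam \<Gamma> U \<Longrightarrow> has \<Gamma> a (El G) \<Longrightarrow>
    has (El G # \<Gamma>) (andT (App (wkt U) (Var 0)) (cvr (wkt a) (sing (Var 0)))) SetT"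
  by (intro has_and ctx_G has_fam_app[where P = G] fam_wk var_G has_D elem_wk fam_sing)

lemma has_meet: "ctx \<Gamma> \<Longrightarrow> fam \<Gamma> U \<Longrightarrow> has \<Gamma> a (El G) \<Longrightarrow> has \<Gamma> (meet U a) SetT"
  unfolding meetT_def by (intro has_Sig has_G derivable.lam has_meet_body)

lemma has_down_body: "ctx \<Gamma> \<Longrightarrow> fam \<Gamma> U \<Longrightarrow> fam \<Gamma> V \<Longrightarrow>
    has (El G # \<Gamma>) (andT (meet (wkt U) (Var 0)) (meet (wkt V) (Var 0))) SetT"
  by (intro has_and ctx_G has_meet fam_wk var_G)

lemma fam_down: "ctx \<Gamma> \<Longrightarrow> fam \<Gamma> U \<Longrightarrow> fam \<Gamma> V \<Longrightarrow> fam \<Gamma> (down U V)"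
  unfolding downT_def by (intro fam_Lam has_down_body)

lemma has_cov_body: "ctx \<Gamma> \<Longrightarrow> fam \<Gamma> U \<Longrightarrow> fam \<Gamma> V \<Longrightarrow>
    has (El G # \<Gamma>) (impT (App (wkt U) (Var 0)) (cvr (Var 0) (wkt V))) SetT"
  by (intro has_imp ctx_G has_fam_app[where P = G] fam_wk var_G has_D)

lemma has_cov: "ctx \<Gamma> \<Longrightarrow> fam \<Gamma> U \<Longrightarrow> fam \<Gamma> V \<Longrightarrow> has \<Gamma> (cov U V) SetT"
  unfolding covT_def by (intro has_Pi has_G derivable.lam has_cov_body)

lemma has_star_body: "ctx \<Gamma> \<Longrightarrow> fam \<Gamma> U \<Longrightarrow>
    has (El G # \<Gamma>) (cov (down (sing (Var 0)) (wkt U)) emptyT) SetT"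
  by (intro has_cov ctx_G fam_down fam_sing var_G fam_wk fam_empty)

lemma fam_star: "ctx \<Gamma> \<Longrightarrow> fam \<Gamma> U \<Longrightarrow> fam \<Gamma> (star U)"
  unfolding starT_def by (intro fam_Lam has_star_body)

lemma tru_covE:
  assumes c: "ctx \<Gamma>" and U: "fam \<Gamma> U" and V: "fam \<Gamma> V"
    and t: "tru \<Gamma> (cov U V)" and a: "has \<Gamma> a (El G)" and u: "tru \<Gamma> (App U a)"
  shows "tru \<Gamma> (cvr a V)"
proof -
  have "tru \<Gamma> (impT (App U a) (cvr a V))"
    using tru_PiE[OF c has_G[OF c] has_cov_body[OF c U V] t[unfolded covT_def] a] by simp
  then show ?thesis
    by (rule tru_impE[OF c has_fam_app[OF U a] has_D[OF c a V] _ u])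
qed

lemma ctx_cov_hyp: "ctx \<Gamma> \<Longrightarrow> fam \<Gamma> U \<Longrightarrow> ctx (El (App (wkt U) (Var 0)) # El G # \<Gamma>)"
  by (intro ctx_El[OF ctx_G] has_fam_app[OF fam_wk[OF _ ctx_G] var_G])

lemma tru_covI:
  assumes c: "ctx \<Gamma>" and U: "fam \<Gamma> U" and V: "fam \<Gamma> V"
    and t: "tru (El (App (wkt U) (Var 0)) # El G # \<Gamma>) (cvr (Var (Suc 0)) (wkt (wkt V)))"
  shows "tru \<Gamma> (cov U V)"
  unfolding covT_def
proof (rule tru_PiI[OF c has_G[OF c] has_cov_body[OF c U V]])
  note c1 = ctx_G[OF c]
  show "tru (El G # \<Gamma>) (impT (App (wkt U) (Var 0)) (cvr (Var 0) (wkt V)))"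
    by (rule tru_impI[OF c1 has_fam_app[OF fam_wk[OF U c1] var_G[OF c]] has_D[OF c1 var_G[OF c] fam_wk[OF V c1]]])
      (use t in simp)
qed

lemma tru_whole: "ctx \<Gamma> \<Longrightarrow> has \<Gamma> a (El G) \<Longrightarrow> tru \<Gamma> (App wholeT a)"
  using tru_beta[OF CN1[OF ctx_G], of \<Gamma> a] by (simp add: tru_N1)

lemma tru_empty: "ctx \<Gamma> \<Longrightarrow> has \<Gamma> a (El G) \<Longrightarrow> tru \<Gamma> (App emptyT a) \<longleftrightarrow> tru \<Gamma> (Con CN0)"
  using tru_beta[OF CN0[OF ctx_G], of \<Gamma> a] by simp

lemma tru_cup:
  assumes c: "ctx \<Gamma>" and U: "fam \<Gamma> U" and V: "fam \<Gamma> V" and a: "has \<Gamma> a (El G)"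
  shows "tru \<Gamma> (App (cupT U V) a) \<longleftrightarrow> tru \<Gamma> (plusT (App U a) (App V a))"
proof -
  note c1 = ctx_G[OF c]
  have "has (El G # \<Gamma>) (plusT (App (wkt U) (Var 0)) (App (wkt V) (Var 0))) SetT"
    by (intro has_Plus c1 has_fam_app[where P = G] fam_wk U V var_G c)
  from tru_beta[OF this a] show ?thesis by (simp add: cupT_def)
qed

lemma tru_down:
  assumes c: "ctx \<Gamma>" and U: "fam \<Gamma> U" and V: "fam \<Gamma> V" and a: "has \<Gamma> a (El G)"
  shows "tru \<Gamma> (App (down U V) a) \<longleftrightarrow> tru \<Gamma> (andT (meet U a) (meet V a))"
  using tru_beta[OF has_down_body[OF c U V] a] by (simp add: downT_def)

lemma tru_star:
  assumes c: "ctx \<Gamma>" and U: "fam \<Gamma> U" and a: "has \<Gamma> a (El G)"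
  shows "tru \<Gamma> (App (star U) a) \<longleftrightarrow> tru \<Gamma> (cov (down (sing a) U) emptyT)"
  using tru_beta[OF has_star_body[OF c U] a] by (simp add: starT_def)

lemma tru_sing_self:
  assumes c: "ctx \<Gamma>" and a: "has \<Gamma> a (El G)"
  shows "tru \<Gamma> (App (sing a) a)"
proof -
  note c1 = ctx_G[OF c]
  have "has (El G # \<Gamma>) (idT G (Var 0) (wkt a)) SetT"
    by (intro has_Id c1 has_G var_G c elem_wk a)
  from tru_beta[OF this a] show ?thesis
    using truI[OF has_Refl[OF c has_G[OF c] a]] by (simp add: singT_def)
qed

lemma fam_const: "ctx \<Gamma> \<Longrightarrow> has \<Gamma> P SetT \<Longrightarrow> fam \<Gamma> (Lam (wkt P))"
  by (intro has_const_fam has_G)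

lemma tru_const:
  "ctx \<Gamma> \<Longrightarrow> has \<Gamma> P SetT \<Longrightarrow> has \<Gamma> a (El G) \<Longrightarrow> tru \<Gamma> (App (Lam (wkt P)) a) \<longleftrightarrow> tru \<Gamma> P"
  using tru_beta[OF set_weaken[OF _ ctx_G], of \<Gamma> P a] by simp

end

text \<open>The cover rules are inhabited closed types, in the form to which the properties listed
  in \<open>ct_space\<close> evaluate at depth 0.\<close>

locale ctt_site = ctt_presite +
  assumes refl_rule: "\<exists>t. has [] t (Fun (famTy G) (Fun (El G) (Fun (El (App (Var (Suc 0)) (Var 0)))
      (El (cvr (Var (Suc 0)) (Var 2))))))"
    and trans_rule: "\<exists>t. has [] t (Fun (famTy G) (Fun (famTy G) (Fun (El G) (Fun (El (cvr (Var 0) (Var 2)))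
      (Fun (El (cov (Var 3) (Var 2))) (El (cvr (Var 2) (Var 3))))))))"
begin

lemma tru_refl:
  assumes c: "ctx \<Gamma>" and U: "fam \<Gamma> U" and a: "has \<Gamma> a (El G)" and u: "tru \<Gamma> (App U a)"
  shows "tru \<Gamma> (cvr a U)"
proof -
  obtain t where t: "has \<Gamma> t (Fun (famTy G) (Fun (El G) (Fun (El (App (Var (Suc 0)) (Var 0)))
      (El (cvr (Var (Suc 0)) (Var 2))))))"
    using refl_rule derivable_closed[OF _ c] by blast
  obtain u where u: "has \<Gamma> u (El (App U a))" using u by (auto simp: tru_def)
  note 1 = has_app[OF t U refl, simplified]
  note 2 = has_app[OF 1 a refl, simplified]
  show ?thesis using has_app[OF 2 u refl] by (auto intro: truI)
qed

lemma tru_trans: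
  assumes c: "ctx \<Gamma>" and U: "fam \<Gamma> U" and V: "fam \<Gamma> V" and a: "has \<Gamma> a (El G)"
    and u: "tru \<Gamma> (cvr a U)" and v: "tru \<Gamma> (cov U V)"
  shows "tru \<Gamma> (cvr a V)"
proof -
  obtain t where t: "has \<Gamma> t (Fun (famTy G) (Fun (famTy G) (Fun (El G) (Fun (El (cvr (Var 0) (Var 2)))
      (Fun (El (cov (Var 3) (Var 2))) (El (cvr (Var 2) (Var 3))))))))"
    using trans_rule derivable_closed[OF _ c] by blast
  obtain u v where u: "has \<Gamma> u (El (cvr a U))" and v: "has \<Gamma> v (El (cov U V))"
    using u v by (auto simp: tru_def)
  note 1 = has_app[OF t U refl, simplified]
  note 2 = has_app[OF 1 V refl, simplified]
  note 3 = has_app[OF 2 a refl, simplified]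
  note 4 = has_app[OF 3 u refl, simplified]
  show ?thesis using has_app[OF 4 v refl] by (auto intro: truI)
qed

lemma tru_meet_self:
  assumes c: "ctx \<Gamma>" and U: "fam \<Gamma> U" and a: "has \<Gamma> a (El G)" and u: "tru \<Gamma> (App U a)"
  shows "tru \<Gamma> (meet U a)"
  unfolding meetT_def
proof (rule tru_SigI[OF c has_G[OF c] has_meet_body[OF c U a] a])
  have "tru \<Gamma> (cvr a (sing a))"
    by (rule tru_refl[OF c fam_sing[OF c a] a tru_sing_self[OF c a]])
  then have "tru \<Gamma> (andT (App U a) (cvr a (sing a)))"
    by (rule tru_andI[OF c has_fam_app[OF U a] has_D[OF c a fam_sing[OF c a]] u])
  then show "tru \<Gamma> (sub_tm (one a) (andT (App (wkt U) (Var 0)) (cvr (wkt a) (sing (Var 0)))))" by simp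
qed

text \<open>As in set theory, \<open>a\<close> itself belongs to \<open>a \<down> U\<close>, which
  membership in the pseudocomplement covers by the empty set.\<close>

lemma tru_star_covered_by_empty:
  assumes c: "ctx \<Gamma>" and U: "fam \<Gamma> U" and a: "has \<Gamma> a (El G)"
    and s: "tru \<Gamma> (App (star U) a)" and u: "tru \<Gamma> (App U a)"
  shows "tru \<Gamma> (cvr a emptyT)"
proof (rule tru_covE[OF c fam_down[OF c fam_sing[OF c a] U] fam_empty[OF c] _ a])
  note S = fam_sing[OF c a]
  show "tru \<Gamma> (cov (down (sing a) U) emptyT)" using s by (simp add: tru_star[OF c U a])
  show "tru \<Gamma> (App (down (sing a) U) a)"
    unfolding tru_down[OF c S U a]
    by (rule tru_andI[OF c has_meet[OF c S a] has_meet[OF c U a] tru_meet_self[OF c S a tru_sing_self[OF c a]]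
          tru_meet_self[OF c U a u]])
qed

lemma tru_cvr_empty:
  assumes c: "ctx \<Gamma>" and a: "has \<Gamma> a (El G)" and V: "fam \<Gamma> V" and e: "tru \<Gamma> (cvr a emptyT)"
  shows "tru \<Gamma> (cvr a V)"
proof (rule tru_trans[OF c fam_empty[OF c] V a e tru_covI[OF c fam_empty[OF c] V]])
  note c1 = ctx_G[OF c]
  have c2: "ctx (El (App emptyT (Var 0)) # El G # \<Gamma>)" using ctx_cov_hyp[OF c fam_empty[OF c]] by simp
  have v1: "has (El (App emptyT (Var 0)) # El G # \<Gamma>) (Var (Suc 0)) (El G)"
    using has_VarSuc[OF c2 var_G[OF c]] by simp
  have "tru (El (App emptyT (Var 0)) # El G # \<Gamma>) (App emptyT (Var (Suc 0)))"
    using tru_hyp[OF c2] by simp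
  then have "tru (El (App emptyT (Var 0)) # El G # \<Gamma>) (Con CN0)"
    by (simp add: tru_empty[OF c2 v1])
  then show "tru (El (App (wkt emptyT) (Var 0)) # El G # \<Gamma>) (cvr (Var (Suc 0)) (wkt (wkt V)))"
    using tru_N0E[OF c2 has_D[OF c2 v1 fam_wk[OF fam_wk[OF V c1] c2]]] by simp
qed

end

section \<open>The uniformity rule trivialises compact De Morgan spaces\<close>

context ctt_site
begin

text \<open>Here \<open>Lam (wkt P)\<close> is the subset of all elements for which \<open>P\<close>
  holds. Any element of its meet with \<open>a\<close> comes with an element of that subset, hence
  with a proof of \<open>P\<close>, against the refutation.\<close>

lemma tru_star_of_refuted:
  assumes c: "ctx \<Gamma>" and P: "has \<Gamma> P SetT" and n: "tru \<Gamma> (impT P (Con CN0))" and a: "has \<Gamma> a (El G)"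
  shows "tru \<Gamma> (App (star (Lam (wkt P))) a)"
proof -
  let ?U = "Lam (wkt P)"
  note U = fam_const[OF c P] and S = fam_sing[OF c a]
  note dn = fam_down[OF c S U]
  have "tru \<Gamma> (cov (down (sing a) ?U) emptyT)"
  proof (rule tru_covI[OF c dn fam_empty[OF c]])
    note c1 = ctx_G[OF c] and c2 = ctx_cov_hyp[OF c dn]
    let ?D1 = "El G # \<Gamma>" and ?D2 = "El (App (wkt (down (sing a) ?U)) (Var 0)) # El G # \<Gamma>"
    note U2 = fam_wk[OF fam_wk[OF U c1] c2] and P2 = set_weaken[OF set_weaken[OF P c1] c2]
      and S2 = fam_wk[OF fam_wk[OF S c1] c2]
    have v1: "has ?D2 (Var (Suc 0)) (El G)" using has_VarSuc[OF c2 var_G[OF c]] by simp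
    have n2: "tru ?D2 (impT (wkt (wkt P)) (Con CN0))" using tru_weaken[OF tru_weaken[OF n c1] c2] by simp
    have "tru ?D2 (App (down (wkt (wkt (sing a))) (wkt (wkt ?U))) (Var (Suc 0)))"
      using tru_hyp[OF c2] by simp
    then have "tru ?D2 (andT (meet (wkt (wkt (sing a))) (Var (Suc 0))) (meet (wkt (wkt ?U)) (Var (Suc 0))))"
      by (simp add: tru_down[OF c2 S2 U2 v1] del: ren_space ren_tm.simps)
    then have m: "tru ?D2 (meet (wkt (wkt ?U)) (Var (Suc 0)))"
      by (rule tru_andE(2)[OF c2 has_meet[OF c2 S2 v1] has_meet[OF c2 U2 v1]])
    have "tru ?D2 (Con CN0)"
    proof (rule tru_SigE[OF c2 has_G[OF c2] has_meet_body[OF c2 U2 v1] CN0[OF c2] m[unfolded meetT_def]])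
      note c3 = ctx_G[OF c2]
      note U3 = fam_wk[OF U2 c3]
      let ?B = "andT (App (wkt (wkt (wkt ?U))) (Var 0)) (cvr (wkt (Var (Suc 0))) (sing (Var 0)))"
      have c4: "ctx (El ?B # El G # ?D2)" by (rule ctx_El[OF c3 has_meet_body[OF c2 U2 v1]])
      let ?D4 = "El ?B # El G # ?D2"
      have v4: "has ?D4 (Var (Suc 0)) (El G)" using has_VarSuc[OF c4 var_G[OF c2]] by simp
      have v4': "has ?D4 (wkt (wkt (Var (Suc 0)))) (El G)" by (rule elem_wk[OF elem_wk[OF v1 c3] c4])
      note U4 = fam_wk[OF U3 c4] and P4 = set_weaken[OF set_weaken[OF P2 c3] c4]
      have s4: "fam ?D4 (sing (Var (Suc 0)))" by (rule fam_sing[OF c4 v4])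
      have "tru ?D4 (wkt ?B)" by (rule tru_hyp[OF c4])
      then have "tru ?D4 (andT (App (wkt (wkt (wkt (wkt ?U)))) (Var (Suc 0)))
          (cvr (wkt (wkt (Var (Suc 0)))) (sing (Var (Suc 0)))))"
        by simp
      from tru_andE(1)[OF c4 has_fam_app[OF U4 v4] has_D[OF c4 v4' s4] this]
      have "tru ?D4 (App (Lam (wkt (wkt (wkt (wkt (wkt P)))))) (Var (Suc 0)))" by simp
      then have "tru ?D4 (wkt (wkt (wkt (wkt P))))" by (simp only: tru_const[OF c4 P4 v4])
      moreover have "tru ?D4 (impT (wkt (wkt (wkt (wkt P)))) (Con CN0))"
        using tru_weaken[OF tru_weaken[OF n2 c3] c4] by simp
      ultimately have "tru ?D4 (Con CN0)" using tru_impE[OF c4 P4 CN0[OF c4]] by blast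
      then show "tru ?D4 (wkt (wkt (Con CN0)))" by simp
    qed
    then show "tru ?D2 (cvr (Var (Suc 0)) (wkt (wkt emptyT)))"
      using tru_N0E[OF c2 has_D[OF c2 v1 fam_empty[OF c2]]] by simp
  qed
  then show ?thesis by (simp only: tru_star[OF c U a])
qed

text \<open>In the first case a refutation of \<open>P\<close> puts \<open>a\<close> into the
  pseudocomplement as well as into the double one; in the second a proof of \<open>P\<close> puts
  \<open>a\<close> into the subset as well as into its pseudocomplement. Either way \<open>a\<close>
  is covered by the empty set.\<close>

lemma tru_decision:
  assumes c: "ctx \<Gamma>" and P: "has \<Gamma> P SetT" and a: "has \<Gamma> a (El G)"
    and d: "tru \<Gamma> (plusT (App (star (star (Lam (wkt P)))) a) (App (star (Lam (wkt P))) a))"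
  shows "tru \<Gamma> (plusT (impT (impT P (Con CN0)) (cvr a emptyT)) (impT P (cvr a emptyT)))"
proof -
  let ?U = "Lam (wkt P)" and ?E = "cvr a emptyT"
  note U = fam_const[OF c P]
  note s1 = has_fam_app[OF fam_star[OF c fam_star[OF c U]] a] and s2 = has_fam_app[OF fam_star[OF c U] a]
  have hE: "has \<Gamma> ?E SetT" by (rule has_D[OF c a fam_empty[OF c]])
  have nP: "has \<Gamma> (impT P (Con CN0)) SetT" using has_imp[OF c P CN0[OF c]] by simp
  note t1 = has_imp[OF c nP hE] and t2 = has_imp[OF c P hE]
  show ?thesis
  proof (rule tru_PlusE[OF c s1 s2 has_Plus[OF c t1 t2] d])
    let ?D = "El (App (star (star ?U)) a) # \<Gamma>"
    note c1 = ctx_El[OF c s1]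
    note P1 = set_weaken[OF P c1] and nP1 = set_weaken[OF nP c1] and E1 = set_weaken[OF hE c1]
    have "tru ?D (impT (wkt (impT P (Con CN0))) (wkt ?E))"
    proof (rule tru_impI[OF c1 nP1 E1])
      note c2 = ctx_El[OF c1 nP1]
      let ?D2 = "El (wkt (impT P (Con CN0))) # ?D"
      have h: "tru ?D2 (App (star (star (Lam (wkt (wkt (wkt P)))))) (wkt (wkt a)))"
        using tru_weaken[OF tru_hyp[OF c1] c2] by simp
      have n: "tru ?D2 (impT (wkt (wkt P)) (Con CN0))" using tru_hyp[OF c2] by simp
      note P2 = set_weaken[OF P1 c2] and a2 = elem_wk[OF elem_wk[OF a c1] c2]
      have "tru ?D2 (cvr (wkt (wkt a)) emptyT)"
        by (rule tru_star_covered_by_empty[OF c2 fam_star[OF c2 fam_const[OF c2 P2]] a2 h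
              tru_star_of_refuted[OF c2 P2 n a2]])
      then show "tru ?D2 (wkt (wkt ?E))" by simp
    qed
    then show "tru ?D (wkt (plusT (impT (impT P (Con CN0)) ?E) (impT P ?E)))"
      using tru_PlusI1[OF c1 set_weaken[OF t1 c1] set_weaken[OF t2 c1]] by simp
  next
    let ?D = "El (App (star ?U) a) # \<Gamma>"
    note c1 = ctx_El[OF c s2]
    note P1 = set_weaken[OF P c1] and E1 = set_weaken[OF hE c1]
    have "tru ?D (impT (wkt P) (wkt ?E))"
    proof (rule tru_impI[OF c1 P1 E1])
      note c2 = ctx_El[OF c1 P1]
      let ?D2 = "El (wkt P) # ?D"
      have h: "tru ?D2 (App (star (Lam (wkt (wkt (wkt P))))) (wkt (wkt a)))"
        using tru_weaken[OF tru_hyp[OF c1] c2] by simp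
      note P2 = set_weaken[OF P1 c2] and a2 = elem_wk[OF elem_wk[OF a c1] c2]
      have "tru ?D2 (App (Lam (wkt (wkt (wkt P)))) (wkt (wkt a)))"
        using tru_hyp[OF c2] tru_const[OF c2 P2 a2] by blast
      from tru_star_covered_by_empty[OF c2 fam_const[OF c2 P2] a2 h this]
      show "tru ?D2 (wkt (wkt ?E))" by simp
    qed
    then show "tru ?D (wkt (plusT (impT (impT P (Con CN0)) ?E) (impT P ?E)))"
      using tru_PlusI2[OF c1 set_weaken[OF t1 c1] set_weaken[OF t2 c1]] by simp
  qed
qed

end

context ctt_gup
begin

text \<open>The code \<open>i\<close> is used through the proposition that it names: the first
  disjunct asserts it and the second refutes it.\<close>

definition tagT :: "'c tm \<Rightarrow> 'c tm \<Rightarrow> 'c tm \<Rightarrow> 'c tm" where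
  "tagT P E i = plusT (andT (App (Con CT) i) (impT (impT P (Con CN0)) E))
     (andT (impT (App (Con CT) i) (Con CN0)) (impT P E))"

lemma tagT_subst [simp]:
  "ren_tm r (tagT P E i) = tagT (ren_tm r P) (ren_tm r E) (ren_tm r i)"
  "sub_tm s (tagT P E i) = tagT (sub_tm s P) (sub_tm s E) (sub_tm s i)"
  by (simp_all add: tagT_def)

lemma has_not: "ctx \<Gamma> \<Longrightarrow> has \<Gamma> P SetT \<Longrightarrow> has \<Gamma> (impT P (Con CN0)) SetT"
  by (intro has_imp CN0)

lemma has_tag:
  "ctx \<Gamma> \<Longrightarrow> has \<Gamma> P SetT \<Longrightarrow> has \<Gamma> E SetT \<Longrightarrow> has \<Gamma> i (El (Con CU)) \<Longrightarrow> has \<Gamma> (tagT P E i) SetT"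
  unfolding tagT_def by (intro has_Plus has_and has_imp has_not has_T)

text \<open>The uniformity rule for the index set \<open>U\<close>: the code \<open>N\<^sub>1\<close> marks the first disjunct and the
  code \<open>N\<^sub>0\<close> the second, so that no disjointness of the constructors of a sum is needed.\<close>

lemma tru_uniform_decision:
  assumes c: "ctx \<Gamma>" and E: "has \<Gamma> E SetT"
    and d: "tru (SetT # \<Gamma>) (plusT (impT (impT (Var 0) (Con CN0)) (wkt E)) (impT (Var 0) (wkt E)))"
  shows "tru \<Gamma> E"
proof -
  let ?G = "SetT # \<Gamma>"
  note c1 = ctx_SetT[OF c]
  note E1 = set_weaken[OF E c1]
  have v: "has ?G (Var 0) SetT" using has_Var0[OF c1] by simp
  note t1 = has_imp[OF c1 has_not[OF c1 v] E1] and t2 = has_imp[OF c1 v E1]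
  have wU: "wkt (Con CU) = Con CU" by simp
  have c2: "ctx (El (Con CU) # ?G)" by (rule ctx_El[OF c1 CU[OF c1]])
  have i2: "has (El (Con CU) # ?G) (Var 0) (El (Con CU))" using has_Var0_El[OF c2] by simp
  have R: "has (El (Con CU) # ?G) (tagT (Var (Suc 0)) (wkt (wkt E)) (Var 0)) SetT"
    by (rule has_tag[OF c2 _ set_weaken[OF E1 c2] i2]) (use set_weaken[OF v c2] in simp)
  note S = has_Sig[OF c1 CU[OF c1] derivable.lam[OF R]]
  have w: "tru ?G (sigB (Con CU) (Lam (tagT (Var (Suc 0)) (wkt (wkt E)) (Var 0))))"
  proof (rule tru_PlusE[OF c1 t1 t2 S d])
    let ?A = "impT (impT (Var 0) (Con CN0)) (wkt E)"
    note k = ctx_El[OF c1 t1]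
    have h: "tru (El ?A # ?G) (impT (impT (Var (Suc 0)) (Con CN0)) (wkt (wkt E)))" using tru_hyp[OF k] by simp
    have v': "has (El ?A # ?G) (Var (Suc 0)) SetT" using set_weaken[OF v k] by simp
    note E' = set_weaken[OF E1 k]
    note T = has_T[OF k CodeN1[OF k]]
    have "tru (El ?A # ?G) (tagT (Var (Suc 0)) (wkt (wkt E)) (Con CodeN1))"
      unfolding tagT_def
      by (rule tru_PlusI1[OF k has_and[OF k T has_imp[OF k has_not[OF k v'] E']]
            has_and[OF k has_not[OF k T] has_imp[OF k v' E']]
            tru_andI[OF k T has_imp[OF k has_not[OF k v'] E'] tru_conv[OF tru_N1[OF k] derivable.tm_sym[OF eqt_T_CodeN1[OF k]]]]])
        (use h in simp)
    then show "tru (El ?A # ?G) (wkt (sigB (Con CU) (Lam (tagT (Var (Suc 0)) (wkt (wkt E)) (Var 0)))))"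
      using tru_SigI[OF k CU[OF k] has_tag[OF ctx_El[OF k CU[OF k]]], of "Var (Suc (Suc 0))" "wkt (wkt (wkt E))" "Var 0" "Con CodeN1"]
        set_weaken[OF v' ctx_El[OF k CU[OF k]]] set_weaken[OF E' ctx_El[OF k CU[OF k]]]
        has_Var0_El[OF ctx_El[OF k CU[OF k]]] CodeN1[OF k]
      by simp
  next
    let ?A = "impT (Var 0) (wkt E)"
    note k = ctx_El[OF c1 t2]
    have h: "tru (El ?A # ?G) (impT (Var (Suc 0)) (wkt (wkt E)))" using tru_hyp[OF k] by simp
    have v': "has (El ?A # ?G) (Var (Suc 0)) SetT" using set_weaken[OF v k] by simp
    note E' = set_weaken[OF E1 k]
    note T = has_T[OF k CodeN0[OF k]]
    have n: "tru (El ?A # ?G) (impT (App (Con CT) (Con CodeN0)) (Con CN0))"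
    proof -
      note kk = ctx_El[OF k T]
      have "tru (El (App (Con CT) (Con CodeN0)) # El ?A # ?G) (Con CN0)"
        using tru_conv[OF tru_hyp[OF kk]] eqt_T_CodeN0[OF kk] by simp
      then show ?thesis using tru_impI[OF k T CN0[OF k]] by simp
    qed
    have "tru (El ?A # ?G) (tagT (Var (Suc 0)) (wkt (wkt E)) (Con CodeN0))"
      unfolding tagT_def
      by (rule tru_PlusI2[OF k has_and[OF k T has_imp[OF k has_not[OF k v'] E']]
            has_and[OF k has_not[OF k T] has_imp[OF k v' E']]
            tru_andI[OF k has_not[OF k T] has_imp[OF k v' E'] n h]])
    then show "tru (El ?A # ?G) (wkt (sigB (Con CU) (Lam (tagT (Var (Suc 0)) (wkt (wkt E)) (Var 0)))))"
      using tru_SigI[OF k CU[OF k] has_tag[OF ctx_El[OF k CU[OF k]]], of "Var (Suc (Suc 0))" "wkt (wkt (wkt E))" "Var 0" "Con CodeN0"]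
        set_weaken[OF v' ctx_El[OF k CU[OF k]]] set_weaken[OF E' ctx_El[OF k CU[OF k]]]
        has_Var0_El[OF ctx_El[OF k CU[OF k]]] CodeN0[OF k]
      by simp
  qed
  obtain i where i: "has \<Gamma> i (El (Con CU))" and t: "tru ?G (tagT (Var 0) (wkt E) (wkt i))"
    using gup_sigma[OF c CU[OF c], unfolded wU, OF R w] by auto
  \<comment> \<open>Uniformity made \<open>i\<close> independent of the proposition variable, so any
    \<open>P\<close> may now be substituted while \<open>i\<close> stays.\<close>
  have tag: "tru \<Gamma> (tagT P E i)" if "has \<Gamma> P SetT" for P
  proof -
    obtain u where "has ?G u (El (tagT (Var 0) (wkt E) (wkt i)))" using t by (auto simp: tru_def)
    from derivable_one[OF this that c] show ?thesis by (auto intro: truI)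
  qed
  note T = has_T[OF c i]
  have hyps: "has \<Gamma> (andT (App (Con CT) i) (impT (impT P (Con CN0)) E)) SetT"
    "has \<Gamma> (andT (impT (App (Con CT) i) (Con CN0)) (impT P E)) SetT" if "has \<Gamma> P SetT" for P
    by (intro has_and has_imp has_not T c E that)+
  note N0 = CN0[OF c] and N1 = CN1[OF c]
  \<comment> \<open>For the true proposition \<open>CN1\<close> the second disjunct gives
    \<open>E\<close> at once. In the first the tag holds, which excludes the second disjunct for
    \<open>CN0\<close>; its first disjunct gives \<open>E\<close>, as \<open>CN0\<close> is
    refuted.\<close>
  show ?thesis
  proof (rule tru_PlusE[OF c hyps(1)[OF N1] hyps(2)[OF N1] E tag[OF N1, unfolded tagT_def]])
    let ?D = "El (andT (App (Con CT) i) (impT (impT (Con CN1) (Con CN0)) E)) # \<Gamma>"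
    note k = ctx_El[OF c hyps(1)[OF N1]]
    note Tk = set_weaken[OF T k] and Ek = set_weaken[OF E k]
    have Ti: "tru ?D (wkt (App (Con CT) i))"
      using tru_andE(1)[OF c T has_imp[OF c has_not[OF c N1] E]] tru_hyp[OF k]
        tru_andE(1)[OF k Tk has_imp[OF k has_not[OF k CN1[OF k]] Ek]] by simp
    have P0: "tru ?D (wkt (tagT (Con CN0) E i))" by (rule tru_weaken[OF tag[OF N0] k])
    show "tru ?D (wkt E)"
    proof (rule tru_PlusE[OF k set_weaken[OF hyps(1)[OF N0] k] set_weaken[OF hyps(2)[OF N0] k] Ek])
      show "tru ?D (plusT (wkt (andT (App (Con CT) i) (impT (impT (Con CN0) (Con CN0)) E)))
          (wkt (andT (impT (App (Con CT) i) (Con CN0)) (impT (Con CN0) E))))"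
        using P0 by (simp add: tagT_def)
    next
      let ?B = "wkt (andT (App (Con CT) i) (impT (impT (Con CN0) (Con CN0)) E))"
      note l = ctx_El[OF k set_weaken[OF hyps(1)[OF N0] k]]
      note Tl = set_weaken[OF Tk l] and El = set_weaken[OF Ek l]
      have nn: "tru (El ?B # ?D) (impT (Con CN0) (Con CN0))"
        using tru_impI[OF l CN0[OF l] CN0[OF l]] tru_hyp[OF ctx_El[OF l CN0[OF l]]] by simp
      have "tru (El ?B # ?D) (impT (impT (Con CN0) (Con CN0)) (wkt (wkt E)))"
        using tru_hyp[OF l] tru_andE(2)[OF l Tl has_imp[OF l has_not[OF l CN0[OF l]] El]] by simp
      then show "tru (El ?B # ?D) (wkt (wkt E))"
        using tru_impE[OF l has_not[OF l CN0[OF l]] El _ nn] by simp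
    next
      let ?B = "wkt (andT (impT (App (Con CT) i) (Con CN0)) (impT (Con CN0) E))"
      note l = ctx_El[OF k set_weaken[OF hyps(2)[OF N0] k]]
      note Tl = set_weaken[OF Tk l] and El = set_weaken[OF Ek l]
      have "tru (El ?B # ?D) (impT (wkt (wkt (App (Con CT) i))) (Con CN0))"
        using tru_hyp[OF l] tru_andE(1)[OF l has_not[OF l Tl] has_imp[OF l CN0[OF l] El]] by simp
      then have "tru (El ?B # ?D) (Con CN0)"
        by (rule tru_impE[OF l Tl CN0[OF l] _ tru_weaken[OF Ti l]])
      then show "tru (El ?B # ?D) (wkt (wkt E))" by (rule tru_N0E[OF l El])
    qed
  next
    let ?D = "El (andT (impT (App (Con CT) i) (Con CN0)) (impT (Con CN1) E)) # \<Gamma>"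
    note k = ctx_El[OF c hyps(2)[OF N1]]
    note Tk = set_weaken[OF T k] and Ek = set_weaken[OF E k]
    have "tru ?D (impT (Con CN1) (wkt E))"
      using tru_hyp[OF k] tru_andE(2)[OF k has_not[OF k Tk] has_imp[OF k CN1[OF k] Ek]] by simp
    then show "tru ?D (wkt E)" by (rule tru_impE[OF k CN1[OF k] Ek _ tru_N1[OF k]])
  qed
qed

end

section \<open>Finite subsets in type theory\<close>

definition finT :: "'c tm \<Rightarrow> 'c tm" where
  "finT n = App (Con CT) (App (App (App (App (Con CNatrec) (Lam (Con CU))) (Con CodeN0))
     (Lam (Lam (App (App (Con CodePlus) (Var 0)) (Con CodeN1))))) n)"
definition rangeT :: "'c tm \<Rightarrow> 'c tm \<Rightarrow> 'c tm \<Rightarrow> 'c tm" where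
  "rangeT G n g = Lam (sigB (finT (wkt n)) (Lam (idT G (Var (Suc 0))
     (App (App (App (App (Con CAp) (finT (wkt (wkt n)))) (Lam G)) (wkt (wkt g))) (Var 0)))))"
definition subcoverT :: "'c tm \<Rightarrow> 'c tm \<Rightarrow> 'c tm \<Rightarrow> 'c tm \<Rightarrow> 'c tm \<Rightarrow> 'c tm" where
  "subcoverT G D U n g = andT (piB G (Lam (impT (App (wkt (rangeT G n g)) (Var 0)) (App (wkt U) (Var 0)))))
     (covT G D wholeT (rangeT G n g))"
definition imageT :: "'c tm \<Rightarrow> 'c tm \<Rightarrow> 'c tm \<Rightarrow> 'c tm" where
  "imageT S f U = Lam (sigB S (Lam (andT (App (wkt (wkt U)) (Var 0)) (App (App f (Var 0)) (Var (Suc 0))))))"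

lemma finT_subst [simp]: "ren_tm r (finT n) = finT (ren_tm r n)" "sub_tm s (finT n) = finT (sub_tm s n)"
  by (simp_all add: finT_def)

context ctt
begin

text \<open>The motive of the recursion is the constant family of codes, so the types come as
  redexes \<open>App ?C t\<close> that are converted to the universe.\<close>

lemma has_finT:
  assumes c: "ctx \<Gamma>" and n: "has \<Gamma> n (El (Con CN))"
  shows "has \<Gamma> (finT n) SetT"
proof -
  let ?C = "Lam (Con CU) :: 'c tm"
  have red: "eqt \<Delta> (App ?C t) (Con CU) SetT" if "ctx \<Delta>" "has \<Delta> t (El (Con CN))" for \<Delta> t
    using eqt_const_fam[OF that(1) CN[OF that(1)] CU[OF that(1)] that(2)] by simp
  have fam: "has \<Delta> ?C (famTy (Con CN))" if "ctx \<Delta>" for \<Delta>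
    using has_const_fam[OF that CN[OF that] CU[OF that]] by simp
  note N = CN[OF c]
  have c1: "ctx (El (Con CN) # \<Gamma>)" by (rule ctx_El[OF c N])
  have v1: "has (El (Con CN) # \<Gamma>) (Var 0) (El (Con CN))" using has_Var0_El[OF c1] by simp
  have Q: "has (El (Con CN) # \<Gamma>) (App ?C (Var 0)) SetT" by (rule has_fam_app[OF fam[OF c1] v1])
  have c2: "ctx (El (App ?C (Var 0)) # El (Con CN) # \<Gamma>)" by (rule ctx_El[OF c1 Q])
  let ?G2 = "El (App ?C (Var 0)) # El (Con CN) # \<Gamma>"
  have v2: "has ?G2 (Var (Suc 0)) (El (Con CN))" using has_VarSuc[OF c2 v1] by simp
  have "has ?G2 (Var 0) (El (App ?C (Var (Suc 0))))" using has_Var0_El[OF c2] by simp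
  then have "has ?G2 (Var 0) (El (Con CU))" by (rule has_conv[OF _ red[OF c2 v2]])
  then have "has ?G2 (App (App (Con CodePlus) (Var 0)) (Con CodeN1)) (El (Con CU))"
    by (rule has_CodePlus[OF c2 _ CodeN1[OF c2]])
  then have "has ?G2 (App (App (Con CodePlus) (Var 0)) (Con CodeN1)) (El (App ?C (App (Con CSucc) (Var (Suc 0)))))"
    by (rule has_conv_sym[OF _ red[OF c2 has_Succ[OF c2 v2]]])
  then have f: "has \<Gamma> (Lam (Lam (App (App (Con CodePlus) (Var 0)) (Con CodeN1))))
      (Fun (El (Con CN)) (Fun (El (App (wkt ?C) (Var 0))) (El (App (wkt (wkt ?C)) (App (Con CSucc) (Var (Suc 0)))))))"
    by (simp add: derivable.lam)
  have z: "has \<Gamma> (Con CodeN0) (El (App ?C (Con CZero)))"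
    by (rule has_conv_sym[OF CodeN0[OF c] red[OF c CZero[OF c]]])
  show ?thesis
    unfolding finT_def
    by (rule has_T[OF c has_conv[OF has_Natrec[OF c fam[OF c] z f n] red[OF c n]]])
qed

end

context ctt_presite
begin

lemma range_subst [simp]:
  "ren_tm r (rangeT G n g) = rangeT G (ren_tm r n) (ren_tm r g)"
  "sub_tm s (rangeT G n g) = rangeT G (sub_tm s n) (sub_tm s g)"
  by (simp_all add: rangeT_def)

lemma subcover_subst [simp]:
  "ren_tm r (subcoverT G D U n g) = subcoverT G D (ren_tm r U) (ren_tm r n) (ren_tm r g)"
  "sub_tm s (subcoverT G D U n g) = subcoverT G D (sub_tm s U) (sub_tm s n) (sub_tm s g)"
  by (simp_all add: subcoverT_def)

abbreviation tupleT :: "'c tm \<Rightarrow> 'c tm" where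
  "tupleT n \<equiv> piB (finT n) (Lam G)"

lemma has_tuple: "ctx \<Gamma> \<Longrightarrow> has \<Gamma> n (El (Con CN)) \<Longrightarrow> has \<Gamma> (tupleT n) SetT"
  using has_imp[OF _ has_finT has_G, of \<Gamma> n] by simp

lemma has_value:
  assumes c: "ctx \<Gamma>" and n: "has \<Gamma> n (El (Con CN))" and g: "has \<Gamma> g (El (tupleT n))" and i: "has \<Gamma> i (El (finT n))"
  shows "has \<Gamma> (App (App (App (App (Con CAp) (finT n)) (Lam G)) g) i) (El G)"
proof -
  note F = has_finT[OF c n]
  have fam: "has \<Gamma> (Lam G) (famTy (finT n))" using has_const_fam[OF c F has_G[OF c]] by simp
  have "eqt \<Gamma> (App (Lam G) i) G SetT" using eqt_const_fam[OF c F has_G[OF c] i] by simp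
  then show ?thesis by (rule has_conv[OF has_Ap[OF c F fam g i]])
qed

lemma fam_range:
  assumes c: "ctx \<Gamma>" and n: "has \<Gamma> n (El (Con CN))" and g: "has \<Gamma> g (El (tupleT n))"
  shows "fam \<Gamma> (rangeT G n g)"
proof -
  note c1 = ctx_G[OF c]
  have n1: "has (El G # \<Gamma>) (wkt n) (El (Con CN))" using has_weaken[OF n c1] by simp
  have g1: "has (El G # \<Gamma>) (wkt g) (El (tupleT (wkt n)))" using has_weaken[OF g c1] by simp
  note F1 = has_finT[OF c1 n1]
  note c2 = ctx_El[OF c1 F1]
  let ?G2 = "El (finT (wkt n)) # El G # \<Gamma>"
  have n2: "has ?G2 (wkt (wkt n)) (El (Con CN))" using has_weaken[OF n1 c2] by simp
  have g2: "has ?G2 (wkt (wkt g)) (El (tupleT (wkt (wkt n))))" using has_weaken[OF g1 c2] by simp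
  have i2: "has ?G2 (Var 0) (El (finT (wkt (wkt n))))" using has_Var0_El[OF c2] by simp
  have x2: "has ?G2 (Var (Suc 0)) (El G)" using has_VarSuc[OF c2 var_G[OF c]] by simp
  show ?thesis
    unfolding rangeT_def
    by (rule fam_Lam[OF c has_Sig[OF c1 F1 derivable.lam[OF has_Id[OF c2 has_G[OF c2] x2 has_value[OF c2 n2 g2 i2]]]]])
qed

lemma has_inclusion_body:
  "ctx \<Gamma> \<Longrightarrow> fam \<Gamma> U \<Longrightarrow> fam \<Gamma> V \<Longrightarrow> has (El G # \<Gamma>) (impT (App (wkt V) (Var 0)) (App (wkt U) (Var 0))) SetT"
  by (intro has_imp ctx_G has_fam_app[where P = G] fam_wk var_G)

lemma has_inclusion:
  "ctx \<Gamma> \<Longrightarrow> fam \<Gamma> U \<Longrightarrow> fam \<Gamma> V \<Longrightarrow> has \<Gamma> (piB G (Lam (impT (App (wkt V) (Var 0)) (App (wkt U) (Var 0))))) SetT"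
  by (intro has_Pi has_G derivable.lam has_inclusion_body)

lemma has_subcover:
  assumes "ctx \<Gamma>" and "fam \<Gamma> U" and "has \<Gamma> n (El (Con CN))" and "has \<Gamma> g (El (tupleT n))"
  shows "has \<Gamma> (subcoverT G D U n g) SetT"
  unfolding subcoverT_def
  by (rule has_and[OF assms(1) has_inclusion[OF assms(1,2) fam_range[OF assms(1,3,4)]]
        has_cov[OF assms(1) fam_whole[OF assms(1)] fam_range[OF assms(1,3,4)]]])

end

section \<open>The argument for a compact De Morgan space\<close>

locale ctt_compact_de_morgan = ctt_site + ctt_gup +
  assumes de_morgan_rule: "\<exists>t. has [] t (Fun (famTy G) (El (cov wholeT (cupT (star (star (Var 0))) (star (Var 0))))))"
    and compact_rule: "\<exists>t. has [] t (Fun (famTy G) (Fun (El (cov wholeT (Var 0)))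
      (El (sigB (Con CN) (Lam (sigB (tupleT (Var 0)) (Lam (subcoverT G D (Var 3) (Var (Suc 0)) (Var 0)))))))))"
begin

lemma tru_de_morgan:
  assumes c: "ctx \<Gamma>" and U: "fam \<Gamma> U"
  shows "tru \<Gamma> (cov wholeT (cupT (star (star U)) (star U)))"
proof -
  obtain t where "has \<Gamma> t (Fun (famTy G) (El (cov wholeT (cupT (star (star (Var 0))) (star (Var 0))))))"
    using de_morgan_rule derivable_closed[OF _ c] by blast
  from has_app[OF this U refl] show ?thesis by (auto intro: truI)
qed

lemma tru_compact:
  assumes c: "ctx \<Gamma>" and U: "fam \<Gamma> U" and t: "tru \<Gamma> (cov wholeT U)"
  shows "tru \<Gamma> (sigB (Con CN) (Lam (sigB (tupleT (Var 0)) (Lam (subcoverT G D (wkt (wkt U)) (Var (Suc 0)) (Var 0))))))"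
proof -
  obtain r where r: "has \<Gamma> r (Fun (famTy G) (Fun (El (cov wholeT (Var 0)))
      (El (sigB (Con CN) (Lam (sigB (tupleT (Var 0)) (Lam (subcoverT G D (Var 3) (Var (Suc 0)) (Var 0)))))))))"
    using compact_rule derivable_closed[OF _ c] by blast
  obtain t where t: "has \<Gamma> t (El (cov wholeT U))" using t by (auto simp: tru_def)
  note 1 = has_app[OF r U refl, simplified]
  show ?thesis using has_app[OF 1 t refl] by (auto intro: truI)
qed

lemma tru_instance: "tru (SetT # \<Gamma>) Q \<Longrightarrow> ctx \<Gamma> \<Longrightarrow> has \<Gamma> P SetT \<Longrightarrow> tru \<Gamma> (sub_tm (one P) Q)"
  unfolding tru_def using derivable_one[of SetT \<Gamma> "HasTy _ (El Q)" P] by fastforce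

text \<open>The uniformity lemmas expect the variable proposition at the head of the context, so
  further assumptions are inserted below it.\<close>

lemma tru_weaken_under:
  "tru (SetT # \<Gamma>) Q \<Longrightarrow> ctx (X # \<Gamma>) \<Longrightarrow> tru (SetT # X # \<Gamma>) (ren_tm (up Suc) Q)"
  unfolding tru_def using derivable_weaken_under[of SetT \<Gamma> "HasTy _ (El Q)" X] ctx_SetT
  by (fastforce simp: sub_up_Suc)

text \<open>Compactness gives a sum over \<open>n\<close> and over tuples \<open>g\<close>. Fixing
  \<open>n\<close> uniformly first makes the tuples a set that no longer mentions the proposition,
  and uniformity applies to it in turn; \<open>V\<close> is the range of the resulting closed
  \<open>g\<close>.\<close>

lemma uniform_finite_cover:
  obtains V where "fam [] V" and "tru [] (cov wholeT V)"
    and "tru [SetT] (piB G (Lam (impT (App (wkt (wkt V)) (Var 0))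
      (App (cupT (star (star (Lam (Var 2)))) (star (Lam (Var 2)))) (Var 0)))))"
proof -
  let ?K = "cupT (star (star (Lam (Var (Suc 0))))) (star (Lam (Var (Suc 0))))"
  note c0 = ctx_Nil and c1 = ctx_SetT[OF ctx_Nil]
  have v: "has [SetT] (Var 0) SetT" using has_Var0[OF c1] by simp
  have U: "fam [SetT] (Lam (Var (Suc 0)))" using fam_const[OF c1 v] by simp
  have K: "fam [SetT] ?K" by (intro fam_cup fam_star c1 U)
  have t: "tru [SetT] (sigB (Con CN) (Lam (sigB (tupleT (Var 0)) (Lam (subcoverT G D (wkt (wkt ?K)) (Var (Suc 0)) (Var 0))))))"
    by (rule tru_compact[OF c1 K tru_de_morgan[OF c1 U]])
  have c2: "ctx [El (Con CN), SetT]" by (rule ctx_El[OF c1 CN[OF c1]])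
  have n2: "has [El (Con CN), SetT] (Var 0) (El (Con CN))" using has_Var0_El[OF c2] by simp
  note T2 = has_tuple[OF c2 n2]
  have c3: "ctx [El (tupleT (Var 0)), El (Con CN), SetT]" by (rule ctx_El[OF c2 T2])
  have n3: "has [El (tupleT (Var 0)), El (Con CN), SetT] (Var (Suc 0)) (El (Con CN))"
    using has_VarSuc[OF c3 n2] by simp
  have g3: "has [El (tupleT (Var 0)), El (Con CN), SetT] (Var 0) (El (tupleT (Var (Suc 0))))"
    using has_Var0_El[OF c3] by simp
  have R: "has [El (wkt (Con CN)), SetT]
      (sigB (tupleT (Var 0)) (Lam (subcoverT G D (wkt (wkt ?K)) (Var (Suc 0)) (Var 0)))) SetT"
    using has_Sig[OF c2 T2 derivable.lam[OF has_subcover[OF c3 fam_wk[OF fam_wk[OF K c2] c3] n3 g3]]] by simp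
  obtain n where n: "has [] n (El (Con CN))"
    and tn: "tru [SetT] (sub_tm (one (wkt n)) (sigB (tupleT (Var 0)) (Lam (subcoverT G D (wkt (wkt ?K)) (Var (Suc 0)) (Var 0)))))"
    using gup_sigma[OF c0 CN[OF c0] R] t by auto
  have tn: "tru [SetT] (sigB (wkt (tupleT n)) (Lam (subcoverT G D (wkt ?K) (wkt (wkt n)) (Var 0))))"
    using tn by simp
  have n1: "has [SetT] (wkt n) (El (Con CN))" using has_weaken[OF n c1] by simp
  note T = has_tuple[OF c0 n]
  note T1 = set_weaken[OF T c1]
  have d2: "ctx [El (wkt (tupleT n)), SetT]" by (rule ctx_El[OF c1 T1])
  have m2: "has [El (wkt (tupleT n)), SetT] (wkt (wkt n)) (El (Con CN))" using has_weaken[OF n1 d2] by simp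
  have h2: "has [El (wkt (tupleT n)), SetT] (Var 0) (El (tupleT (wkt (wkt n))))" using has_Var0_El[OF d2] by simp
  have R': "has [El (wkt (tupleT n)), SetT] (subcoverT G D (wkt ?K) (wkt (wkt n)) (Var 0)) SetT"
    by (rule has_subcover[OF d2 fam_wk[OF K d2] m2 h2])
  obtain g where g: "has [] g (El (tupleT n))"
    and tg: "tru [SetT] (sub_tm (one (wkt g)) (subcoverT G D (wkt ?K) (wkt (wkt n)) (Var 0)))"
    using gup_sigma[OF c0 T R' tn] by blast
  let ?V = "rangeT G n g"
  have V: "fam [] ?V" by (rule fam_range[OF c0 n g])
  note V1 = fam_wk[OF V c1]
  have tg: "tru [SetT] (andT (piB G (Lam (impT (App (wkt (wkt ?V)) (Var 0)) (App (wkt ?K) (Var 0))))) (cov wholeT (wkt ?V)))"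
    using tg by (simp add: subcoverT_def)
  note ands = tru_andE[OF c1 has_inclusion[OF c1 K V1] has_cov[OF c1 fam_whole[OF c1] V1] tg]
  \<comment> \<open>The statement does not mention the proposition, so an arbitrary instance, here
    \<open>CN0\<close>, removes it from the context.\<close>
  have "tru [] (cov wholeT ?V)" using tru_instance[OF ands(2) c0 CN0[OF c0]] by simp
  moreover have "tru [SetT] (piB G (Lam (impT (App (wkt (wkt ?V)) (Var 0))
      (App (cupT (star (star (Lam (Var 2)))) (star (Lam (Var 2)))) (Var 0)))))"
    using ands(1) by (simp add: numeral_2_eq_2)
  ultimately show ?thesis using V that by blast
qed

lemma tru_trivial: "tru [] (cov wholeT emptyT)"
proof -
  obtain V where V: "fam [] V" and wV: "tru [] (cov wholeT V)"
    and inc: "tru [SetT] (piB G (Lam (impT (App (wkt (wkt V)) (Var 0))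
      (App (cupT (star (star (Lam (Var 2)))) (star (Lam (Var 2)))) (Var 0)))))"
    by (rule uniform_finite_cover)
  note c0 = ctx_Nil
  note c1 = ctx_G[OF c0] and c2 = ctx_cov_hyp[OF c0 V]
  \<comment> \<open>An element of \<open>V\<close> is fixed before the proposition, so that the
    context ends with \<open>SetT\<close> when uniformity is applied to the disjunction.\<close>
  let ?G2 = "[El (App (wkt V) (Var 0)), El G]"
  note c3 = ctx_SetT[OF c2]
  let ?G3 = "SetT # ?G2"
  let ?U = "Lam (wkt (Var 0))"
  have v2: "has ?G2 (Var (Suc 0)) (El G)" using has_VarSuc[OF c2 var_G[OF c0]] by simp
  have v3: "has ?G3 (Var 2) (El G)" using has_VarSuc[OF c3 v2] by (simp add: numeral_2_eq_2)
  have p3: "has ?G3 (Var 0) SetT" using has_Var0[OF c3] by simp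
  note U3 = fam_const[OF c3 p3]
  note S1 = fam_star[OF c3 fam_star[OF c3 U3]] and S2 = fam_star[OF c3 U3]
  have V3: "fam ?G3 (wkt (wkt (wkt V)))" by (rule fam_wk[OF fam_wk[OF fam_wk[OF V c1] c2] c3])
  have "tru ?G3 (ren_tm (up Suc) (ren_tm (up Suc) (piB G (Lam (impT (App (wkt (wkt V)) (Var 0))
      (App (cupT (star (star (Lam (Var 2)))) (star (Lam (Var 2)))) (Var 0)))))))"
    by (rule tru_weaken_under[OF tru_weaken_under[OF inc c1] c2])
  then have "tru ?G3 (piB G (Lam (impT (App (wkt (wkt (wkt (wkt V)))) (Var 0))
      (App (wkt (cupT (star (star ?U)) (star ?U))) (Var 0)))))"
    by (simp add: numeral_2_eq_2)
  from tru_PiE[OF c3 has_G[OF c3] has_inclusion_body[OF c3 fam_cup[OF c3 S1 S2] V3] this v3]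
  have "tru ?G3 (impT (App (wkt (wkt (wkt V))) (Var 2)) (App (cupT (star (star ?U)) (star ?U)) (Var 2)))"
    by simp
  moreover have "tru ?G3 (App (wkt (wkt (wkt V))) (Var 2))"
    using tru_weaken[OF tru_hyp[OF c2] c3] by (simp add: numeral_2_eq_2)
  ultimately have "tru ?G3 (App (cupT (star (star ?U)) (star ?U)) (Var 2))"
    by (rule tru_impE[OF c3 has_fam_app[OF V3 v3] has_fam_app[OF fam_cup[OF c3 S1 S2] v3]])
  then have "tru ?G3 (plusT (App (star (star ?U)) (Var 2)) (App (star ?U) (Var 2)))"
    by (simp only: tru_cup[OF c3 S1 S2 v3])
  from tru_decision[OF c3 p3 v3 this]
  have "tru ?G3 (plusT (impT (impT (Var 0) (Con CN0)) (wkt (cvr (Var (Suc 0)) emptyT)))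
      (impT (Var 0) (wkt (cvr (Var (Suc 0)) emptyT))))"
    by (simp add: numeral_2_eq_2)
  then have "tru ?G2 (cvr (Var (Suc 0)) emptyT)"
    by (rule tru_uniform_decision[OF c2 has_D[OF c2 v2 fam_empty[OF c2]]])
  then have Ve: "tru [] (cov V emptyT)"
    by (intro tru_covI[OF c0 V fam_empty[OF c0]]) simp
  show ?thesis
  proof (rule tru_covI[OF c0 fam_whole[OF c0] fam_empty[OF c0]])
    let ?H = "[El (App (wkt wholeT) (Var 0)), El G]"
    have k: "ctx ?H" using ctx_cov_hyp[OF c0 fam_whole[OF c0]] by simp
    have vk: "has ?H (Var (Suc 0)) (El G)" using has_VarSuc[OF k var_G[OF c0]] by simp
    have Vk: "fam ?H V" using derivable_closed[OF V k] .
    have "tru ?H (cov wholeT V)" "tru ?H (cov V emptyT)"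
      using wV Ve derivable_closed[OF _ k] by (auto simp: tru_def)
    then show "tru ?H (cvr (Var (Suc 0)) (wkt (wkt emptyT)))"
      using tru_trans[OF k Vk fam_empty[OF k] vk tru_covE[OF k fam_whole[OF k] Vk _ vk tru_whole[OF k vk]]]
      by simp
  qed
qed

end

section \<open>Surjections and the main theorem\<close>

lemma derivable_mono: "derivable A \<Gamma> J \<Longrightarrow> A \<subseteq> B \<Longrightarrow> derivable B \<Gamma> J"
proof (induction rule: derivable.induct)
  case (axiom \<Gamma> J)
  then show ?case by (blast intro: derivable.axiom)
next
  case (subst \<Gamma> J \<Delta> s)
  then show ?case by (intro derivable.subst[where \<Gamma> = \<Gamma>]) auto
next
  case (app \<Gamma> f X Y a)
  then show ?case by (intro derivable.app[where X = X]) auto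
next
  case (app_eq \<Gamma> f g X Y a b)
  then show ?case by (intro derivable.app_eq[where X = X]) auto
next
  case (ty_subst_eq X \<Gamma> Y a b)
  then show ?case by (intro derivable.ty_subst_eq[where X = X]) auto
next
  case (beta X \<Gamma> b Y a)
  then show ?case by (intro derivable.beta[where X = X]) auto
next
  case (var \<Gamma> i)
  then show ?case by (intro derivable.var) auto
next
  case (ty_trans \<Gamma> X Y Z)
  then show ?case by (blast intro: derivable.ty_trans)
next
  case (tm_trans \<Gamma> t u X v)
  then show ?case by (blast intro: derivable.tm_trans)
next
  case (conv \<Gamma> t X Y)
  then show ?case by (blast intro: derivable.conv)
next
  case (conv_eq \<Gamma> t u X Y)
  then show ?case by (blast intro: derivable.conv_eq)
next
  case (ty_sym \<Gamma> X Y)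
  then show ?case by (blast intro: derivable.ty_sym)
next
  case (tm_sym \<Gamma> t u X)
  then show ?case by (blast intro: derivable.tm_sym)
qed (simp_all add: derivable.ctx_nil derivable.ctx_cons derivable.set_ty derivable.el_ty derivable.el_eq
    derivable.fun_ty derivable.fun_eq derivable.lam derivable.lam_eq derivable.eta derivable.ty_refl
    derivable.tm_refl)

locale ctt_surjection = GD: ctt_site A G D + SC: ctt_presite A S C
  for A :: "'c judgement set" and G D S C +
  fixes f :: "'c tm"
  assumes scoped_f: "scoped 0 f" and f: "GD.has [] f (Fun (El S) (famTy G))"
    and surjective_rule: "\<exists>t. GD.has [] t (Fun (El S) (Fun (famTy S)
      (Fun (El (covT G D (App f (Var (Suc 0))) (imageT S f (Var 0)))) (El (App (App C (Var 2)) (Var (Suc 0)))))))"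
begin

lemma closed_f [simp]: "ren_tm r f = f" "sub_tm s f = f"
  by (simp_all add: ren_closed sub_closed scoped_f)

lemma image_subst [simp]:
  "ren_tm r (imageT S f U) = imageT S f (ren_tm r U)"
  "sub_tm s (imageT S f U) = imageT S f (sub_tm s U)"
  by (simp_all add: imageT_def)

lemma fam_f: "GD.ctx \<Gamma> \<Longrightarrow> GD.has \<Gamma> a (El S) \<Longrightarrow> GD.fam \<Gamma> (App f a)"
  using GD.has_app[OF GD.derivable_closed[OF f], of \<Gamma> a "famTy G"] by simp

lemma fam_image:
  assumes c: "GD.ctx \<Gamma>" and U: "SC.fam \<Gamma> U"
  shows "GD.fam \<Gamma> (imageT S f U)"
proof -
  note c1 = GD.ctx_G[OF c]
  note c2 = SC.ctx_G[OF c1]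
  have U2: "SC.fam (El S # El G # \<Gamma>) (wkt (wkt U))" by (rule SC.fam_wk[OF SC.fam_wk[OF U c1] c2])
  have b: "GD.has (El S # El G # \<Gamma>) (Var (Suc 0)) (El G)"
    using GD.has_VarSuc[OF c2 GD.var_G[OF c]] by simp
  note v = SC.var_G[OF c1]
  show ?thesis
    unfolding imageT_def
    by (rule GD.fam_Lam[OF c GD.has_Sig[OF c1 SC.has_G[OF c1] derivable.lam[OF
      GD.has_and[OF c2 GD.has_fam_app[OF U2 v] GD.has_fam_app[OF fam_f[OF c2 v] b]]]]])
qed

text \<open>Surjectivity is used at the empty subset: in a trivial \<open>G\<close> the image of
  \<open>a\<close> is covered by the empty set, hence by the image of the empty subset, and this is
  reflected to \<open>a\<close>.\<close>

lemma tru_trivial_image: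
  assumes triv: "GD.tru [] (covT G D wholeT emptyT)"
  shows "GD.tru [] (covT S C wholeT emptyT)"
proof (rule SC.tru_covI[OF GD.ctx_Nil SC.fam_whole[OF GD.ctx_Nil] SC.fam_empty[OF GD.ctx_Nil]])
  let ?H = "[El (App wholeT (Var 0)), El S]"
  have c: "GD.ctx ?H" using SC.ctx_cov_hyp[OF GD.ctx_Nil SC.fam_whole[OF GD.ctx_Nil]] by simp
  have a: "GD.has ?H (Var (Suc 0)) (El S)" using GD.has_VarSuc[OF c SC.var_G[OF GD.ctx_Nil]] by simp
  let ?U = "App f (Var (Suc 0))" and ?V = "imageT S f emptyT"
  note U = fam_f[OF c a] and E = SC.fam_empty[OF c]
  note V = fam_image[OF c E]
  have "GD.tru ?H (covT G D ?U ?V)"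
  proof (rule GD.tru_covI[OF c U V])
    let ?K = "El (App (wkt ?U) (Var 0)) # El G # ?H"
    note c1 = GD.ctx_G[OF c] and c2 = GD.ctx_cov_hyp[OF c U]
    have v: "GD.has ?K (Var (Suc 0)) (El G)" using GD.has_VarSuc[OF c2 GD.var_G[OF c]] by simp
    have "GD.tru ?K (covT G D wholeT emptyT)"
      using triv GD.derivable_closed[OF _ c2] by (auto simp: GD.tru_def)
    from GD.tru_covE[OF c2 GD.fam_whole[OF c2] GD.fam_empty[OF c2] this v GD.tru_whole[OF c2 v]]
    show "GD.tru ?K (App (App D (Var (Suc 0))) (wkt (wkt ?V)))"
      by (rule GD.tru_cvr_empty[OF c2 v GD.fam_wk[OF GD.fam_wk[OF V c1] c2]])
  qed
  then obtain p where p: "GD.has ?H p (El (covT G D ?U ?V))" by (auto simp: GD.tru_def)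
  obtain t where t: "GD.has ?H t (Fun (El S) (Fun (famTy S)
      (Fun (El (covT G D (App f (Var (Suc 0))) (imageT S f (Var 0)))) (El (App (App C (Var 2)) (Var (Suc 0)))))))"
    using surjective_rule GD.derivable_closed[OF _ c] by blast
  note 1 = GD.has_app[OF t a refl, simplified]
  note 2 = GD.has_app[OF 1 E refl, simplified]
  show "GD.tru [El (App (wkt wholeT) (Var 0)), El S] (App (App C (Var (Suc 0))) (wkt (wkt emptyT)))"
    using GD.has_app[OF 2 p refl] by (auto intro: GD.truI)
qed

end

lemmas ct_defs = framework_syntax emb_def ct_whole_def ct_empty_def ct_sing_def ct_cup_def ct_covers_def
  ct_down_def ct_star_def ct_fin_def ct_value_def ct_range_def ct_image_def

lemmas raw_defs = covT_def singT_def cupT_def meetT_def downT_def starT_def finT_def rangeT_def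
  subcoverT_def imageT_def

lemma inhabited_mono: "inhabited A X \<Longrightarrow> A \<subseteq> B \<Longrightarrow> \<exists>t. derivable B [] (HasTy t (X 0))"
  unfolding inhabited_def by (blast intro: derivable_mono)

theorem CTT_no_gleason_cover:
  fixes A :: "'c judgement set"
  assumes A: "CTT \<subseteq> A" "consistent_ctt (A \<union> GUP_CTT)"
    and S: "ct_ntcr_space_in A S C"
  shows "\<not> ct_gleason_cover_in A G D S C f"
proof
  assume cover: "ct_gleason_cover_in A G D S C f"
  \<comment> \<open>Everything given over \<open>A\<close> is moved to \<open>A\<close> with the
    uniformity rule, the theory whose consistency is assumed.\<close>
  let ?A = "A \<union> GUP_CTT"
  have mono: "derivable A \<Gamma> J \<Longrightarrow> derivable ?A \<Gamma> J" for \<Gamma> J by (erule derivable_mono) simp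
  have inh: "inhabited A X \<Longrightarrow> \<exists>t. derivable ?A [] (HasTy t (X 0))" for X :: "'c pty"
    by (erule inhabited_mono) simp
  interpret ctt ?A by unfold_locales (use A in auto)
  have sc: "scoped 0 G" "scoped 0 D" "scoped 0 S" "scoped 0 C" "scoped 0 f"
    using S cover by (auto simp: ct_ntcr_space_in_def ct_gleason_cover_in_def given_space_def given_term_def)
  note cl = sc[THEN ren_closed] sc[THEN sub_closed]
  have types: "has [] G SetT" "has [] D (Fun (El G) (Fun (famTy G) SetT))" "has [] S SetT"
    "has [] C (Fun (El S) (Fun (famTy S) SetT))" "has [] f (Fun (El S) (famTy G))"
    using S cover by (auto intro!: mono simp: ct_ntcr_space_in_def ct_gleason_cover_in_def
        given_space_def given_term_def framework_syntax emb_def)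
  interpret GD: ctt_presite ?A G D by unfold_locales (fact sc types)+
  interpret SC: ctt_presite ?A S C by unfold_locales (fact sc types)+
  have "\<forall>X \<in> set (ct_gleason_cover (emb G) (emb D) (emb S) (emb C) (emb f)). \<exists>t. has [] t (X 0)"
    using cover inh by (simp add: ct_gleason_cover_in_def)
  then have space: "\<forall>X \<in> set (ct_space (emb G) (emb D)). \<exists>t. has [] t (X 0)"
    and compact: "\<forall>X \<in> set (ct_compact (emb G) (emb D)). \<exists>t. has [] t (X 0)"
    and de_morgan: "\<forall>X \<in> set (ct_de_morgan (emb G) (emb D)). \<exists>t. has [] t (X 0)"
    and surjective: "\<exists>t. has [] t (ct_surjective (emb G) (emb D) (emb S) (emb C) (emb f) 0)"
    unfolding ct_gleason_cover_def set_append ball_Un by simp_all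
  \<comment> \<open>Evaluation at depth 0 turns the host-level types into the de Bruijn forms of the
    locales, since the given terms are closed.\<close>
  interpret GD: ctt_site ?A G D
    by unfold_locales (use space in \<open>simp_all add: ct_space_def ct_defs raw_defs cl\<close>)
  interpret GD: ctt_gup ?A
    by unfold_locales simp
  interpret GD: ctt_compact_de_morgan ?A G D
    by unfold_locales
      (use de_morgan compact in \<open>simp_all add: ct_compact_def ct_de_morgan_def ct_defs raw_defs cl numeral_eq_Suc\<close>)
  interpret ctt_surjection ?A G D S C f
    by unfold_locales (use surjective sc types in \<open>simp_all add: ct_surjective_def ct_defs raw_defs cl numeral_eq_Suc\<close>)
  have "tru [] (covT S C wholeT emptyT)" by (rule tru_trivial_image[OF GD.tru_trivial])
  \<comment> \<open>Non-triviality is a list with a single type, picked out by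
    \<open>hd\<close>.\<close>
  moreover have "tru [] (impT (covT S C wholeT emptyT) (Con CN0))"
    using inh[of "hd (ct_nontrivial (emb S) (emb C))"] S
    by (simp add: ct_ntcr_space_in_def ct_nontrivial_def ct_defs raw_defs cl tru_def)
  ultimately have "tru [] (Con CN0)"
    using tru_impE[OF ctx_Nil SC.has_cov[OF ctx_Nil SC.fam_whole[OF ctx_Nil] SC.fam_empty[OF ctx_Nil]] CN0[OF ctx_Nil]]
    by blast
  then show False using A(2) by (auto simp: tru_def consistent_ctt_def inhabited_def framework_syntax)
qed

theorem mainTheorem10:
  shows "(\<forall>T :: fm set. CZF \<subseteq> T \<and> consistent_fm (T \<union> GUP_CZF) \<longrightarrow>
            (\<forall>s c. cz_ntcr_space_in T s c \<longrightarrow> \<not> (\<exists>g d p. cz_gleason_cover_in T g d s c p)))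
       \<and> (\<forall>A :: 'c judgement set. CTT \<subseteq> A \<and> consistent_ctt (A \<union> GUP_CTT) \<longrightarrow>
            (\<forall>S C. ct_ntcr_space_in A S C \<longrightarrow> \<not> (\<exists>G D f. ct_gleason_cover_in A G D S C f)))"
  using CZF_no_gleason_cover CTT_no_gleason_cover by blast

end
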